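(* Let $\{\alpha(k)\}$ be a bounded Besicovich sequence (BB-sequence) of real numbers and let $T\in C_{1,\infty}(\nabla,m)$ (i.e. $T$ is an $L_1$--$L_\infty$ contraction in $L_1(\nabla,m)$). Then for every $x\in L_1(\nabla,m)$ the averages $$a_n(T)(x)=\frac1n\sum_{k=0}^{n-1}\alpha(k)T^k(x)$$ $(o)$-converge in $L_0(\nabla,m)$. In addition, if $1<p<\infty$ and $x\in L_p(\nabla,m)$, then the sequence $a_n(T)(x)$ is order bounded in $L_p(\nabla,m)$ and $$\Big\|\sup_{n\ge1}|a_n(T)(x)|\Big\|_p\le\Big(\frac p{p-1}\Big)\sup_k|\alpha(k)|\,\|x\|_p .$$
   Context: $(\Omega,\Sigma,\mu)$ is a measure space with the direct sum property (there is a family of pairwise disjoint measurable sets of finite measure such that every measurable set of finite measure is, up to a null set, covered by countably many of them). $L_0(\Omega)$ is the algebra and order complete vector lattice of classes (mod a.e. equality) of real measurable functions on $\Omega$, with unit $\mathbf 1$; $B(\Omega)$ is the complete Boolean algebra of idempotents of $L_0(\Omega)$. $\nabla$ is a complete Boolean algebra with Stone space $X(\nabla)$; $L_0(\nabla)=C_\infty(X(\nabla))$ is the algebra and vector lattice of continuous functions $X(\nabla)\to[-\infty,+\infty]$ taking the values $\pm\infty$ only on nowhere dense sets; $L_\infty(\nabla)=C(X(\nabla))$ with the sup-norm $\|\cdot\|_\infty$. Elements of $\nabla$ are identified with idempotents of $L_0(\nabla)$. We write $L_0(\nabla,m)=L_0(\nabla)$, $L_\infty(\nabla,m)=L_\infty(\nabla)$.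 $m:\nabla\to L_0(\Omega)$ is an $L_0(\Omega)$-valued measure: $m(e)\ge0$, $m(e)=0\Leftrightarrow e=0$; $m(e\vee g)=m(e)+m(g)$ if $e\wedge g=0$; $m(e_\alpha)\downarrow0$ for every net $e_\alpha\downarrow0$. It is assumed $d$-decomposable: whenever $m(e)=a_1+a_2$ with $a_i \in L_0(\Omega)$, $a_1\wedge a_2=0$, there are $e_1,e_2\in\nabla$ with $e=e_1\vee e_2$ and $m(e_i)=a_i$. As is equivalent to $d$-decomposability, $B(\Omega)$ is identified with a regular Boolean subalgebra of $\nabla$ (suprema and infima of subsets computed in it coincide with those in $\nabla$) such that $m(qe)=q\,m(e)$ for $q\in B(\Omega)$, $e\in\nabla$; correspondingly $L_0(\Omega)\subset L_0(\nabla)$, which makes $L_0(\nabla)$ an $L_0(\Omega)$-module. It is also assumed that $m(\mathbf 1)=\mathbf 1$. For $p\ge1$, $L_p(\nabla,m)$ is the set of $x\in L_0(\nabla)$ with $|x|^p$ integrable with respect to $m$, with the $L_0(\Omega)$-valued norm $\|x\|_p=(\int|x|^p\,dm)^{1/p}$; here $\int\sum\lambda_ie_i\,dm=\sum\lambda_im(e_i)$ for simple elements, and $0\le x\in L_0(\nabla)$ is integrable iff the integrals of simple elements $0\le s\le x$ are order bounded in $L_0(\Omega)$, their supremum being $\int x\,dm$. A linear $T:L_1(\nabla,m)\to L_1(\nabla,m)$ is $L_0(\Omega)$-bounded if $\|Tx\|_1\le c\|x\|_1$ for all $x$ and some $0\le c\in L_0(\Omega)$; then $\|T\|_{L_1\to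 L_1}=\sup\{\|Tx\|_1:\|x\|_1\le\mathbf 1\}\in L_0(\Omega)$. $C_{1,\infty}(\nabla,m)$ is the set of $L_1$--$L_\infty$ contractions: $L_0(\Omega)$-bounded linear $T:L_1(\nabla,m)\to L_1(\nabla,m)$ with $\|T\|_{L_1\to L_1}\le\mathbf 1$, $T(L_\infty(\nabla,m))\subset L_\infty(\nabla,m)$ and $\|T\|_{L_\infty\to L_\infty}\le1$ (ordinary real operator norm). (It is known that such $T$ maps $L_p(\nabla,m)$ into itself.) A trigonometric polynomial is a function $P:\mathbb Z\to\mathbb C$, $P(k)=\sum_{j=1}^sr_j\lambda_j^k$, with $r_j\in\mathbb C$ and $\lambda_j\in\mathbb C$, $|\lambda_j|=1$. A sequence $\{\alpha(k)\}_{k\in\mathbb Z}$ of complex numbers is a bounded Besicovich sequence (BB-sequence) if $\sup_k|\alpha(k)|<\infty$ and for every $\varepsilon>0$ there is a trigonometric polynomial $P$ with $\limsup_{n\to\infty}\frac1n\sum_{k=0}^{n-1}|\alpha(k)-P(k)|<\varepsilon$. In a vector lattice $E$, $x_n$ $(o)$-converges to $x$ if there is a decreasing sequence $y_n\downarrow0$ in $E$ with $|x_n-x|\le y_n$. *)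

theory Defs
  imports "HOL-Analysis.Analysis" "HOL-Library.Lattice_Algebras"
begin

text \<open>The library class \<open>complete_boolean_algebra\<close> demands complete distributivity and hence
  only admits atomic algebras, so it is too narrow for measure algebras.\<close>

class complete_ba = boolean_algebra + complete_lattice

definition ultrafilters :: "'b::boolean_algebra set set" where
  "ultrafilters = {U. top \<in> U \<and> bot \<notin> U \<and> (\<forall>a b. inf a b \<in> U \<longleftrightarrow> a \<in> U \<and> b \<in> U) \<and>
     (\<forall>a. - a \<in> U \<longleftrightarrow> a \<notin> U)}"

definition stone_set :: "'b::boolean_algebra \<Rightarrow> 'b set set" where
  "stone_set e = {U \<in> ultrafilters. e \<in> U}"

definition stone :: "'b::boolean_algebra set topology" where
  "stone = topology_generated_by (range stone_set)"

lemma topspace_stone [simp]: "topspace stone = ultrafilters"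
  unfolding stone_def topology_generated_by_topspace
  by (auto simp: stone_set_def) (auto simp: ultrafilters_def)

lemma openin_stone_set [simp, intro]: "openin stone (stone_set e)"
  unfolding stone_def by (rule topology_generated_by_Basis) simp

lemma stone_set_inf: "stone_set (inf a b) = stone_set a \<inter> stone_set b"
  by (auto simp: stone_set_def ultrafilters_def)

lemma stone_set_compl: "stone_set (- a) = ultrafilters - stone_set a"
  by (auto simp: stone_set_def ultrafilters_def)

lemma stone_set_subset: "stone_set a \<subseteq> ultrafilters"
  by (auto simp: stone_set_def)

lemma closedin_stone_set [simp, intro]: "closedin stone (stone_set e)"
  unfolding closedin_def using openin_stone_set[of "- e"] stone_set_subset[of e]
  by (simp add: stone_set_compl)

lemma openin_stone_base:
  assumes "openin stone V" "U \<in> V"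
  obtains a where "U \<in> stone_set a" "stone_set a \<subseteq> V"
proof -
  have "generate_topology_on (range stone_set) V"
    using assms(1) unfolding stone_def by (rule openin_topology_generated_by)
  then have "\<forall>U\<in>V. \<exists>a. U \<in> stone_set a \<and> stone_set a \<subseteq> V"
  proof induction
    case (Int A B)
    show ?case
    proof
      fix U assume "U \<in> A \<inter> B"
      with Int obtain a b where "U \<in> stone_set a" "stone_set a \<subseteq> A" "U \<in> stone_set b" "stone_set b \<subseteq> B"
        by blast
      then show "\<exists>a. U \<in> stone_set a \<and> stone_set a \<subseteq> A \<inter> B"
        by (intro exI[of _ "inf a b"]) (auto simp: stone_set_inf)
    qed
  qed (auto, meson UnionI Union_upper order_trans)
  with assms(2) that show thesis by blast
qed

lemma ex_ultrafilter:
  fixes a :: "'b::boolean_algebra"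
  assumes "a \<noteq> bot"
  shows "stone_set a \<noteq> {}"
proof -
  define fil where "fil = {F::'b set. a \<in> F \<and> bot \<notin> F \<and> (\<forall>x y. inf x y \<in> F \<longleftrightarrow> x \<in> F \<and> y \<in> F)}"
  have "\<exists>M\<in>fil. \<forall>X\<in>fil. M \<subseteq> X \<longrightarrow> X = M"
  proof (rule Zorn_Lemma2, intro ballI)
    fix C assume C: "C \<in> chains fil"
    have sub: "C \<subseteq> fil" and ch: "\<And>x y. x \<in> C \<Longrightarrow> y \<in> C \<Longrightarrow> x \<subseteq> y \<or> y \<subseteq> x"
      using C by (auto dest: chainsD chainsD2)
    show "\<exists>U\<in>fil. \<forall>X\<in>C. X \<subseteq> U"
    proof (cases "C = {}")
      case True
      have "{x. a \<le> x} \<in> fil" using assms by (auto simp: fil_def bot_unique)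
      then show ?thesis using True by blast
    next
      case False
      have "\<Union>C \<in> fil"
      proof -
        have 1: "a \<in> \<Union>C" "bot \<notin> \<Union>C" using False sub by (auto simp: fil_def)
        have 2: "inf x y \<in> \<Union>C \<longleftrightarrow> x \<in> \<Union>C \<and> y \<in> \<Union>C" for x y
        proof
          assume "inf x y \<in> \<Union>C"
          then show "x \<in> \<Union>C \<and> y \<in> \<Union>C" using sub by (auto simp: fil_def)
        next
          assume "x \<in> \<Union>C \<and> y \<in> \<Union>C"
          then obtain X Y where "x \<in> X" "X \<in> C" "y \<in> Y" "Y \<in> C" by blast
          with ch[of X Y] have "\<exists>Z\<in>C. x \<in> Z \<and> y \<in> Z" by blast
          then show "inf x y \<in> \<Union>C" using sub by (auto simp: fil_def)
        qed
        from 1 2 show ?thesis unfolding fil_def by blast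
      qed
      then show ?thesis by blast
    qed
  qed
  then obtain M where M: "M \<in> fil" and max: "\<And>X. X \<in> fil \<Longrightarrow> M \<subseteq> X \<Longrightarrow> X = M" by blast
  have inf: "inf x y \<in> M \<longleftrightarrow> x \<in> M \<and> y \<in> M" for x y
    using M by (auto simp: fil_def)
  have bot: "bot \<notin> M" and a: "a \<in> M"
    using M by (auto simp: fil_def)
  have up: "x \<in> M \<Longrightarrow> x \<le> y \<Longrightarrow> y \<in> M" for x y
    using inf[of x y] by (simp add: inf.absorb1)
  have "top \<in> M" using up[OF a] by simp
  have compl: "- x \<in> M \<longleftrightarrow> x \<notin> M" for x
  proof
    assume "- x \<in> M" then show "x \<notin> M" using inf[of x "- x"] bot by auto
  next
    assume x: "x \<notin> M"
    define N where "N = {z. \<exists>y\<in>M. inf y x \<le> z}"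
    have sub: "M \<subseteq> N" by (auto simp: N_def intro: le_infI1)
    have xN: "x \<in> N" using a by (auto simp: N_def)
    have "N \<notin> fil" using max[OF _ sub] xN x by blast
    moreover have "inf u v \<in> N \<longleftrightarrow> u \<in> N \<and> v \<in> N" for u v
    proof
      assume "u \<in> N \<and> v \<in> N"
      then obtain y z where "y \<in> M" "inf y x \<le> u" "z \<in> M" "inf z x \<le> v" by (auto simp: N_def)
      moreover have "inf (inf y z) x \<le> inf y x" "inf (inf y z) x \<le> inf z x"
        by (meson inf_le1 inf_le2 inf_mono le_infI1 order_refl)+
      ultimately have "inf y z \<in> M" "inf (inf y z) x \<le> u" "inf (inf y z) x \<le> v" using inf
        by (blast, meson order_trans, meson order_trans)
      then show "inf u v \<in> N" by (auto simp: N_def)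
    qed (auto simp: N_def)
    ultimately have "bot \<in> N" using sub a by (auto simp: fil_def)
    then obtain y where "y \<in> M" "inf y x = bot" by (auto simp: N_def bot_unique)
    then have "y \<le> - x" by (metis inf_shunt)
    with \<open>y \<in> M\<close> show "- x \<in> M" by (rule up)
  qed
  have "M \<in> stone_set a"
    unfolding stone_set_def ultrafilters_def using inf bot a compl \<open>top \<in> M\<close> by blast
  then show ?thesis by blast
qed

lemma openin_closure_of_stone:
  fixes V :: "'b::complete_ba set set"
  assumes "openin stone V"
  shows "openin stone (stone closure_of V)"
proof -
  define s where "s = Sup {e. stone_set e \<subseteq> V}"
  have mono: "a \<le> b \<Longrightarrow> stone_set a \<subseteq> stone_set b" for a b :: 'b
    using stone_set_inf[of a b] by (auto simp: inf.absorb1)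
  have "stone closure_of V = stone_set s"
  proof
    show "stone closure_of V \<subseteq> stone_set s"
    proof (rule closure_of_minimal)
      show "V \<subseteq> stone_set s"
      proof
        fix U assume "U \<in> V"
        with assms obtain a where "U \<in> stone_set a" "stone_set a \<subseteq> V" by (rule openin_stone_base)
        moreover from this have "a \<le> s" unfolding s_def by (auto intro: Sup_upper)
        ultimately show "U \<in> stone_set s" using mono by blast
      qed
    qed simp
  next
    show "stone_set s \<subseteq> stone closure_of V"
    proof
      fix U assume U: "U \<in> stone_set s"
      have "\<exists>y\<in>V. y \<in> T" if "U \<in> T" "openin stone T" for T
      proof -
        obtain a where a: "U \<in> stone_set a" "stone_set a \<subseteq> T"
          using \<open>openin stone T\<close> \<open>U \<in> T\<close> by (rule openin_stone_base)
        have "\<exists>e. stone_set e \<subseteq> V \<and> inf a e \<noteq> bot"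
        proof (rule ccontr)
          assume *: "\<not> ?thesis"
          have "s \<le> - a" unfolding s_def
            by (rule Sup_least) (metis "*" inf_commute inf_shunt mem_Collect_eq)
          then have "U \<in> stone_set (- a)" using U mono by blast
          with a show False by (simp add: stone_set_compl)
        qed
        then obtain e where e: "stone_set e \<subseteq> V" "inf a e \<noteq> bot" by blast
        with ex_ultrafilter[OF e(2)] a show ?thesis by (auto simp: stone_set_inf)
      qed
      then show "U \<in> stone closure_of V"
        unfolding in_closure_of using U stone_set_subset by fastforce
    qed
  qed
  then show ?thesis by simp
qed

lemma continuous_map_order_topology:
  fixes f :: "'a \<Rightarrow> 'c::order_topology"
  assumes "\<And>c. openin X {t \<in> topspace X. c < f t}" "\<And>c. openin X {t \<in> topspace X. f t < c}"
  shows "continuous_map X euclidean f"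
  unfolding continuous_map_def
proof (intro conjI allI impI)
  fix U :: "'c set" assume "openin euclidean U"
  then have "generate_topology (range (\<lambda>a. {..< a}) \<union> range (\<lambda>a. {a <..})) U"
    using open_generated_order by (metis open_openin)
  then show "openin X {x \<in> topspace X. f x \<in> U}"
  proof induction
    case UNIV
    then show ?case by simp
  next
    case (Int a b)
    have "{x \<in> topspace X. f x \<in> a \<inter> b} = {x \<in> topspace X. f x \<in> a} \<inter> {x \<in> topspace X. f x \<in> b}"
      by auto
    with Int show ?case by auto
  next
    case (UN K)
    have "{x \<in> topspace X. f x \<in> \<Union>K} = \<Union>((\<lambda>k. {x \<in> topspace X. f x \<in> k}) ` K)"
      by auto
    with UN show ?case by auto
  next
    case (Basis s)
    with assms show ?case by auto
  qed
qed auto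

text \<open>Upper semicontinuous regularisation; on an extremally disconnected space it turns lower
  semicontinuous functions into continuous ones. This yields sums and suprema in \<open>C\<^sub>\<infinity>\<close>.\<close>

definition usc_hull :: "'a topology \<Rightarrow> ('a \<Rightarrow> ereal) \<Rightarrow> 'a \<Rightarrow> ereal" where
  "usc_hull X g t = (INF V\<in>{V. openin X V \<and> t \<in> V}. SUP s\<in>V. g s)"

lemma usc_hull_upper: "t \<in> topspace X \<Longrightarrow> g t \<le> usc_hull X g t"
  unfolding usc_hull_def by (intro INF_greatest) (auto intro: SUP_upper)

lemma usc_hull_lessE:
  assumes "usc_hull X g t < c"
  obtains V where "openin X V" "t \<in> V" "(SUP s\<in>V. g s) < c"
  using assms unfolding usc_hull_def by (auto simp: INF_less_iff)

lemma usc_hull_least: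
  assumes "continuous_map X euclidean h" "\<And>s. s \<in> topspace X \<Longrightarrow> g s \<le> h s" "t \<in> topspace X"
  shows "usc_hull X g t \<le> h t"
proof (rule dense_ge)
  fix c assume c: "h t < c"
  have "openin X {s \<in> topspace X. h s \<in> {..<c}}"
    using assms(1) by (rule openin_continuous_map_preimage) (simp add: open_openin[symmetric])
  then have "usc_hull X g t \<le> (SUP s\<in>{s \<in> topspace X. h s \<in> {..<c}}. g s)"
    unfolding usc_hull_def using c assms(3) by (intro INF_lower) auto
  also have "\<dots> \<le> c" using assms(2) by (intro SUP_least) (auto intro: order_trans less_imp_le)
  finally show "usc_hull X g t \<le> c" .
qed

lemma continuous_map_usc_hull:
  assumes ed: "\<And>V. openin X V \<Longrightarrow> openin X (X closure_of V)"
    and lsc: "\<And>c. openin X {t \<in> topspace X. c < g t}"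
  shows "continuous_map X euclidean (usc_hull X g)"
proof (rule continuous_map_order_topology)
  fix c
  have "\<exists>W. openin X W \<and> t \<in> W \<and> W \<subseteq> {t \<in> topspace X. c < usc_hull X g t}"
    if t: "t \<in> topspace X" "c < usc_hull X g t" for t
  proof -
    obtain d where d: "c < d" "d < usc_hull X g t" using dense[OF t(2)] by blast
    let ?W = "X closure_of {t \<in> topspace X. d < g t}"
    have "t \<in> ?W" unfolding in_closure_of
    proof (intro conjI allI impI)
      fix T assume T: "t \<in> T \<and> openin X T"
      then have "d < (SUP s\<in>T. g s)"
        using less_INF_D[OF d(2)[unfolded usc_hull_def], of T] by auto
      then obtain s where "s \<in> T" "d < g s" by (auto simp: less_SUP_iff)
      then show "\<exists>y. y \<in> {t \<in> topspace X. d < g t} \<and> y \<in> T"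
        using T openin_subset by blast
    qed (fact t)
    moreover have "d \<le> usc_hull X g s" if s: "s \<in> ?W" for s
      unfolding usc_hull_def
    proof (rule INF_greatest)
      fix V assume "V \<in> {V. openin X V \<and> s \<in> V}"
      then obtain y where "y \<in> V" "d < g y" using s unfolding in_closure_of by auto
      then show "d \<le> (SUP s\<in>V. g s)" by (meson SUP_upper2 less_imp_le)
    qed
    ultimately show ?thesis
      using ed[OF lsc[of d]] d(1) closure_of_subset_topspace[of X]
      by (intro exI[of _ ?W]) (auto intro: less_le_trans)
  qed
  then show "openin X {t \<in> topspace X. c < usc_hull X g t}"
    by (subst openin_subopen) auto
next
  fix c
  have "\<exists>W. openin X W \<and> t \<in> W \<and> W \<subseteq> {t \<in> topspace X. usc_hull X g t < c}"
    if t: "usc_hull X g t < c" for t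
  proof -
    obtain V where V: "openin X V" "t \<in> V" "(SUP s\<in>V. g s) < c" using t by (rule usc_hull_lessE)
    have "usc_hull X g s \<le> (SUP s\<in>V. g s)" if "s \<in> V" for s
      unfolding usc_hull_def using V that by (intro INF_lower) auto
    then show ?thesis using V openin_subset[OF V(1)] by (intro exI[of _ V]) (auto intro: le_less_trans)
  qed
  then show "openin X {t \<in> topspace X. usc_hull X g t < c}"
    by (subst openin_subopen) auto
qed

lemma usc_hull_eq:
  assumes "openin X D" "t \<in> D" "continuous_map (subtopology X D) euclidean g"
  shows "usc_hull X g t = g t"
proof (rule antisym)
  show "usc_hull X g t \<le> g t"
  proof (rule dense_ge)
    fix c assume c: "g t < c"
    have "openin (subtopology X D) {s \<in> topspace (subtopology X D). g s \<in> {..<c}}"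
      using assms(3) by (rule openin_continuous_map_preimage) (simp add: open_openin[symmetric])
    then have "openin X {s \<in> topspace (subtopology X D). g s \<in> {..<c}}"
      using assms(1) openin_open_subtopology by blast
    then have "usc_hull X g t \<le> (SUP s\<in>{s \<in> topspace (subtopology X D). g s \<in> {..<c}}. g s)"
      unfolding usc_hull_def using c assms(1,2) openin_subset by (intro INF_lower) auto
    also have "\<dots> \<le> c" by (intro SUP_least) auto
    finally show "usc_hull X g t \<le> c" .
  qed
  show "g t \<le> usc_hull X g t" using assms(1,2) openin_subset by (intro usc_hull_upper) auto
qed

definition dense_open :: "'a topology \<Rightarrow> 'a set \<Rightarrow> bool" where
  "dense_open X D \<longleftrightarrow> openin X D \<and> X closure_of D = topspace X"

lemma dense_open_Int: "dense_open X A \<Longrightarrow> dense_open X B \<Longrightarrow> dense_open X (A \<inter> B)"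
  unfolding dense_open_def
  by (metis closure_of_openin_Int_superset openin_Int openin_subset)

lemma dense_open_mono: "dense_open X A \<Longrightarrow> A \<subseteq> B \<Longrightarrow> openin X B \<Longrightarrow> dense_open X B"
  unfolding dense_open_def
  by (metis closure_of_mono closure_of_subset_topspace subset_antisym)

lemma dense_open_eq:
  fixes f g :: "'a \<Rightarrow> 'c::t2_space"
  assumes "dense_open X D" "continuous_map X euclidean f" "continuous_map X euclidean g"
    "\<And>t. t \<in> D \<Longrightarrow> f t = g t" "t \<in> topspace X"
  shows "f t = g t"
  by (rule forall_in_closure_of_eq[of t X D euclidean])
     (use assms in \<open>auto simp: dense_open_def Hausdorff_space_def disjnt_def open_openin[symmetric] separation_t2\<close>)

lemma extend_ereal:
  fixes g :: "'a \<Rightarrow> ereal"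
  assumes ed: "\<And>V. openin X V \<Longrightarrow> openin X (X closure_of V)"
    and D: "openin X D" and g: "continuous_map (subtopology X D) euclidean g"
  obtains h where "continuous_map X euclidean h" "\<And>t. t \<in> D \<Longrightarrow> h t = g t"
proof -
  define g' where "g' t = (if t \<in> D then g t else -\<infinity>)" for t
  have g': "continuous_map (subtopology X D) euclidean g'"
    by (rule continuous_map_eq[OF g]) (auto simp: g'_def)
  have sub: "D \<subseteq> topspace X" using D openin_subset by blast
  have "openin X {t \<in> topspace X. c < g' t}" for c
  proof -
    have "openin (subtopology X D) {s \<in> topspace (subtopology X D). g s \<in> {c<..}}"
      using g by (rule openin_continuous_map_preimage) (simp add: open_openin[symmetric])
    then have "openin X {s \<in> topspace (subtopology X D). g s \<in> {c<..}}"
      using D openin_open_subtopology by blast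
    also have "{s \<in> topspace (subtopology X D). g s \<in> {c<..}} = {t \<in> topspace X. c < g' t}"
      using sub by (auto simp: g'_def split: if_splits)
    finally show ?thesis .
  qed
  then have "continuous_map X euclidean (usc_hull X g')"
    by (intro continuous_map_usc_hull ed)
  moreover have "usc_hull X g' t = g t" if "t \<in> D" for t
    using usc_hull_eq[OF D that g'] that by (simp add: g'_def)
  ultimately show thesis using that by blast
qed

text \<open>\<open>C\<^sub>\<infinity>(X)\<close> for the Stone space \<open>X\<close> of ultrafilters. Since \<open>X\<close> is a set and not a type (it is empty
  for the one-element algebra), the functions are normalised to \<open>0\<close> off \<open>X\<close>.\<close>

typedef (overloaded) 'b L0 = "{f :: 'b::complete_ba set \<Rightarrow> ereal.
    continuous_map stone euclidean f \<and>
    stone interior_of (stone closure_of {t \<in> ultrafilters. \<bar>f t\<bar> = \<infinity>}) = {} \<and>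
    (\<forall>t. t \<notin> ultrafilters \<longrightarrow> f t = 0)}"
  morphisms L0_val Abs_L0
  by (rule exI[of _ "\<lambda>_. 0"]) auto

setup_lifting type_definition_L0

lemma closedin_infinite_stone:
  assumes "continuous_map stone euclidean (f :: 'b::complete_ba set \<Rightarrow> ereal)"
  shows "closedin stone {t \<in> ultrafilters. \<bar>f t\<bar> = \<infinity>}"
proof -
  have "closedin stone {t \<in> topspace stone. f t \<in> {\<infinity>, -\<infinity>}}"
    using assms by (rule closedin_continuous_map_preimage) auto
  also have "{t \<in> topspace stone. f t \<in> {\<infinity>, -\<infinity>}} = {t \<in> ultrafilters. \<bar>f t\<bar> = \<infinity>}"
    by auto
  finally show ?thesis .
qed

lemma nowhere_dense_iff_dense_open:
  assumes "continuous_map stone euclidean (f :: 'b::complete_ba set \<Rightarrow> ereal)"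
  shows "stone interior_of (stone closure_of {t \<in> ultrafilters. \<bar>f t\<bar> = \<infinity>}) = {} \<longleftrightarrow>
    dense_open stone {t \<in> ultrafilters. \<bar>f t\<bar> \<noteq> \<infinity>}"
proof -
  let ?I = "{t \<in> ultrafilters. \<bar>f t\<bar> = \<infinity>}"
  have eq: "{t \<in> ultrafilters. \<bar>f t\<bar> \<noteq> \<infinity>} = topspace stone - ?I" by auto
  have "stone closure_of ?I = ?I" "openin stone (topspace stone - ?I)"
    using closedin_infinite_stone[OF assms] by (simp_all only: closure_of_closedin closedin_def)
  then show ?thesis unfolding eq dense_open_def closure_of_complement
    using interior_of_subset_topspace[of stone ?I] by auto
qed

definition fin_set :: "'b::complete_ba L0 \<Rightarrow> 'b set set" where
  "fin_set x = {t \<in> ultrafilters. \<bar>L0_val x t\<bar> \<noteq> \<infinity>}"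

lemma continuous_val: "continuous_map stone euclidean (L0_val x)"
  and val_outside [simp]: "t \<notin> ultrafilters \<Longrightarrow> L0_val x t = 0"
  using L0_val[of x] by auto

lemma dense_open_fin_set [intro]: "dense_open stone (fin_set x)"
  using L0_val[of x] nowhere_dense_iff_dense_open[OF continuous_val, of x] by (auto simp: fin_set_def)

lemma Abs_L0_cases:
  fixes f :: "'b::complete_ba set \<Rightarrow> ereal"
  assumes "continuous_map stone euclidean f" "dense_open stone D"
    "\<And>t. t \<in> D \<Longrightarrow> \<bar>f t\<bar> \<noteq> \<infinity>" "\<And>t. t \<notin> ultrafilters \<Longrightarrow> f t = 0"
  shows "f \<in> {f. continuous_map stone euclidean f \<and>
    stone interior_of (stone closure_of {t \<in> ultrafilters. \<bar>f t\<bar> = \<infinity>}) = {} \<and>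
    (\<forall>t. t \<notin> ultrafilters \<longrightarrow> f t = 0)}"
proof -
  have "dense_open stone {t \<in> ultrafilters. \<bar>f t\<bar> \<noteq> \<infinity>}"
  proof (rule dense_open_mono[OF assms(2)])
    show "D \<subseteq> {t \<in> ultrafilters. \<bar>f t\<bar> \<noteq> \<infinity>}"
      using assms(2,3) openin_subset by (fastforce simp: dense_open_def)
    have "openin stone (topspace stone - {t \<in> ultrafilters. \<bar>f t\<bar> = \<infinity>})"
      using closedin_infinite_stone[OF assms(1)] by (auto simp: closedin_def)
    then show "openin stone {t \<in> ultrafilters. \<bar>f t\<bar> \<noteq> \<infinity>}"
      by (rule back_subst) auto
  qed
  with assms nowhere_dense_iff_dense_open[OF assms(1)] show ?thesis by auto
qed

lemma L0_eqI:
  assumes "dense_open stone D" "\<And>t. t \<in> D \<Longrightarrow> L0_val x t = L0_val y t"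
  shows "x = y"
proof -
  have "L0_val x t = L0_val y t" for t
    by (cases "t \<in> ultrafilters")
       (use dense_open_eq[OF assms(1) continuous_val continuous_val, of x y] assms(2) in auto)
  then show ?thesis by (metis ext L0_val_inject)
qed

lemma continuous_map_max:
  fixes f g :: "'a \<Rightarrow> 'c::linorder_topology"
  assumes "continuous_map X euclidean f" "continuous_map X euclidean g"
  shows "continuous_map X euclidean (\<lambda>t. max (f t) (g t))"
    and "continuous_map X euclidean (\<lambda>t. min (f t) (g t))"
proof -
  have *: "openin X {t \<in> topspace X. c < f t}" "openin X {t \<in> topspace X. f t < c}"
    if "continuous_map X euclidean f" for f and c :: 'c
    using openin_continuous_map_preimage[OF that, of "{c<..}"]
      openin_continuous_map_preimage[OF that, of "{..<c}"] by auto
  have "{t \<in> topspace X. c < max (f t) (g t)} = {t \<in> topspace X. c < f t} \<union> {t \<in> topspace X. c < g t}"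
    "{t \<in> topspace X. max (f t) (g t) < c} = {t \<in> topspace X. f t < c} \<inter> {t \<in> topspace X. g t < c}"
    "{t \<in> topspace X. c < min (f t) (g t)} = {t \<in> topspace X. c < f t} \<inter> {t \<in> topspace X. c < g t}"
    "{t \<in> topspace X. min (f t) (g t) < c} = {t \<in> topspace X. f t < c} \<union> {t \<in> topspace X. g t < c}"
    for c by (auto simp: less_max_iff_disj min_less_iff_disj)
  note eq = this
  show "continuous_map X euclidean (\<lambda>t. max (f t) (g t))"
    by (rule continuous_map_order_topology; unfold eq)
       (intro openin_Un openin_Int *[OF assms(1)] *[OF assms(2)])+
  show "continuous_map X euclidean (\<lambda>t. min (f t) (g t))"
    by (rule continuous_map_order_topology; unfold eq)
       (intro openin_Un openin_Int *[OF assms(1)] *[OF assms(2)])+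
qed

lemma continuous_map_comp_ereal:
  fixes h :: "ereal \<Rightarrow> ereal"
  assumes "continuous_map X euclidean f" "continuous_on UNIV h"
  shows "continuous_map X euclidean (\<lambda>t. h (f t))"
  using continuous_map_compose[OF assms(1), of euclidean h] assms(2) by (simp add: comp_def)

lemma ex1_L0:
  fixes g :: "'b::complete_ba set \<Rightarrow> real"
  assumes D: "dense_open stone D" and g: "continuous_map (subtopology stone D) euclidean g"
  shows "\<exists>!z. \<forall>t\<in>D. L0_val z t = ereal (g t)"
proof (rule ex_ex1I)
  have "continuous_map (subtopology stone D) euclidean (\<lambda>t. ereal (g t))"
    using continuous_map_compose[OF g, of euclidean ereal] by (simp add: comp_def continuous_on_ereal)
  then obtain h where h: "continuous_map stone euclidean h" "\<And>t. t \<in> D \<Longrightarrow> h t = ereal (g t)"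
    using extend_ereal[OF openin_closure_of_stone] D unfolding dense_open_def by metis
  let ?h = "\<lambda>t. if t \<in> ultrafilters then h t else 0"
  have sub: "D \<subseteq> ultrafilters" using D openin_subset unfolding dense_open_def by fastforce
  have "L0_val (Abs_L0 ?h) = ?h"
  proof (rule Abs_L0_inverse, rule Abs_L0_cases[OF _ D])
    show "continuous_map stone euclidean ?h" by (rule continuous_map_eq[OF h(1)]) auto
  qed (use h(2) sub in auto)
  then show "\<exists>z. \<forall>t\<in>D. L0_val z t = ereal (g t)"
    using h(2) sub by (intro exI[of _ "Abs_L0 ?h"]) auto
qed (auto intro!: L0_eqI[OF D])

lemma continuous_real_val:
  assumes "D \<subseteq> fin_set x"
  shows "continuous_map (subtopology stone D) euclidean (\<lambda>t. real_of_ereal (L0_val x t))"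
proof -
  have "continuous_map (subtopology stone D) (top_of_set (UNIV - {\<infinity>, -\<infinity>})) (L0_val x)"
    unfolding continuous_map_in_subtopology
    using continuous_map_from_subtopology[OF continuous_val] assms by (auto simp: fin_set_def)
  then show ?thesis
    using continuous_map_compose[of _ _ "L0_val x" euclidean real_of_ereal] continuous_on_real
    by (simp add: comp_def)
qed

text \<open>The sum is the unique element that is the pointwise sum wherever both summands are finite.\<close>

instantiation L0 :: (complete_ba) "{zero, plus, uminus, minus, scaleR}"
begin

lift_definition zero_L0 :: "'a L0" is "\<lambda>_. 0" by auto

definition plus_L0 :: "'a L0 \<Rightarrow> 'a L0 \<Rightarrow> 'a L0" where
  "x + y = (THE z. \<forall>t. \<bar>L0_val x t\<bar> \<noteq> \<infinity> \<and> \<bar>L0_val y t\<bar> \<noteq> \<infinity> \<longrightarrow> L0_val z t = L0_val x t + L0_val y t)"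

lift_definition scaleR_L0 :: "real \<Rightarrow> 'a L0 \<Rightarrow> 'a L0" is "\<lambda>c f t. ereal c * f t"
proof -
  fix c :: real and f :: "'a set \<Rightarrow> ereal"
  assume f: "continuous_map stone euclidean f \<and>
      stone interior_of (stone closure_of {t \<in> ultrafilters. \<bar>f t\<bar> = \<infinity>}) = {} \<and>
      (\<forall>t. t \<notin> ultrafilters \<longrightarrow> f t = 0)"
  have 1: "continuous_map stone euclidean (\<lambda>t. ereal c * f t)"
    by (rule continuous_map_comp_ereal[where h = "\<lambda>u. ereal c * u"])
       (use f in \<open>auto simp: continuous_on_def intro!: tendsto_intros\<close>)
  have "dense_open stone {t \<in> ultrafilters. \<bar>f t\<bar> \<noteq> \<infinity>}"
    using f nowhere_dense_iff_dense_open by blast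
  moreover have "\<bar>ereal c * u\<bar> \<noteq> \<infinity>" if "\<bar>u\<bar> \<noteq> \<infinity>" for u
    using that by (cases u) auto
  ultimately show "continuous_map stone euclidean (\<lambda>t. ereal c * f t) \<and>
      stone interior_of (stone closure_of {t \<in> ultrafilters. \<bar>ereal c * f t\<bar> = \<infinity>}) = {} \<and>
      (\<forall>t. t \<notin> ultrafilters \<longrightarrow> ereal c * f t = 0)"
    using Abs_L0_cases[OF 1, of "{t \<in> ultrafilters. \<bar>f t\<bar> \<noteq> \<infinity>}"] f by auto
qed

definition uminus_L0 :: "'a L0 \<Rightarrow> 'a L0" where "- x = (- 1) *\<^sub>R (x :: 'a L0)"
definition minus_L0 :: "'a L0 \<Rightarrow> 'a L0 \<Rightarrow> 'a L0" where "x - y = x + - (y :: 'a L0)"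
instance ..
end

lemma val_zero [simp]: "L0_val 0 t = 0" by transfer simp
lemma val_scaleR [simp]: "L0_val (c *\<^sub>R x) t = ereal c * L0_val x t" by transfer simp
lemma val_uminus [simp]: "L0_val (- x) t = - L0_val x t"
  by (cases "L0_val x t") (auto simp: uminus_L0_def)

lemma val_plus:
  assumes "\<bar>L0_val x t\<bar> \<noteq> \<infinity>" "\<bar>L0_val y t\<bar> \<noteq> \<infinity>"
  shows "L0_val (x + y) t = L0_val x t + L0_val y t"
proof -
  let ?D = "fin_set x \<inter> fin_set y"
  have D: "dense_open stone ?D" by (intro dense_open_Int dense_open_fin_set)
  have c: "continuous_map (subtopology stone ?D) euclidean
      (\<lambda>t. real_of_ereal (L0_val x t) + real_of_ereal (L0_val y t))"
    by (intro continuous_map_add continuous_real_val) auto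
  have eq: "(\<forall>t. \<bar>L0_val x t\<bar> \<noteq> \<infinity> \<and> \<bar>L0_val y t\<bar> \<noteq> \<infinity> \<longrightarrow> L0_val z t = L0_val x t + L0_val y t) \<longleftrightarrow>
    (\<forall>t\<in>?D. L0_val z t = ereal (real_of_ereal (L0_val x t) + real_of_ereal (L0_val y t)))" for z
  proof -
    have "L0_val x t + L0_val y t = ereal (real_of_ereal (L0_val x t) + real_of_ereal (L0_val y t))"
      if "\<bar>L0_val x t\<bar> \<noteq> \<infinity>" "\<bar>L0_val y t\<bar> \<noteq> \<infinity>" for t
      using that by (cases "L0_val x t"; cases "L0_val y t") auto
    then have "L0_val z t = L0_val x t + L0_val y t \<longleftrightarrow>
        L0_val z t = ereal (real_of_ereal (L0_val x t) + real_of_ereal (L0_val y t))"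
      if "\<bar>L0_val x t\<bar> \<noteq> \<infinity>" "\<bar>L0_val y t\<bar> \<noteq> \<infinity>" for t
      using that by metis
    moreover have "L0_val z t = L0_val x t + L0_val y t" if "t \<notin> ultrafilters" for t
      using that by simp
    moreover have "t \<in> ?D \<longleftrightarrow> t \<in> ultrafilters \<and> \<bar>L0_val x t\<bar> \<noteq> \<infinity> \<and> \<bar>L0_val y t\<bar> \<noteq> \<infinity>" for t
      unfolding fin_set_def mem_Collect_eq Int_iff by argo
    ultimately show ?thesis by meson
  qed
  have "\<forall>t. \<bar>L0_val x t\<bar> \<noteq> \<infinity> \<and> \<bar>L0_val y t\<bar> \<noteq> \<infinity> \<longrightarrow> L0_val (x + y) t = L0_val x t + L0_val y t"
  proof -
    have P: "\<exists>!z. \<forall>t. \<bar>L0_val x t\<bar> \<noteq> \<infinity> \<and> \<bar>L0_val y t\<bar> \<noteq> \<infinity> \<longrightarrow> L0_val z t = L0_val x t + L0_val y t"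
      unfolding eq by (rule ex1_L0[OF D c])
    show ?thesis using theI'[OF P] unfolding plus_L0_def .
  qed
  from this[rule_format, OF conjI[OF assms]] show ?thesis .
qed

lemma fin_set_uminus [simp]: "fin_set (- x) = fin_set x"
  by (simp add: fin_set_def)

lemma fin_set_scaleR: "fin_set x \<subseteq> fin_set (c *\<^sub>R x)"
  by (auto simp: fin_set_def)

lemma fin_set_plus: "fin_set x \<inter> fin_set y \<subseteq> fin_set (x + y)"
  by (auto simp: fin_set_def val_plus)

lemma val_real: "t \<in> fin_set x \<Longrightarrow> \<exists>r. L0_val x t = ereal r"
  by (cases "L0_val x t") (auto simp: fin_set_def)

instance L0 :: (complete_ba) real_vector
proof
  fix x y z :: "'a L0" and a b :: real
  note [intro] = dense_open_Int
  have D: "dense_open stone (fin_set x \<inter> fin_set y \<inter> fin_set z)" by blast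
  note eqI = L0_eqI[OF D]
  show "x + y + z = x + (y + z)"
  proof (rule eqI)
    fix t assume t: "t \<in> fin_set x \<inter> fin_set y \<inter> fin_set z"
    then obtain p q r where "L0_val x t = ereal p" "L0_val y t = ereal q" "L0_val z t = ereal r"
      using val_real by (metis IntE)
    then show "L0_val (x + y + z) t = L0_val (x + (y + z)) t" by (simp add: val_plus)
  qed
  show "x + y = y + x"
  proof (rule eqI)
    fix t assume t: "t \<in> fin_set x \<inter> fin_set y \<inter> fin_set z"
    then obtain p q where "L0_val x t = ereal p" "L0_val y t = ereal q"
      using val_real by (metis IntE)
    then show "L0_val (x + y) t = L0_val (y + x) t" by (simp add: val_plus)
  qed
  show "0 + x = x"
    by (rule L0_eqI[OF dense_open_fin_set[of x]]) (auto simp: val_plus fin_set_def)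
  show "- x + x = 0"
    by (rule L0_eqI[OF dense_open_fin_set[of x]], drule val_real) (auto simp: val_plus)
  show "x - y = x + - y" by (simp add: minus_L0_def)
  show "a *\<^sub>R (x + y) = a *\<^sub>R x + a *\<^sub>R y"
  proof (rule eqI)
    fix t assume t: "t \<in> fin_set x \<inter> fin_set y \<inter> fin_set z"
    then obtain p q where "L0_val x t = ereal p" "L0_val y t = ereal q"
      using val_real by (metis IntE)
    then show "L0_val (a *\<^sub>R (x + y)) t = L0_val (a *\<^sub>R x + a *\<^sub>R y) t"
      by (simp add: val_plus algebra_simps)
  qed
  show "(a + b) *\<^sub>R x = a *\<^sub>R x + b *\<^sub>R x"
    by (rule L0_eqI[OF dense_open_fin_set[of x]], drule val_real) (auto simp: val_plus algebra_simps)
  show "a *\<^sub>R b *\<^sub>R x = (a * b) *\<^sub>R x"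
    by (rule L0_eqI[OF dense_open_fin_set[of x]], drule val_real) (auto simp: algebra_simps)
  show "1 *\<^sub>R x = x"
    by (rule L0_eqI[OF dense_open_fin_set[of x]], drule val_real) (auto simp: algebra_simps)
qed

instantiation L0 :: (complete_ba) "{lattice, abs}"
begin

definition less_eq_L0 :: "'a L0 \<Rightarrow> 'a L0 \<Rightarrow> bool" where
  "x \<le> y \<longleftrightarrow> (\<forall>t. L0_val x t \<le> L0_val y t)"
definition less_L0 :: "'a L0 \<Rightarrow> 'a L0 \<Rightarrow> bool" where
  "x < y \<longleftrightarrow> x \<le> y \<and> \<not> y \<le> (x :: 'a L0)"

lemma L0_closed_max_min:
  fixes x y :: "'a L0"
  shows "L0_val (Abs_L0 (\<lambda>t. max (L0_val x t) (L0_val y t))) t = max (L0_val x t) (L0_val y t)"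
    and "L0_val (Abs_L0 (\<lambda>t. min (L0_val x t) (L0_val y t))) t = min (L0_val x t) (L0_val y t)"
proof -
  have D: "dense_open stone (fin_set x \<inter> fin_set y)" by (intro dense_open_Int dense_open_fin_set)
  show "L0_val (Abs_L0 (\<lambda>t. max (L0_val x t) (L0_val y t))) t = max (L0_val x t) (L0_val y t)"
    by (subst Abs_L0_inverse, rule Abs_L0_cases[OF _ D])
       (auto intro!: continuous_map_max continuous_val simp: fin_set_def split: split_max)
  show "L0_val (Abs_L0 (\<lambda>t. min (L0_val x t) (L0_val y t))) t = min (L0_val x t) (L0_val y t)"
    by (subst Abs_L0_inverse, rule Abs_L0_cases[OF _ D])
       (auto intro!: continuous_map_max continuous_val simp: fin_set_def split: split_min)
qed

definition sup_L0 :: "'a L0 \<Rightarrow> 'a L0 \<Rightarrow> 'a L0" where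
  "sup x y = Abs_L0 (\<lambda>t. max (L0_val x t) (L0_val y t))"
definition inf_L0 :: "'a L0 \<Rightarrow> 'a L0 \<Rightarrow> 'a L0" where
  "inf x y = Abs_L0 (\<lambda>t. min (L0_val x t) (L0_val y t))"
definition abs_L0 :: "'a L0 \<Rightarrow> 'a L0" where
  "\<bar>x\<bar> = sup x (- x :: 'a L0)"

lemma L0_antisym: "x \<le> y \<Longrightarrow> y \<le> x \<Longrightarrow> x = (y :: 'a L0)"
  unfolding less_eq_L0_def by (metis antisym ext L0_val_inject)

lemma L0_trans: "x \<le> y \<Longrightarrow> y \<le> z \<Longrightarrow> x \<le> (z :: 'a L0)"
  unfolding less_eq_L0_def by (meson order_trans)

instance
proof
  fix x y z :: "'a L0"
  show "x < y \<longleftrightarrow> x \<le> y \<and> \<not> y \<le> x" by (rule less_L0_def)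
  show "x \<le> x" by (simp add: less_eq_L0_def)
  show "x \<le> y \<Longrightarrow> y \<le> z \<Longrightarrow> x \<le> z" by (rule L0_trans)
  show "x \<le> y \<Longrightarrow> y \<le> x \<Longrightarrow> x = y" by (rule L0_antisym)
  show "inf x y \<le> x" "inf x y \<le> y" "x \<le> y \<Longrightarrow> x \<le> z \<Longrightarrow> x \<le> inf y z"
    "x \<le> sup x y" "y \<le> sup x y" "y \<le> x \<Longrightarrow> z \<le> x \<Longrightarrow> sup y z \<le> x"
    by (auto simp: less_eq_L0_def sup_L0_def inf_L0_def L0_closed_max_min)
qed
end

instantiation L0 :: (complete_ba) conditionally_complete_lattice
begin

definition Sup_L0 :: "'a L0 set \<Rightarrow> 'a L0" where
  "Sup (S :: 'a L0 set) = (THE z. (\<forall>x\<in>S. x \<le> z) \<and> (\<forall>u. (\<forall>x\<in>S. x \<le> u) \<longrightarrow> z \<le> u))"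
definition Inf_L0 :: "'a L0 set \<Rightarrow> 'a L0" where
  "Inf (S :: 'a L0 set) = (THE z. (\<forall>x\<in>S. z \<le> x) \<and> (\<forall>u. (\<forall>x\<in>S. u \<le> x) \<longrightarrow> u \<le> z))"

lemma ex_lub_L0:
  fixes S :: "'a L0 set"
  assumes "x0 \<in> S" "\<forall>x\<in>S. x \<le> u0"
  shows "\<exists>z. (\<forall>x\<in>S. x \<le> z) \<and> (\<forall>u. (\<forall>x\<in>S. x \<le> u) \<longrightarrow> z \<le> u)"
proof -
  define g where "g t = (SUP x\<in>S. L0_val x t)" for t
  define h where "h t = (if t \<in> ultrafilters then usc_hull stone g t else 0)" for t
  have lsc: "openin stone {t \<in> topspace stone. c < g t}" for c
  proof -
    have "{t \<in> topspace stone. c < g t} = (\<Union>x\<in>S. {t \<in> topspace stone. L0_val x t \<in> {c<..}})"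
      by (auto simp: g_def less_SUP_iff)
    also have "openin stone \<dots>"
      by (intro openin_Union ballI) (force intro!: openin_continuous_map_preimage[OF continuous_val])
    finally show ?thesis .
  qed
  have hc: "continuous_map stone euclidean h"
    by (rule continuous_map_eq[OF continuous_map_usc_hull[OF openin_closure_of_stone lsc]])
       (auto simp: h_def)
  have le: "h t \<le> L0_val u t" if "\<forall>x\<in>S. x \<le> u" for u t
    using usc_hull_least[OF continuous_val[of u], of g t] that
    by (auto simp: h_def g_def less_eq_L0_def intro!: SUP_least)
  have ge: "L0_val x t \<le> h t" if "x \<in> S" for x t
  proof (cases "t \<in> ultrafilters")
    case True
    have "L0_val x t \<le> g t" using that by (auto simp: g_def intro: SUP_upper)
    also have "g t \<le> h t" using usc_hull_upper[of t stone g] True by (auto simp: h_def)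
    finally show ?thesis .
  qed (auto simp: h_def)
  have "L0_val (Abs_L0 h) = h"
  proof (rule Abs_L0_inverse, rule Abs_L0_cases[OF hc])
    show "dense_open stone (fin_set x0 \<inter> fin_set u0)" by (intro dense_open_Int dense_open_fin_set)
    fix t assume "t \<in> fin_set x0 \<inter> fin_set u0"
    then show "\<bar>h t\<bar> \<noteq> \<infinity>" using le[OF assms(2), of t] ge[OF assms(1), of t]
      by (auto simp: fin_set_def)
  qed (auto simp: h_def)
  then show ?thesis using le ge
    by (intro exI[of _ "Abs_L0 h"]) (auto simp: less_eq_L0_def)
qed

lemma ex_glb_L0:
  fixes S :: "'a L0 set"
  assumes "x0 \<in> S" "\<forall>x\<in>S. u0 \<le> x"
  shows "\<exists>z. (\<forall>x\<in>S. z \<le> x) \<and> (\<forall>u. (\<forall>x\<in>S. u \<le> x) \<longrightarrow> u \<le> z)"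
proof -
  have "\<exists>z. (\<forall>x\<in>{u. \<forall>x\<in>S. u \<le> x}. x \<le> z) \<and> (\<forall>u. (\<forall>x\<in>{u. \<forall>x\<in>S. u \<le> x}. x \<le> u) \<longrightarrow> z \<le> u)"
    by (rule ex_lub_L0[of u0 _ x0]) (use assms in auto)
  then show ?thesis by blast
qed

lemma lub_Sup_L0:
  fixes S :: "'a L0 set"
  assumes "x0 \<in> S" "\<forall>x\<in>S. x \<le> u0"
  shows "(\<forall>x\<in>S. x \<le> Sup S) \<and> (\<forall>u. (\<forall>x\<in>S. x \<le> u) \<longrightarrow> Sup S \<le> u)"
proof -
  have "\<exists>!z. (\<forall>x\<in>S. x \<le> z) \<and> (\<forall>u. (\<forall>x\<in>S. x \<le> u) \<longrightarrow> z \<le> u)"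
  proof (rule ex_ex1I[OF ex_lub_L0[OF assms]])
    fix z z' assume "(\<forall>x\<in>S. x \<le> z) \<and> (\<forall>u. (\<forall>x\<in>S. x \<le> u) \<longrightarrow> z \<le> u)" "(\<forall>x\<in>S. x \<le> z') \<and> (\<forall>u. (\<forall>x\<in>S. x \<le> u) \<longrightarrow> z' \<le> u)"
    then show "z = z'" by (intro order.antisym) simp_all
  qed
  from theI'[OF this] show ?thesis by (simp only: Sup_L0_def)
qed

lemma glb_Inf_L0:
  fixes S :: "'a L0 set"
  assumes "x0 \<in> S" "\<forall>x\<in>S. u0 \<le> x"
  shows "(\<forall>x\<in>S. Inf S \<le> x) \<and> (\<forall>u. (\<forall>x\<in>S. u \<le> x) \<longrightarrow> u \<le> Inf S)"
proof -
  have "\<exists>!z. (\<forall>x\<in>S. z \<le> x) \<and> (\<forall>u. (\<forall>x\<in>S. u \<le> x) \<longrightarrow> u \<le> z)"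
  proof (rule ex_ex1I[OF ex_glb_L0[OF assms]])
    fix z z' assume "(\<forall>x\<in>S. z \<le> x) \<and> (\<forall>u. (\<forall>x\<in>S. u \<le> x) \<longrightarrow> u \<le> z)" "(\<forall>x\<in>S. z' \<le> x) \<and> (\<forall>u. (\<forall>x\<in>S. u \<le> x) \<longrightarrow> u \<le> z')"
    then show "z = z'" by (intro order.antisym) simp_all
  qed
  from theI'[OF this] show ?thesis by (simp only: Inf_L0_def)
qed

instance
proof
  fix x z :: "'a L0" and S :: "'a L0 set"
  show "x \<in> S \<Longrightarrow> bdd_below S \<Longrightarrow> Inf S \<le> x"
    using glb_Inf_L0 by (auto simp: bdd_below_def)
  show "x \<in> S \<Longrightarrow> bdd_above S \<Longrightarrow> x \<le> Sup S"
    using lub_Sup_L0 by (auto simp: bdd_above_def)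
  show "S \<noteq> {} \<Longrightarrow> (\<And>x. x \<in> S \<Longrightarrow> z \<le> x) \<Longrightarrow> z \<le> Inf S"
    using glb_Inf_L0 by (metis all_not_in_conv)
  show "S \<noteq> {} \<Longrightarrow> (\<And>x. x \<in> S \<Longrightarrow> x \<le> z) \<Longrightarrow> Sup S \<le> z"
    using lub_Sup_L0 by (metis all_not_in_conv)
qed
end

lemma val_sup: "L0_val (sup x y) t = max (L0_val x t) (L0_val y t)"
  and val_inf: "L0_val (inf x y) t = min (L0_val x t) (L0_val y t)"
  by (auto simp: sup_L0_def inf_L0_def L0_closed_max_min)

lemma val_abs: "L0_val \<bar>x\<bar> t = \<bar>L0_val x t\<bar>"
  by (cases "L0_val x t") (auto simp: abs_L0_def val_sup max_def)

lemma L0_leI: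
  assumes "dense_open stone D" "\<And>t. t \<in> D \<Longrightarrow> L0_val x t \<le> L0_val y t"
  shows "x \<le> y"
proof -
  have "sup x y = y" by (rule L0_eqI[OF assms(1)]) (use assms(2) in \<open>auto simp: val_sup\<close>)
  then show ?thesis by (metis sup_ge1)
qed

instance L0 :: (complete_ba) lattice_ab_group_add_abs
proof
  fix x y z :: "'a L0"
  assume le: "x \<le> y"
  have D: "dense_open stone (fin_set x \<inter> fin_set y \<inter> fin_set z)"
    by (intro dense_open_Int dense_open_fin_set)
  show "z + x \<le> z + y"
  proof (rule L0_leI[OF D])
    fix t assume t: "t \<in> fin_set x \<inter> fin_set y \<inter> fin_set z"
    then show "L0_val (z + x) t \<le> L0_val (z + y) t" using le
      by (auto simp: val_plus less_eq_L0_def fin_set_def intro: add_left_mono)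
  qed
qed (rule abs_L0_def)

instance L0 :: (complete_ba) ordered_real_vector
proof
  fix x y :: "'a L0" and a b :: real
  show "x \<le> y \<Longrightarrow> 0 \<le> a \<Longrightarrow> a *\<^sub>R x \<le> a *\<^sub>R y"
    by (auto simp: less_eq_L0_def intro: ereal_mult_left_mono)
  show "a \<le> b \<Longrightarrow> 0 \<le> x \<Longrightarrow> a *\<^sub>R x \<le> b *\<^sub>R x"
    by (auto simp: less_eq_L0_def intro: ereal_mult_right_mono)
qed

text \<open>This is \<open>\<bar>x\<bar>\<^sup>p\<close> only for \<open>p > 0\<close>; otherwise the function need not lie in \<open>C\<^sub>\<infinity>\<close>.\<close>

definition abs_powr :: "'b::complete_ba L0 \<Rightarrow> real \<Rightarrow> 'b L0" where
  "abs_powr x p = Abs_L0 (\<lambda>t. if \<bar>L0_val x t\<bar> = \<infinity> then \<infinity> else ereal (\<bar>real_of_ereal (L0_val x t)\<bar> powr p))"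

lemma val_abs_powr:
  assumes "p > 0"
  shows "L0_val (abs_powr x p) t =
    (if \<bar>L0_val x t\<bar> = \<infinity> then \<infinity> else ereal (\<bar>real_of_ereal (L0_val x t)\<bar> powr p))"
proof -
  define h where "h u = (if \<bar>u\<bar> = \<infinity> then \<infinity> else ereal (\<bar>real_of_ereal u\<bar> powr p))" for u :: ereal
  have *: "ereal r < h u \<longleftrightarrow> ereal (r powr (1/p)) < \<bar>u\<bar>" "h u < ereal r \<longleftrightarrow> \<bar>u\<bar> < ereal (r powr (1/p))"
    if "r \<ge> 0" for u r
  proof -
    have e: "(r powr (1/p)) powr p = r" using that assms by (simp add: powr_powr)
    have "r < \<bar>v\<bar> powr p \<longleftrightarrow> r powr (1/p) < \<bar>v\<bar>" "\<bar>v\<bar> powr p < r \<longleftrightarrow> \<bar>v\<bar> < r powr (1/p)" for v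
      using powr_less_mono2[of p "r powr (1/p)" "\<bar>v\<bar>"] powr_mono2[of p "\<bar>v\<bar>" "r powr (1/p)"]
        powr_less_mono2[of p "\<bar>v\<bar>" "r powr (1/p)"] powr_mono2[of p "r powr (1/p)" "\<bar>v\<bar>"] assms e
      by (auto simp: not_less[symmetric])
    then show "ereal r < h u \<longleftrightarrow> ereal (r powr (1/p)) < \<bar>u\<bar>"
      "h u < ereal r \<longleftrightarrow> \<bar>u\<bar> < ereal (r powr (1/p))"
      by (cases u; auto simp: h_def)+
  qed
  have h0: "0 \<le> h u" for u by (auto simp: h_def)
  have c: "continuous_map stone euclidean (\<lambda>t. h (L0_val x t))"
  proof (rule continuous_map_order_topology)
    note pre = openin_continuous_map_preimage[OF continuous_val[of "\<bar>x\<bar>"], unfolded val_abs]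
    fix c
    show "openin stone {t \<in> topspace stone. c < h (L0_val x t)}"
    proof (cases "c < 0")
      case True
      then have "{t \<in> topspace stone. c < h (L0_val x t)} = topspace stone"
        using h0 by (auto intro: less_le_trans)
      then show ?thesis by (metis openin_topspace)
    next
      case False
      show ?thesis
      proof (cases c)
        case (real r)
        with False show ?thesis using pre[of "{ereal (r powr (1/p))<..}"] *(1)[of r] by simp
      qed (use False in auto)
    qed
    show "openin stone {t \<in> topspace stone. h (L0_val x t) < c}"
    proof (cases "c \<le> 0")
      case True
      then have "{t \<in> topspace stone. h (L0_val x t) < c} = {}"
        using h0 by (auto simp: not_less intro: order_trans)
      then show ?thesis by (metis openin_empty)
    next
      case False
      show ?thesis
      proof (cases c)
        case (real r)
        with False show ?thesis using pre[of "{..<ereal (r powr (1/p))}"] *(2)[of r] by simp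
      next
        case PInf
        have "h u < \<infinity> \<longleftrightarrow> \<bar>u\<bar> < \<infinity>" for u by (auto simp: h_def)
        then show ?thesis using pre[of "{..<\<infinity>}"] PInf by simp
      qed (use False in auto)
    qed
  qed
  have "L0_val (Abs_L0 (\<lambda>t. h (L0_val x t))) = (\<lambda>t. h (L0_val x t))"
    by (rule Abs_L0_inverse, rule Abs_L0_cases[OF c dense_open_fin_set[of x]])
       (auto simp: h_def fin_set_def)
  from fun_cong[OF this, of t] show ?thesis by (simp only: abs_powr_def h_def)
qed

lemma val_indicator_L0_aux:
  "(\<lambda>t. indicator (stone_set (e::'b::complete_ba)) t :: ereal) \<in> {f. continuous_map stone euclidean f \<and>
    stone interior_of (stone closure_of {t \<in> ultrafilters. \<bar>f t\<bar> = \<infinity>}) = {} \<and>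
    (\<forall>t. t \<notin> ultrafilters \<longrightarrow> f t = 0)}"
proof (rule Abs_L0_cases[where D = "topspace stone"])
  show "continuous_map stone euclidean (indicator (stone_set e) :: _ \<Rightarrow> ereal)"
    unfolding continuous_map_def
  proof (intro conjI allI impI)
    fix U :: "ereal set"
    have "{t \<in> topspace stone. indicator (stone_set e) t \<in> U} =
      (if 1 \<in> U then stone_set e else {}) \<union> (if 0 \<in> U then stone_set (- e) else {})"
      using stone_set_subset[of e] by (auto simp: stone_set_compl indicator_def)
    then show "openin stone {t \<in> topspace stone. indicator (stone_set e) t \<in> U}" by auto
  qed auto
  show "dense_open stone (topspace stone)"
    unfolding dense_open_def using openin_topspace closure_of_topspace by (intro conjI)
qed (auto simp: indicator_def stone_set_def)

text \<open>The idempotent of \<open>L\<^sub>0(\<nabla>)\<close> with which \<open>e\<close> is identified.\<close>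

lift_definition idem_L0 :: "'b::complete_ba \<Rightarrow> 'b L0" is "\<lambda>e t. indicator (stone_set e) t"
  using val_indicator_L0_aux by simp

lemma val_idem: "L0_val (idem_L0 e) t = indicator (stone_set e) t" by transfer simp

definition o_converges :: "(nat \<Rightarrow> 'a::{order, ab_group_add, abs}) \<Rightarrow> 'a \<Rightarrow> bool" where
  "o_converges X x \<longleftrightarrow> (\<exists>y. decseq y \<and> (\<forall>n. 0 \<le> y n) \<and> (\<forall>z. (\<forall>n. z \<le> y n) \<longrightarrow> z \<le> 0) \<and>
     (\<forall>n. \<bar>X n - x\<bar> \<le> y n))"


definition direct_sum_property :: "'w measure \<Rightarrow> bool" where
  "direct_sum_property M \<longleftrightarrow> (\<exists>F \<subseteq> sets M. disjoint F \<and> (\<forall>A\<in>F. emeasure M A < \<infinity>) \<and>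
     (\<forall>A\<in>sets M. emeasure M A < \<infinity> \<longrightarrow> (\<exists>C\<subseteq>F. countable C \<and> A - \<Union>C \<in> null_sets M)))"

text \<open>Elements of \<open>L\<^sub>0(\<Omega>)\<close> are given by measurable representatives, and equality and order between
  them are read almost everywhere. In particular suprema and infima are those of the
  vector lattice of classes, not pointwise ones, and \<open>L0_Sup\<close> picks some representative.\<close>

definition L0_upper :: "'w measure \<Rightarrow> ('w \<Rightarrow> real) set \<Rightarrow> ('w \<Rightarrow> real) \<Rightarrow> bool" where
  "L0_upper M S g \<longleftrightarrow> g \<in> borel_measurable M \<and> (\<forall>f\<in>S. AE w in M. f w \<le> g w)"

definition L0_lower :: "'w measure \<Rightarrow> ('w \<Rightarrow> real) set \<Rightarrow> ('w \<Rightarrow> real) \<Rightarrow> bool" where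
  "L0_lower M S g \<longleftrightarrow> g \<in> borel_measurable M \<and> (\<forall>f\<in>S. AE w in M. g w \<le> f w)"

definition L0_is_sup :: "'w measure \<Rightarrow> ('w \<Rightarrow> real) set \<Rightarrow> ('w \<Rightarrow> real) \<Rightarrow> bool" where
  "L0_is_sup M S g \<longleftrightarrow> L0_upper M S g \<and> (\<forall>h. L0_upper M S h \<longrightarrow> (AE w in M. g w \<le> h w))"

definition L0_is_inf :: "'w measure \<Rightarrow> ('w \<Rightarrow> real) set \<Rightarrow> ('w \<Rightarrow> real) \<Rightarrow> bool" where
  "L0_is_inf M S g \<longleftrightarrow> L0_lower M S g \<and> (\<forall>h. L0_lower M S h \<longrightarrow> (AE w in M. h w \<le> g w))"

definition L0_Sup :: "'w measure \<Rightarrow> ('w \<Rightarrow> real) set \<Rightarrow> 'w \<Rightarrow> real" where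
  "L0_Sup M S = (SOME g. L0_is_sup M S g)"

text \<open>The last clause is order continuity along nets \<open>e\<^sub>\<alpha> \<down> 0\<close>: the set of values of such a net is
  downward directed with infimum \<open>0\<close>, and conversely such a set is a decreasing net indexed by
  itself.\<close>

definition L0_measure :: "'w measure \<Rightarrow> ('b::complete_ba \<Rightarrow> 'w \<Rightarrow> real) \<Rightarrow> bool" where
  "L0_measure M m \<longleftrightarrow>
     (\<forall>e. m e \<in> borel_measurable M) \<and>
     (\<forall>e. AE w in M. 0 \<le> m e w) \<and>
     (\<forall>e. (AE w in M. m e w = 0) \<longleftrightarrow> e = bot) \<and>
     (\<forall>e g. inf e g = bot \<longrightarrow> (AE w in M. m (sup e g) w = m e w + m g w)) \<and>
     (\<forall>D. D \<noteq> {} \<and> (\<forall>a\<in>D. \<forall>b\<in>D. \<exists>c\<in>D. c \<le> a \<and> c \<le> b) \<and> Inf D = bot \<longrightarrow>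
        L0_is_inf M (m ` D) (\<lambda>_. 0))"

definition d_decomposable :: "'w measure \<Rightarrow> ('b::complete_ba \<Rightarrow> 'w \<Rightarrow> real) \<Rightarrow> bool" where
  "d_decomposable M m \<longleftrightarrow>
     (\<forall>e. \<forall>a1\<in>borel_measurable M. \<forall>a2\<in>borel_measurable M.
        (AE w in M. m e w = a1 w + a2 w) \<and> (AE w in M. min (a1 w) (a2 w) = 0) \<longrightarrow>
        (\<exists>e1 e2. e = sup e1 e2 \<and> (AE w in M. m e1 w = a1 w) \<and> (AE w in M. m e2 w = a2 w)))"

text \<open>The idempotents of \<open>L\<^sub>0(\<Omega>)\<close> are the classes of indicators of measurable sets, so
  \<open>B(\<Omega>)\<close> is \<open>sets M\<close> modulo null sets, and \<open>\<iota> A\<close> is the element of \<open>\<nabla>\<close> identified with the class of \<open>A\<close>.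
  The first three clauses make \<open>\<iota>\<close> an injective Boolean homomorphism on classes. The next one says
  that \<open>B(\<Omega>)\<close> is complete and regular in \<open>\<nabla>\<close>: as \<open>\<iota>\<close> is an order embedding, the class of \<open>S\<close>
  is then the supremum (infimum) of the classes in \<open>\<A>\<close> computed in \<open>B(\<Omega>)\<close>.\<close>

definition regular_embedding ::
  "'w measure \<Rightarrow> ('b::complete_ba \<Rightarrow> 'w \<Rightarrow> real) \<Rightarrow> ('w set \<Rightarrow> 'b) \<Rightarrow> bool" where
  "regular_embedding M m \<iota> \<longleftrightarrow>
     (\<forall>A\<in>sets M. \<forall>B\<in>sets M. \<iota> (A \<union> B) = sup (\<iota> A) (\<iota> B)) \<and>
     (\<forall>A\<in>sets M. \<iota> (space M - A) = - \<iota> A) \<and>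
     (\<forall>A\<in>sets M. \<iota> A = bot \<longleftrightarrow> A \<in> null_sets M) \<and>
     (\<forall>\<A>\<subseteq>sets M. (\<exists>S\<in>sets M. \<iota> S = Sup (\<iota> ` \<A>)) \<and> (\<exists>S\<in>sets M. \<iota> S = Inf (\<iota> ` \<A>))) \<and>
     (\<forall>A\<in>sets M. \<forall>e. AE w in M. m (inf (\<iota> A) e) w = indicator A w * m e w)"


text \<open>All representations of a simple element between \<open>0\<close> and \<open>x\<close> are taken, with \<open>e i\<close> not necessarily disjoint;
  by additivity of \<open>m\<close> they give the same integral almost everywhere.\<close>

definition lower_integrals :: "('b::complete_ba \<Rightarrow> 'w \<Rightarrow> real) \<Rightarrow> 'b L0 \<Rightarrow> ('w \<Rightarrow> real) set" where
  "lower_integrals m x =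
     {\<lambda>w. \<Sum>i<n. c i * m (e i) w | (n::nat) c e.
        0 \<le> (\<Sum>i<n. c i *\<^sub>R idem_L0 (e i)) \<and> (\<Sum>i<n. c i *\<^sub>R idem_L0 (e i)) \<le> x}"

definition m_integrable :: "'w measure \<Rightarrow> ('b::complete_ba \<Rightarrow> 'w \<Rightarrow> real) \<Rightarrow> 'b L0 \<Rightarrow> bool" where
  "m_integrable M m x \<longleftrightarrow> 0 \<le> x \<and> (\<exists>g. L0_upper M (lower_integrals m x) g)"

definition m_integral :: "'w measure \<Rightarrow> ('b::complete_ba \<Rightarrow> 'w \<Rightarrow> real) \<Rightarrow> 'b L0 \<Rightarrow> 'w \<Rightarrow> real" where
  "m_integral M m x = L0_Sup M (lower_integrals m x)"

definition Lp :: "'w measure \<Rightarrow> ('b::complete_ba \<Rightarrow> 'w \<Rightarrow> real) \<Rightarrow> real \<Rightarrow> 'b L0 set" where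
  "Lp M m p = {x. m_integrable M m (abs_powr x p)}"

definition Lp_norm ::
  "'w measure \<Rightarrow> ('b::complete_ba \<Rightarrow> 'w \<Rightarrow> real) \<Rightarrow> real \<Rightarrow> 'b L0 \<Rightarrow> 'w \<Rightarrow> real" where
  "Lp_norm M m p x w = m_integral M m (abs_powr x p) w powr (1 / p)"

definition Linf :: "'b::complete_ba L0 set" where
  "Linf = {x. \<forall>t. \<bar>L0_val x t\<bar> \<noteq> \<infinity>}"

text \<open>The points off the Stone space contribute only the value \<open>0\<close>.\<close>

definition Linf_norm :: "'b::complete_ba L0 \<Rightarrow> ereal" where
  "Linf_norm x = (SUP t. \<bar>L0_val x t\<bar>)"

definition L1_opnorm ::
  "'w measure \<Rightarrow> ('b::complete_ba \<Rightarrow> 'w \<Rightarrow> real) \<Rightarrow> ('b L0 \<Rightarrow> 'b L0) \<Rightarrow> 'w \<Rightarrow> real" where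
  "L1_opnorm M m T =
     L0_Sup M {Lp_norm M m 1 (T x) | x. x \<in> Lp M m 1 \<and> (AE w in M. Lp_norm M m 1 x w \<le> 1)}"

definition Linf_opnorm :: "('b::complete_ba L0 \<Rightarrow> 'b L0) \<Rightarrow> ereal" where
  "Linf_opnorm T = (SUP x\<in>{x \<in> Linf. Linf_norm x \<le> 1}. Linf_norm (T x))"

text \<open>Operators are total functions on \<open>L\<^sub>0(\<nabla>)\<close> of which only the restriction to \<open>L\<^sub>1\<close> matters.\<close>

definition C1inf :: "'w measure \<Rightarrow> ('b::complete_ba \<Rightarrow> 'w \<Rightarrow> real) \<Rightarrow> ('b L0 \<Rightarrow> 'b L0) set" where
  "C1inf M m = {T.
     (\<forall>x\<in>Lp M m 1. T x \<in> Lp M m 1) \<and>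
     (\<forall>x\<in>Lp M m 1. \<forall>y\<in>Lp M m 1. T (x + y) = T x + T y) \<and>
     (\<forall>r. \<forall>x\<in>Lp M m 1. T (r *\<^sub>R x) = r *\<^sub>R T x) \<and>
     (\<exists>c\<in>borel_measurable M. (AE w in M. 0 \<le> c w) \<and>
        (\<forall>x\<in>Lp M m 1. AE w in M. Lp_norm M m 1 (T x) w \<le> c w * Lp_norm M m 1 x w)) \<and>
     (AE w in M. L1_opnorm M m T w \<le> 1) \<and>
     (\<forall>x\<in>Linf. T x \<in> Linf) \<and>
     Linf_opnorm T \<le> 1}"


definition trig_poly :: "(int \<Rightarrow> complex) \<Rightarrow> bool" where
  "trig_poly P \<longleftrightarrow> (\<exists>(s::nat) r l. (\<forall>j\<in>{1..s}. cmod (l j) = 1) \<and>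
     P = (\<lambda>k. \<Sum>j=1..s. r j * l j powi k))"

definition BB_sequence :: "(int \<Rightarrow> complex) \<Rightarrow> bool" where
  "BB_sequence \<alpha> \<longleftrightarrow> bdd_above (range (\<lambda>k. cmod (\<alpha> k))) \<and>
     (\<forall>\<epsilon>>0. \<exists>P. trig_poly P \<and>
        limsup (\<lambda>n. ereal (1 / real n * (\<Sum>k<n. cmod (\<alpha> (int k) - P (int k))))) < ereal \<epsilon>)"

definition weighted_avg ::
  "(int \<Rightarrow> real) \<Rightarrow> ('a::real_vector \<Rightarrow> 'a) \<Rightarrow> nat \<Rightarrow> 'a \<Rightarrow> 'a" where
  "weighted_avg \<alpha> T n x = (1 / real n) *\<^sub>R (\<Sum>k<n. \<alpha> (int k) *\<^sub>R (T ^^ k) x)"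

end

theory Submission
  imports Defs
begin

text \<open>The proof works with the \<open>L\<^sub>0(\<Omega>)\<close>-valued integral throughout, almost everywhere on \<open>\<Omega>\<close>; no reduction to
  scalar measures is possible in general, as \<open>B(\<Omega>)\<close> need not carry any. Chacon's filling scheme gives a maximal
  inequality for averages of the orbit of a not necessarily positive \<open>T\<close> with arbitrary weights bounded by 1.
  Integrated over the levels by means of Young's inequality it becomes the bound on the maximal function in
  \<open>L\<^sub>p\<close>. For convergence, consider first weights \<open>cos (k \<theta> + \<phi>)\<close> and a bounded \<open>x\<close>: \<open>T\<close> contracts \<open>L\<^sub>2\<close>, so by
  the parallelogram law the averages are Cauchy in \<open>L\<^sub>2\<close>, and the maximal inequality turns this into convergence
  at the points of the Stone space outside a meager set. Trigonometric polynomials approximate the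
  Besicovitch weights uniformly on bounded \<open>x\<close>, and truncation together with the maximal inequality extends the
  convergence to \<open>L\<^sub>1\<close>. Convergence outside a meager set is order convergence in \<open>C\<^sub>\<infinity>\<close>.\<close>

section \<open>Points of the Stone space outside a meager set\<close>

text \<open>Two kinds of exceptional sets run side by side: null sets of Omega for the values of the
  integral, and meager subsets of the Stone space for the elements of L_0(nabla). Both absorb only
  countably many exceptions, so levels, tolerances and indices are made to range over rationals or
  numbers \<open>1 / real (Suc r)\<close>. The bridge from the first kind to the second is
  \<open>generic_escape\<close>, which rests on the strict positivity of \<open>m\<close>. It has to
  tolerate indices that depend on the point of Omega, since an L_0(Omega)-valued norm may tend to 0
  at no uniform rate; for the same reason nearly minimal indices are chosen separately at almost
  every point. The operator is assumed to be real linear, so its behaviour under restriction to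
  elements of B(Omega) is extracted from the L_0(Omega)-valued bound on its norm
  (\<open>T_local\<close>). The constant \<open>p / (p - 1)\<close> goes back to the shape of the
  maximal inequality: \<open>a * m e\<close> is bounded by the integral of the absolute value of
  \<open>x\<close> over \<open>e\<close> alone, as in Doob's inequality for martingales.\<close>

lemma ex_ultrafilter_decseq:
  fixes a :: "nat \<Rightarrow> 'b::boolean_algebra"
  assumes nz: "\<And>n. a n \<noteq> bot" and dec: "decseq a"
  obtains U where "U \<in> ultrafilters" "\<And>n. a n \<in> U"
proof -
  \<comment> \<open>Proper filters that contain the whole sequence; a maximal one is an ultrafilter.
    In the Stone space this is compactness: a decreasing sequence of nonempty clopen sets has a
    common point.\<close>
  define fil where "fil = {F::'b set. range a \<subseteq> F \<and> bot \<notin> F \<and>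
    (\<forall>x y. inf x y \<in> F \<longleftrightarrow> x \<in> F \<and> y \<in> F)}"
  have up: "y \<in> F" if "F \<in> fil" "x \<in> F" "x \<le> y" for F x y
    using that by (simp add: fil_def) (metis inf.absorb1)
  have "\<exists>M\<in>fil. \<forall>X\<in>fil. M \<subseteq> X \<longrightarrow> X = M"
  proof (rule subset_Zorn_nonempty)
    have "inf x y \<in> {x. \<exists>n. a n \<le> x}" if xy: "x \<in> {x. \<exists>n. a n \<le> x}" "y \<in> {x. \<exists>n. a n \<le> x}" for x y
    proof -
      obtain i j where "a i \<le> x" "a j \<le> y" using xy by blast
      moreover have "a (max i j) \<le> a i" "a (max i j) \<le> a j" using dec by (auto simp: decseq_def)
      ultimately show ?thesis by (auto intro: order_trans)
    qed
    then have "inf x y \<in> {x. \<exists>n. a n \<le> x} \<longleftrightarrow> x \<in> {x. \<exists>n. a n \<le> x} \<and> y \<in> {x. \<exists>n. a n \<le> x}" for x y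
      by auto
    then have "{x. \<exists>n. a n \<le> x} \<in> fil"
      unfolding fil_def using nz by (auto simp: bot_unique)
    then show "fil \<noteq> {}" by blast
  next
    fix C assume C: "C \<noteq> {}" "subset.chain fil C"
    have ch: "\<exists>Z\<in>C. x \<in> Z \<and> y \<in> Z" if "x \<in> X" "X \<in> C" "y \<in> Y" "Y \<in> C" for x y X Y
    proof -
      have "X \<subseteq> Y \<or> Y \<subseteq> X" using C(2) that(2,4) by (auto simp: subset_chain_def)
      then show ?thesis using that by blast
    qed
    have sub: "C \<subseteq> fil" using C(2) by (auto simp: subset_chain_def)
    have "inf x y \<in> \<Union>C \<longleftrightarrow> x \<in> \<Union>C \<and> y \<in> \<Union>C" for x y
    proof
      assume "inf x y \<in> \<Union>C"
      then show "x \<in> \<Union>C \<and> y \<in> \<Union>C" using sub by (auto simp: fil_def)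
    next
      assume "x \<in> \<Union>C \<and> y \<in> \<Union>C"
      then obtain Z where "Z \<in> C" "x \<in> Z" "y \<in> Z" using ch by blast
      then show "inf x y \<in> \<Union>C" using sub by (auto simp: fil_def)
    qed
    moreover have "bot \<notin> \<Union>C" using sub by (auto simp: fil_def)
    moreover have "range a \<subseteq> \<Union>C"
    proof -
      obtain X where X: "X \<in> C" using C(1) by blast
      then have "X \<in> fil" using sub by blast
      then have "range a \<subseteq> X" by (simp add: fil_def)
      then show ?thesis using X by blast
    qed
    ultimately show "\<Union>C \<in> fil" unfolding fil_def by blast
  qed
  then obtain M where M: "M \<in> fil" and max: "\<And>X. X \<in> fil \<Longrightarrow> M \<subseteq> X \<Longrightarrow> X = M" by blast
  have inf: "inf x y \<in> M \<longleftrightarrow> x \<in> M \<and> y \<in> M" and bot: "bot \<notin> M" and a: "a n \<in> M" for x y n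
    using M by (auto simp: fil_def)
  have compl: "- x \<in> M \<longleftrightarrow> x \<notin> M" for x
  proof
    assume "- x \<in> M" then show "x \<notin> M" using inf[of x "- x"] bot by auto
  next
    assume x: "x \<notin> M"
    define N where "N = {z. \<exists>y\<in>M. inf y x \<le> z}"
    have sub: "M \<subseteq> N" by (auto simp: N_def intro: le_infI1)
    have xN: "x \<in> N" using a[of 0] by (auto simp: N_def)
    have "N \<notin> fil" using max[OF _ sub] xN x by blast
    moreover have "inf u v \<in> N \<longleftrightarrow> u \<in> N \<and> v \<in> N" for u v
    proof
      assume "u \<in> N \<and> v \<in> N"
      then obtain y z where yz: "y \<in> M" "inf y x \<le> u" "z \<in> M" "inf z x \<le> v" by (auto simp: N_def)
      moreover have "inf (inf y z) x \<le> inf y x" "inf (inf y z) x \<le> inf z x"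
        by (meson inf_le1 inf_le2 inf_mono le_infI1 order_refl)+
      ultimately have "inf (inf y z) x \<le> u" "inf (inf y z) x \<le> v"
        by (meson order_trans)+
      then show "inf u v \<in> N" using yz inf by (auto simp: N_def)
    qed (auto simp: N_def)
    ultimately have "bot \<in> N" using sub a by (auto simp: fil_def)
    then obtain y where "y \<in> M" "inf y x = bot" by (auto simp: N_def bot_unique)
    then show "- x \<in> M" using up[OF M, of y "- x"] by (simp add: inf_shunt)
  qed
  have "top \<in> M" using up[OF M a[of 0]] by simp
  then have "M \<in> ultrafilters" unfolding ultrafilters_def using inf bot compl by blast
  with a that show thesis by blast
qed

lemma stone_set_mono: "a \<le> b \<Longrightarrow> stone_set a \<subseteq> stone_set b"
  using stone_set_inf[of a b] by (auto simp: inf.absorb1)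

lemma stone_set_sup: "stone_set (sup a b) = stone_set a \<union> stone_set b"
proof -
  have eq: "sup a b = - inf (- a) (- b)" by simp
  show ?thesis unfolding eq stone_set_compl stone_set_inf
    using stone_set_subset[of a] stone_set_subset[of b] by auto
qed

lemma stone_set_top [simp]: "stone_set top = ultrafilters"
  by (auto simp: stone_set_def ultrafilters_def)

lemma stone_set_bot [simp]: "stone_set bot = {}"
  by (auto simp: stone_set_def ultrafilters_def)

text \<open>Baire's theorem for the Stone space. The nested closed sets of the usual proof are
  clopen sets of nonzero elements, chosen one inside each \<open>D n\<close>, and an ultrafilter
  through all of them is the required point.\<close>

lemma stone_Baire:
  fixes a :: "'b::complete_ba"
  assumes D: "\<And>n::nat. dense_open stone (D n)" and a: "a \<noteq> bot"
  obtains t where "t \<in> stone_set a" "\<And>n. t \<in> D n"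
proof -
  have step: "\<exists>c. c \<noteq> bot \<and> c \<le> b \<and> stone_set c \<subseteq> D n" if "b \<noteq> bot" for b and n :: nat
  proof -
    obtain t where t: "t \<in> stone_set b" using ex_ultrafilter[OF \<open>b \<noteq> bot\<close>] by blast
    then have "t \<in> stone closure_of (D n)"
      using D[of n] stone_set_subset by (auto simp: dense_open_def)
    then obtain u where u: "u \<in> D n" "u \<in> stone_set b"
      using t unfolding in_closure_of by blast
    have "openin stone (D n)" using D[of n] by (simp add: dense_open_def)
    with u(1) obtain c where c: "u \<in> stone_set c" "stone_set c \<subseteq> D n"
      by (meson openin_stone_base)
    have "u \<in> stone_set (inf b c)" using u c by (simp add: stone_set_inf)
    then have "inf b c \<noteq> bot" by auto
    then show ?thesis using c(2) by (intro exI[of _ "inf b c"]) (auto simp: stone_set_inf)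
  qed
  have "\<exists>f. \<forall>n. (f n \<noteq> bot \<and> f n \<le> a \<and> stone_set (f n) \<subseteq> D n) \<and> f (Suc n) \<le> f n"
  proof (rule dependent_nat_choice)
    show "\<exists>x. x \<noteq> bot \<and> x \<le> a \<and> stone_set x \<subseteq> D 0" using step[OF a] by blast
    fix x n assume "x \<noteq> bot \<and> x \<le> a \<and> stone_set x \<subseteq> D n"
    then show "\<exists>y. (y \<noteq> bot \<and> y \<le> a \<and> stone_set y \<subseteq> D (Suc n)) \<and> y \<le> x"
      using step[of x "Suc n"] by (meson order_trans)
  qed
  then obtain f where f: "\<And>n. f n \<noteq> bot" "\<And>n. f n \<le> a" "\<And>n. stone_set (f n) \<subseteq> D n"
    "\<And>n. f (Suc n) \<le> f n" by blast
  from f(4) have "decseq f" by (simp add: decseq_SucI)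
  with f(1) obtain U where U: "U \<in> ultrafilters" "\<And>n. f n \<in> U"
    using ex_ultrafilter_decseq by blast
  then have "U \<in> stone_set (f n)" for n by (simp add: stone_set_def)
  then show thesis using that f stone_set_mono by blast
qed

text \<open>The filter of comeager subsets of the Stone space. Since \<open>C\<^sub>\<infinity>\<close> carries countable suprema only up to
  meager sets, relations in \<open>L\<^sub>0(\<nabla>)\<close> are read off pointwise along this filter.\<close>

definition generic :: "'b::complete_ba set filter" where
  "generic = Abs_filter (\<lambda>P. \<exists>D::nat \<Rightarrow> _. (\<forall>n. dense_open stone (D n)) \<and> (\<forall>t. (\<forall>n. t \<in> D n) \<longrightarrow> P t))"

abbreviation generically :: "('b::complete_ba set \<Rightarrow> bool) \<Rightarrow> bool"  (binder "\<forall>\<^sup>*" 10) where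
  "generically P \<equiv> eventually P generic"

lemma dense_open_topspace: "dense_open X (topspace X)"
  by (simp add: dense_open_def)

lemma eventually_generic:
  "eventually P generic \<longleftrightarrow>
    (\<exists>D::nat \<Rightarrow> _. (\<forall>n. dense_open stone (D n)) \<and> (\<forall>t. (\<forall>n. t \<in> D n) \<longrightarrow> P t))"
  unfolding generic_def
proof (rule eventually_Abs_filter, rule is_filter.intro, goal_cases)
  case 1
  show ?case using dense_open_topspace[of stone] by blast
next
  case (2 P Q)
  then obtain D E :: "nat \<Rightarrow> 'a set set" where
    "\<forall>n. dense_open stone (D n)" "\<forall>t. (\<forall>n. t \<in> D n) \<longrightarrow> P t"
    "\<forall>n. dense_open stone (E n)" "\<forall>t. (\<forall>n. t \<in> E n) \<longrightarrow> Q t" by blast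
  then show ?case by (intro exI[of _ "\<lambda>n. D n \<inter> E n"]) (auto intro: dense_open_Int)
qed blast

lemma generic_dense_open:
  assumes "dense_open stone D" shows "\<forall>\<^sup>*t. t \<in> D"
  unfolding eventually_generic using assms by (intro exI[of _ "\<lambda>_. D"]) auto

lemma generic_ultrafilter: "\<forall>\<^sup>*t. t \<in> ultrafilters"
  using generic_dense_open[OF dense_open_topspace] by simp

lemma generic_all:
  fixes P :: "'i::countable \<Rightarrow> _"
  assumes "\<And>i. \<forall>\<^sup>*t. P i t"
  shows "\<forall>\<^sup>*t. \<forall>i. P i t"
proof -
  have "\<forall>i. \<exists>D::nat \<Rightarrow> _. (\<forall>n. dense_open stone (D n)) \<and> (\<forall>t. (\<forall>n. t \<in> D n) \<longrightarrow> P i t)"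
    using assms by (simp add: eventually_generic)
  then obtain D :: "'i \<Rightarrow> nat \<Rightarrow> _" where D: "\<And>i n. dense_open stone (D i n)"
    "\<And>i t. (\<forall>n. t \<in> D i n) \<Longrightarrow> P i t" by metis
  \<comment> \<open>The countable family of sequences of dense open sets is merged into one sequence
    by coding the pair of indices.\<close>
  define E where "E k = D (from_nat (fst (prod_decode k))) (snd (prod_decode k))" for k
  show ?thesis unfolding eventually_generic
  proof (intro exI[of _ E] conjI allI impI)
    fix t i assume t: "\<forall>n. t \<in> E n"
    show "P i t"
    proof (rule D(2), intro allI)
      fix n show "t \<in> D i n"
        using t[rule_format, of "prod_encode (to_nat i, n)"] by (simp add: E_def)
    qed
  qed (simp add: E_def D(1))
qed

lemma generic_meets:
  assumes "eventually P generic" "a \<noteq> bot"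
  obtains t where "t \<in> stone_set a" "P t"
  using assms unfolding eventually_generic by (metis stone_Baire)

lemma generic_nonempty_open:
  assumes "eventually P generic" "openin stone V" "t \<in> V"
  obtains s where "s \<in> V" "P s"
proof -
  obtain a where a: "t \<in> stone_set a" "stone_set a \<subseteq> V"
    using assms(2,3) by (meson openin_stone_base)
  then have "a \<noteq> bot" by auto
  with assms(1) a that show thesis by (meson generic_meets subset_eq)
qed

text \<open>By Baire's theorem a comeager set meets every nonempty open set, so an open comeager set
  is dense. This turns finiteness at generic points into membership in \<open>L0\<close>.\<close>

lemma dense_open_generic:
  assumes "openin stone D" "\<forall>\<^sup>*t. t \<in> D"
  shows "dense_open stone D"
proof -
  have "t \<in> stone closure_of D" if "t \<in> topspace stone" for t
    unfolding in_closure_of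
  proof (intro conjI allI impI)
    fix V assume "t \<in> V \<and> openin stone V"
    then show "\<exists>y. y \<in> D \<and> y \<in> V" using generic_nonempty_open[OF assms(2), of V t] by blast
  qed (fact that)
  then show ?thesis using assms(1) closure_of_subset_topspace[of stone D]
    by (auto simp: dense_open_def)
qed

text \<open>If \<open>a\<close> were not below \<open>b\<close>, the nonzero element
  \<open>inf a (- b)\<close> would contain a generic point.\<close>

lemma le_generic:
  "a \<le> b \<longleftrightarrow> (\<forall>\<^sup>*t. t \<in> stone_set a \<longrightarrow> t \<in> stone_set b)"
proof
  assume "a \<le> b"
  then show "\<forall>\<^sup>*t. t \<in> stone_set a \<longrightarrow> t \<in> stone_set b"
    using stone_set_mono by (auto intro: always_eventually)
next
  assume *: "\<forall>\<^sup>*t. t \<in> stone_set a \<longrightarrow> t \<in> stone_set b"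
  show "a \<le> b"
  proof (rule ccontr)
    assume "\<not> a \<le> b"
    then have "inf a (- b) \<noteq> bot" by (simp add: inf_shunt)
    with * obtain t where "t \<in> stone_set (inf a (- b))" "t \<in> stone_set a \<longrightarrow> t \<in> stone_set b"
      by (rule generic_meets)
    then show False by (auto simp: stone_set_inf stone_set_compl)
  qed
qed

lemma dense_open_boundary:
  assumes "openin X V" shows "dense_open X (V \<union> (topspace X - X closure_of V))"
proof -
  have "X closure_of (V \<union> (topspace X - X closure_of V)) =
      X closure_of V \<union> X closure_of (topspace X - X closure_of V)"
    by (simp add: closure_of_Un)
  moreover have "topspace X - X closure_of V \<subseteq> X closure_of (topspace X - X closure_of V)"
    by (rule closure_of_subset) auto
  ultimately show ?thesis
    using assms closure_of_subset_topspace[of X] unfolding dense_open_def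
    by (auto intro!: openin_Un openin_diff)
qed

lemma stone_set_Sup_subset:
  fixes A :: "'b::complete_ba set"
  shows "stone_set (Sup A) \<subseteq> stone closure_of (\<Union>(stone_set ` A))"
proof
  fix U assume U: "U \<in> stone_set (Sup A)"
  have "\<exists>y\<in>\<Union>(stone_set ` A). y \<in> V" if V: "U \<in> V" "openin stone V" for V
  proof -
    obtain a where a: "U \<in> stone_set a" "stone_set a \<subseteq> V"
      using V(2,1) by (rule openin_stone_base)
    have "\<exists>e\<in>A. inf a e \<noteq> bot"
    proof (rule ccontr)
      assume *: "\<not> ?thesis"
      have "Sup A \<le> - a"
        by (rule Sup_least) (metis "*" inf_commute inf_shunt)
      then have "U \<in> stone_set (- a)" using U stone_set_mono by blast
      with a show False by (simp add: stone_set_compl)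
    qed
    then obtain e where e: "e \<in> A" "inf a e \<noteq> bot" by blast
    with ex_ultrafilter[OF e(2)] a show ?thesis by (auto simp: stone_set_inf)
  qed
  moreover have "U \<in> topspace stone" using U stone_set_subset by auto
  ultimately show "U \<in> stone closure_of (\<Union>(stone_set ` A))"
    unfolding in_closure_of by blast
qed

text \<open>The family may be uncountable: the clopen set of the supremum lies between the union,
  which is open, and its closure, so the two differ by part of a single nowhere dense
  boundary.\<close>

lemma generic_Sup:
  fixes A :: "'b::complete_ba set"
  shows "\<forall>\<^sup>*t. t \<in> stone_set (Sup A) \<longleftrightarrow> (\<exists>e\<in>A. t \<in> stone_set e)"
proof -
  let ?V = "\<Union>(stone_set ` A)"
  have "openin stone ?V" by (intro openin_Union) auto
  then have "\<forall>\<^sup>*t. t \<in> ?V \<union> (topspace stone - stone closure_of ?V)"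
    by (intro generic_dense_open dense_open_boundary)
  then show ?thesis
  proof eventually_elim
    case (elim t)
    then show ?case using stone_set_Sup_subset[of A] stone_set_mono[OF Sup_upper] by blast
  qed
qed

text \<open>For an open \<open>V\<close> the clopen set of this element is the closure of
  \<open>V\<close>.\<close>

definition opn :: "'b::complete_ba set set \<Rightarrow> 'b" where
  "opn V = Sup {e. stone_set e \<subseteq> V}"

lemma generic_opn:
  assumes "openin stone V"
  shows "\<forall>\<^sup>*t. t \<in> stone_set (opn V) \<longleftrightarrow> t \<in> V"
  using generic_Sup[of "{e. stone_set e \<subseteq> V}"]
proof eventually_elim
  case (elim t)
  then show ?case using openin_stone_base[OF assms] unfolding opn_def by blast
qed

text \<open>Junk value \<open>0\<close> at the points where the element is infinite; these are not generic.\<close>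

definition rv :: "'b::complete_ba L0 \<Rightarrow> 'b set \<Rightarrow> real" where
  "rv x t = real_of_ereal (L0_val x t)"

lemma generic_val: "\<forall>\<^sup>*t. L0_val x t = ereal (rv x t)"
  using generic_dense_open[OF dense_open_fin_set[of x]]
  by eventually_elim (auto simp: rv_def ereal_real fin_set_def)

lemma generic_finite: "\<forall>\<^sup>*t. \<exists>r. L0_val x t = ereal r"
  using generic_val[of x] by eventually_elim blast

lemma generic_plus: "\<forall>\<^sup>*t. rv (x + y) t = rv x t + rv y t"
  using generic_finite[of x] generic_finite[of y] by eventually_elim (auto simp: rv_def val_plus)

lemma rv_zero [simp]: "rv 0 t = 0" by (simp add: rv_def)
lemma rv_scaleR [simp]: "rv (c *\<^sub>R x) t = c * rv x t" by (simp add: rv_def)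
lemma rv_uminus [simp]: "rv (- x) t = - rv x t" by (simp add: rv_def)
lemma rv_abs [simp]: "rv \<bar>x\<bar> t = \<bar>rv x t\<bar>"
  unfolding rv_def val_abs by (cases "L0_val x t") auto
lemma rv_idem [simp]: "rv (idem_L0 e) t = indicator (stone_set e) t"
  by (simp add: rv_def val_idem indicator_def)
lemma rv_abs_powr [simp]: "p > 0 \<Longrightarrow> rv (abs_powr x p) t = \<bar>rv x t\<bar> powr p"
  by (cases "L0_val x t") (auto simp: rv_def val_abs_powr)

lemma generic_minus: "\<forall>\<^sup>*t. rv (x - y) t = rv x t - rv y t"
  using generic_plus[of x "- y"] by simp

lemma generic_sup: "\<forall>\<^sup>*t. rv (sup x y) t = max (rv x t) (rv y t)"
  using generic_finite[of x] generic_finite[of y] by eventually_elim (auto simp: rv_def val_sup max_def)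

lemma generic_inf: "\<forall>\<^sup>*t. rv (inf x y) t = min (rv x t) (rv y t)"
  using generic_finite[of x] generic_finite[of y] by eventually_elim (auto simp: rv_def val_inf min_def)

lemma generic_sum:
  assumes "finite A"
  shows "\<forall>\<^sup>*t. rv (\<Sum>i\<in>A. f i) t = (\<Sum>i\<in>A. rv (f i) t)"
  using assms
proof induction
  case (insert i A)
  show ?case using insert(3) generic_plus[of "f i" "sum f A"]
    by eventually_elim (simp add: insert)
qed simp

text \<open>A failure of the order at one point persists, by continuity, on a nonempty open set, and
  this set contains generic points at which both elements are finite.\<close>

lemma L0_le_generic:
  "x \<le> y \<longleftrightarrow> (\<forall>\<^sup>*t. rv x t \<le> rv y t)"
proof
  assume le: "x \<le> y"
  show "\<forall>\<^sup>*t. rv x t \<le> rv y t"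
    using generic_val[of x] generic_val[of y]
    by eventually_elim (metis le less_eq_L0_def ereal_less_eq(3))
next
  assume *: "\<forall>\<^sup>*t. rv x t \<le> rv y t"
  show "x \<le> y" unfolding less_eq_L0_def
  proof (rule ccontr)
    assume "\<not> (\<forall>t. L0_val x t \<le> L0_val y t)"
    then obtain t where t: "L0_val y t < L0_val x t" by (auto simp: not_le)
    then have tu: "t \<in> ultrafilters" by (cases "t \<in> ultrafilters") auto
    obtain c where c: "L0_val y t < c" "c < L0_val x t" using dense[OF t] by blast
    let ?V = "{s \<in> topspace stone. L0_val y s \<in> {..<c}} \<inter> {s \<in> topspace stone. L0_val x s \<in> {c<..}}"
    have op: "openin stone ?V"
      by (intro openin_Int openin_continuous_map_preimage[OF continuous_val]) auto
    have t': "t \<in> ?V" using c tu by simp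
    have ev: "\<forall>\<^sup>*t. rv x t \<le> rv y t \<and> L0_val x t = ereal (rv x t) \<and> L0_val y t = ereal (rv y t)"
      using * generic_val[of x] generic_val[of y] by eventually_elim auto
    obtain s where s: "s \<in> ?V" and "rv x s \<le> rv y s \<and> L0_val x s = ereal (rv x s) \<and> L0_val y s = ereal (rv y s)"
      by (rule generic_nonempty_open[OF ev op t'])
    then have "L0_val x s \<le> L0_val y s" by (metis ereal_less_eq(3))
    with s show False by auto
  qed
qed

lemma L0_eq_generic:
  "x = y \<longleftrightarrow> (\<forall>\<^sup>*t. rv x t = rv y t)"
proof
  assume *: "\<forall>\<^sup>*t. rv x t = rv y t"
  have "x \<le> y" "y \<le> x" unfolding L0_le_generic using * by (auto elim: eventually_mono)
  then show "x = y" by (rule order.antisym)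
qed simp

lemma openin_gt: "openin stone {t \<in> ultrafilters. c < L0_val x t}"
  using openin_continuous_map_preimage[OF continuous_val[of x], of "{c<..}"] by simp

text \<open>The spectral element of the set where \<open>x\<close> exceeds \<open>a\<close>. The
  strict inequality makes this set open, so \<open>opn\<close> represents it up to a meager
  set.\<close>

definition lvl :: "'b::complete_ba L0 \<Rightarrow> real \<Rightarrow> 'b" where
  "lvl x a = opn {t \<in> ultrafilters. ereal a < L0_val x t}"

lemma generic_lvl: "\<forall>\<^sup>*t. t \<in> stone_set (lvl x a) \<longleftrightarrow> a < rv x t"
  using generic_opn[OF openin_gt[of "ereal a" x]] generic_val[of x] generic_ultrafilter
  by eventually_elim (simp add: lvl_def)

lemma generic_Sup_lvl:
  fixes f :: "'i::countable \<Rightarrow> 'b::complete_ba L0"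
  shows "\<forall>\<^sup>*t. t \<in> stone_set (Sup ((\<lambda>i. lvl (f i) (c i)) ` S)) \<longleftrightarrow> (\<exists>i\<in>S. c i < rv (f i) t)"
  using generic_all[of "\<lambda>i t. t \<in> stone_set (lvl (f i) (c i)) \<longleftrightarrow> c i < rv (f i) t", OF generic_lvl]
    generic_Sup[of "(\<lambda>i. lvl (f i) (c i)) ` S"]
  by eventually_elim simp

text \<open>The product of \<open>x\<close> with the idempotent \<open>e\<close>.\<close>

lift_definition restr :: "'b::complete_ba \<Rightarrow> 'b L0 \<Rightarrow> 'b L0" is
  "\<lambda>e f t. if t \<in> stone_set e then f t else 0"
proof -
  fix e :: 'b and f :: "'b set \<Rightarrow> ereal"
  assume f: "continuous_map stone euclidean f \<and>
      stone interior_of (stone closure_of {t \<in> ultrafilters. \<bar>f t\<bar> = \<infinity>}) = {} \<and>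
      (\<forall>t. t \<notin> ultrafilters \<longrightarrow> f t = 0)"
  let ?g = "\<lambda>t. if t \<in> stone_set e then f t else 0"
  have c: "continuous_map stone euclidean ?g"
    unfolding continuous_map_def
  proof (intro conjI allI impI)
    fix U :: "ereal set" assume "openin euclidean U"
    then have "openin stone {t \<in> topspace stone. f t \<in> U}"
      using f openin_continuous_map_preimage by blast
    moreover have "{t \<in> topspace stone. ?g t \<in> U} =
      (stone_set e \<inter> {t \<in> topspace stone. f t \<in> U}) \<union> (if 0 \<in> U then stone_set (- e) else {})"
      using stone_set_subset[of e] by (auto simp: stone_set_compl)
    ultimately show "openin stone {t \<in> topspace stone. ?g t \<in> U}" by auto
  qed auto
  have "dense_open stone {t \<in> ultrafilters. \<bar>f t\<bar> \<noteq> \<infinity>}"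
    using f nowhere_dense_iff_dense_open by blast
  from Abs_L0_cases[OF c this]
  show "continuous_map stone euclidean ?g \<and>
      stone interior_of (stone closure_of {t \<in> ultrafilters. \<bar>?g t\<bar> = \<infinity>}) = {} \<and>
      (\<forall>t. t \<notin> ultrafilters \<longrightarrow> ?g t = 0)"
    using f by (auto simp: stone_set_def)
qed

lemma rv_restr [simp]: "rv (restr e x) t = (if t \<in> stone_set e then rv x t else 0)"
  unfolding rv_def by transfer simp

text \<open>Boundedness of the sequence at generic points already gives an upper bound in
  C_infinity. The pointwise supremum is lower semicontinuous and differs from its continuous
  regularisation only on a meager set, so the regularisation is finite on a dense open set.\<close>

lemma L0_countable_sup:
  fixes X :: "nat \<Rightarrow> 'b::complete_ba L0"
  assumes bdd: "\<forall>\<^sup>*t. bdd_above (range (\<lambda>n. rv (X n) t))"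
  obtains g where "\<And>n. X n \<le> g" "\<And>u. (\<And>n. X n \<le> u) \<Longrightarrow> g \<le> u"
    "\<forall>\<^sup>*t. rv g t = (SUP n. rv (X n) t)"
proof -
  define f where "f t = (SUP n. L0_val (X n) t)" for t
  define h where "h t = (if t \<in> ultrafilters then usc_hull stone f t else 0)" for t
  have op: "openin stone {t \<in> topspace stone. c < f t}" for c
  proof -
    have "{t \<in> topspace stone. c < f t} = (\<Union>n. {t \<in> ultrafilters. c < L0_val (X n) t})"
      by (auto simp: f_def less_SUP_iff)
    then show ?thesis by (auto intro: openin_gt)
  qed
  have hc: "continuous_map stone euclidean h"
    by (rule continuous_map_eq[OF continuous_map_usc_hull[OF openin_closure_of_stone op]])
       (auto simp: h_def)
  \<comment> \<open>Discard the boundaries of the sets where \<open>f\<close> exceeds a rational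
    \<open>q\<close>. At a remaining point with \<open>f t\<close> below \<open>q\<close> there is a
    neighbourhood on which \<open>f\<close> is at most \<open>q\<close>, so the hull is at most
    \<open>q\<close> as well.\<close>
  have "\<forall>\<^sup>*t. \<forall>q::rat. t \<in> {t \<in> topspace stone. ereal (of_rat q) < f t} \<union>
      (topspace stone - stone closure_of {t \<in> topspace stone. ereal (of_rat q) < f t})"
    by (intro generic_all generic_dense_open dense_open_boundary op)
  then have hf: "\<forall>\<^sup>*t. h t = f t"
    using generic_ultrafilter
  proof eventually_elim
    case (elim t)
    have "f t \<le> h t" using usc_hull_upper[of t stone f] elim(2) by (simp add: h_def)
    moreover have "\<not> f t < h t"
    proof
      assume "f t < h t"
      then obtain q where q: "f t < ereal (of_rat q)" "ereal (of_rat q) < h t"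
        by (metis ereal_dense3)
      let ?V = "{t \<in> topspace stone. ereal (of_rat q) < f t}"
      let ?W = "topspace stone - stone closure_of ?V"
      have "t \<in> ?W" using elim(1)[rule_format, of q] q(1) by auto
      moreover have "openin stone ?W" by (rule openin_diff[OF openin_topspace closedin_closure_of])
      ultimately have "usc_hull stone f t \<le> (SUP s\<in>?W. f s)"
        unfolding usc_hull_def by (intro INF_lower) auto
      also have "\<dots> \<le> ereal (of_rat q)"
      proof (rule SUP_least)
        fix s assume s: "s \<in> ?W"
        then have "s \<notin> ?V" using closure_of_subset[of ?V stone] by blast
        then show "f s \<le> ereal (of_rat q)" using s by auto
      qed
      finally show False using q(2) elim(2) by (simp add: h_def)
    qed
    ultimately show ?case by auto
  qed
  have "\<forall>\<^sup>*t. \<forall>n. L0_val (X n) t = ereal (rv (X n) t)"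
    by (intro generic_all generic_val)
  then have val: "\<forall>\<^sup>*t. h t = ereal (SUP n. rv (X n) t) \<and> t \<in> ultrafilters"
    using hf bdd generic_ultrafilter
  proof eventually_elim
    case (elim t)
    have "ereal (SUP n. rv (X n) t) = (SUP n. ereal (rv (X n) t))"
    proof (rule ereal_SUP)
      obtain M where "\<And>n. rv (X n) t \<le> M" using elim(3) by (auto simp: bdd_above_def)
      then have "(SUP n. ereal (rv (X n) t)) \<le> ereal M" by (intro SUP_least) simp
      moreover have "ereal (rv (X 0) t) \<le> (SUP n. ereal (rv (X n) t))" by (intro SUP_upper) simp
      ultimately show "\<bar>SUP n. ereal (rv (X n) t)\<bar> \<noteq> \<infinity>" by auto
    qed
    then show ?case using elim by (simp add: f_def)
  qed
  have D: "dense_open stone {t \<in> ultrafilters. \<bar>h t\<bar> \<noteq> \<infinity>}"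
  proof (rule dense_open_generic)
    have "{t \<in> ultrafilters. \<bar>h t\<bar> \<noteq> \<infinity>} = topspace stone - {t \<in> ultrafilters. \<bar>h t\<bar> = \<infinity>}" by auto
    then show "openin stone {t \<in> ultrafilters. \<bar>h t\<bar> \<noteq> \<infinity>}"
      using closedin_infinite_stone[OF hc] by (auto simp: closedin_def)
    show "\<forall>\<^sup>*t. t \<in> {t \<in> ultrafilters. \<bar>h t\<bar> \<noteq> \<infinity>}"
      using val by eventually_elim auto
  qed
  have inv: "L0_val (Abs_L0 h) = h"
    by (rule Abs_L0_inverse, rule Abs_L0_cases[OF hc D]) (auto simp: h_def)
  let ?g = "Abs_L0 h"
  have g: "\<forall>\<^sup>*t. rv ?g t = (SUP n. rv (X n) t)"
    using val by eventually_elim (simp add: rv_def inv)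
  show thesis
  proof (rule that[of ?g])
    show "X n \<le> ?g" for n unfolding L0_le_generic
      using g bdd by eventually_elim (auto intro: cSUP_upper)
    show "?g \<le> u" if "\<And>n. X n \<le> u" for u
    proof -
      have "\<forall>\<^sup>*t. \<forall>n. rv (X n) t \<le> rv u t"
        using that by (intro generic_all) (simp add: L0_le_generic)
      with g show ?thesis unfolding L0_le_generic by eventually_elim (auto intro: cSUP_least)
    qed
  qed (fact g)
qed

section \<open>From convergence at generic points to order convergence\<close>

lemma L0_tail_sup:
  fixes X :: "nat \<Rightarrow> 'b::complete_ba L0"
  assumes conv: "\<forall>\<^sup>*t. (\<lambda>n. rv (X n) t) \<longlonglongrightarrow> l t"
  obtains u where "decseq u" "\<And>n. X n \<le> u n" "\<forall>\<^sup>*t. (\<lambda>n. rv (u n) t) \<longlonglongrightarrow> l t"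
proof -
  have ba: "\<forall>\<^sup>*t. bdd_above (range (\<lambda>n. rv (X (n + k)) t))" for k
    using conv
  proof eventually_elim
    case (elim t)
    then have "(\<lambda>n. rv (X (n + k)) t) \<longlonglongrightarrow> l t" by (rule LIMSEQ_ignore_initial_segment)
    then have "Bseq (\<lambda>n. rv (X (n + k)) t)" by (intro convergent_imp_Bseq convergentI)
    then show ?case by (metis Bseq_eq_bounded bounded_imp_bdd_above)
  qed
  have "\<exists>g. (\<forall>n. X (n + k) \<le> g) \<and> (\<forall>v. (\<forall>n. X (n + k) \<le> v) \<longrightarrow> g \<le> v) \<and>
     (\<forall>\<^sup>*t. rv g t = (SUP n. rv (X (n + k)) t))" for k
    by (rule L0_countable_sup[OF ba[of k]]) blast
  then have "\<forall>k. \<exists>g. (\<forall>n. X (n + k) \<le> g) \<and> (\<forall>v. (\<forall>n. X (n + k) \<le> v) \<longrightarrow> g \<le> v) \<and>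
     (\<forall>\<^sup>*t. rv g t = (SUP n. rv (X (n + k)) t))" by blast
  from choice[OF this] obtain u where
    u: "\<And>k n. X (n + k) \<le> u k" "\<And>k v. (\<And>n. X (n + k) \<le> v) \<Longrightarrow> u k \<le> v"
    "\<And>k. \<forall>\<^sup>*t. rv (u k) t = (SUP n. rv (X (n + k)) t)" by blast
  show thesis
  proof (rule that)
    show "decseq u"
    proof (rule decseq_SucI, rule u(2))
      fix k n show "X (n + Suc k) \<le> u k" using u(1)[of "Suc n" k] by simp
    qed
    show "X n \<le> u n" for n using u(1)[of 0 n] by simp
    have "\<forall>\<^sup>*t. \<forall>k. rv (u k) t = (SUP n. rv (X (n + k)) t)"
      by (intro generic_all u)
    then show "\<forall>\<^sup>*t. (\<lambda>n. rv (u n) t) \<longlonglongrightarrow> l t" using conv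
    proof eventually_elim
      case (elim t)
      show ?case
      proof (rule LIMSEQ_I)
        fix r :: real assume "r > 0"
        then obtain N where N: "\<And>n. n \<ge> N \<Longrightarrow> \<bar>rv (X n) t - l t\<bar> < r / 2"
          using LIMSEQ_D[OF elim(2), of "r/2"] by auto
        have "\<bar>rv (u k) t - l t\<bar> \<le> r / 2" if "k \<ge> N" for k
        proof -
          have b: "l t - r/2 \<le> rv (X (n + k)) t" "rv (X (n + k)) t \<le> l t + r/2" for n
            using N[of "n + k"] that unfolding abs_less_iff by linarith+
          have "l t - r/2 \<le> (SUP n. rv (X (n + k)) t)"
            using b b(1)[of 0] by (intro cSUP_upper2[where x = 0]) (auto simp: bdd_above_def)
          moreover have "(SUP n. rv (X (n + k)) t) \<le> l t + r/2"
            using b by (intro cSUP_least) auto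
          moreover have e: "rv (u k) t = (SUP n. rv (X (n + k)) t)" using elim(1) by blast
          ultimately show ?thesis unfolding e abs_le_iff by linarith
        qed
        show "\<exists>no. \<forall>n\<ge>no. norm (rv (u n) t - l t) < r"
        proof (intro exI[of _ N] allI impI)
          fix k assume "k \<ge> N"
          with \<open>r > 0\<close> \<open>\<And>k. k \<ge> N \<Longrightarrow> \<bar>rv (u k) t - l t\<bar> \<le> r / 2\<close>[of k] show "norm (rv (u k) t - l t) < r" by simp
        qed
      qed
    qed
  qed
qed

text \<open>The limit function need not be continuous, so the limit in \<open>L0\<close> is obtained
  as the infimum of the tail suprema, written as a negated supremum. The tail suprema of the
  distances to it then serve as the decreasing sequence of bounds.\<close>

lemma o_converges_generic:
  fixes X :: "nat \<Rightarrow> 'b::complete_ba L0"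
  assumes conv: "\<forall>\<^sup>*t. convergent (\<lambda>n. rv (X n) t)"
  shows "\<exists>x. o_converges X x"
proof -
  define l where "l t = lim (\<lambda>n. rv (X n) t)" for t
  have l: "\<forall>\<^sup>*t. (\<lambda>n. rv (X n) t) \<longlonglongrightarrow> l t"
    using conv by eventually_elim (simp add: l_def convergent_LIMSEQ_iff)
  obtain u where u: "decseq u" "\<forall>\<^sup>*t. (\<lambda>n. rv (u n) t) \<longlonglongrightarrow> l t"
    by (rule L0_tail_sup[OF l])
  have inc: "\<forall>\<^sup>*t. incseq (\<lambda>n. rv (- u n) t)"
  proof -
    have "u (Suc k) \<le> u k" for k using u(1) by (simp add: decseq_Suc_iff)
    then have "\<forall>\<^sup>*t. rv (u (Suc k)) t \<le> rv (u k) t" for k by (simp add: L0_le_generic)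
    then have "\<forall>\<^sup>*t. \<forall>k. rv (u (Suc k)) t \<le> rv (u k) t" by (rule generic_all)
    then show ?thesis by eventually_elim (simp add: incseq_Suc_iff)
  qed
  have bu: "\<forall>\<^sup>*t. bdd_above (range (\<lambda>k. rv (- u k) t))"
    using u(2)
  proof eventually_elim
    case (elim t)
    then have "(\<lambda>k. rv (- u k) t) \<longlonglongrightarrow> - l t" by (simp add: tendsto_minus)
    then have "Bseq (\<lambda>k. rv (- u k) t)" by (intro convergent_imp_Bseq convergentI)
    then show ?case by (metis Bseq_eq_bounded bounded_imp_bdd_above)
  qed
  obtain x' where x': "\<forall>\<^sup>*t. rv x' t = (SUP n. rv (- u n) t)"
    by (rule L0_countable_sup[OF bu])
  define x where "x = - x'"
  have "\<forall>\<^sup>*t. rv x t = l t"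
    using x' bu inc u(2)
  proof eventually_elim
    case (elim t)
    have "(\<lambda>k. rv (- u k) t) \<longlonglongrightarrow> - l t" using elim(4) by (simp add: tendsto_minus)
    moreover have "(\<lambda>k. rv (- u k) t) \<longlonglongrightarrow> (SUP n. rv (- u n) t)"
      by (rule LIMSEQ_incseq_SUP) (use elim in auto)
    ultimately have "- l t = (SUP n. rv (- u n) t)" by (rule LIMSEQ_unique)
    then show ?case using elim(1) by (simp add: x_def)
  qed
  moreover have "\<forall>\<^sup>*t. \<forall>n. rv (X n - x) t = rv (X n) t - rv x t"
    by (intro generic_all generic_minus)
  ultimately have lim: "\<forall>\<^sup>*t. (\<lambda>n. rv \<bar>X n - x\<bar> t) \<longlonglongrightarrow> (\<lambda>_. 0) t"
    using l
  proof eventually_elim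
    case (elim t)
    then show ?case by (auto intro!: tendsto_rabs_zero simp: LIM_zero_iff)
  qed
  show ?thesis
  proof (rule L0_tail_sup[OF lim])
    fix v assume v: "decseq v" "\<And>n. \<bar>X n - x\<bar> \<le> v n"
      "\<forall>\<^sup>*t. (\<lambda>n. rv (v n) t) \<longlonglongrightarrow> 0"
    have "z \<le> 0" if z: "\<And>n. z \<le> v n" for z
    proof -
      have "\<forall>\<^sup>*t. \<forall>n. rv z t \<le> rv (v n) t"
        using z by (intro generic_all) (simp add: L0_le_generic)
      then show ?thesis using v(3) unfolding L0_le_generic
        by eventually_elim (auto intro: LIMSEQ_le_const)
    qed
    moreover have "0 \<le> v n" for n using v(2)[of n] by (meson abs_ge_zero order_trans)
    ultimately show "\<exists>x. o_converges X x" using v(1,2) unfolding o_converges_def by blast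
  qed
qed

section \<open>Integrals with values in \<open>L\<^sub>0(\<Omega>)\<close>\<close>

lemma staircase_sum:
  fixes z \<epsilon> :: real
  assumes "0 < \<epsilon>" "0 \<le> z" "z \<le> real n * \<epsilon>"
  shows "(\<Sum>i<n. \<epsilon> * of_bool (real (Suc i) * \<epsilon> < z)) \<le> z"
    and "z \<le> (\<Sum>i<n. \<epsilon> * of_bool (real (Suc i) * \<epsilon> < z)) + \<epsilon>"
proof -
  \<comment> \<open>Capping \<open>z\<close> at \<open>real n * \<epsilon>\<close> frees the
    induction from the hypothesis that \<open>n\<close> steps suffice.\<close>
  have *: "(\<Sum>i<n. \<epsilon> * of_bool (real (Suc i) * \<epsilon> < z)) \<le> min z (real n * \<epsilon>) \<and>
    min z (real n * \<epsilon>) - \<epsilon> \<le> (\<Sum>i<n. \<epsilon> * of_bool (real (Suc i) * \<epsilon> < z))" for n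
  proof (induction n)
    case 0
    then show ?case using assms by simp
  next
    case (Suc n)
    have full: "(\<Sum>i<n. \<epsilon> * of_bool (real (Suc i) * \<epsilon> < z)) = real n * \<epsilon>" if "real n * \<epsilon> < z"
    proof -
      have "real (Suc i) * \<epsilon> < z" if "i < n" for i
      proof -
        have "real (Suc i) * \<epsilon> \<le> real n * \<epsilon>" using \<open>i < n\<close> assms(1) by (intro mult_right_mono) auto
        then show ?thesis using \<open>real n * \<epsilon> < z\<close> by linarith
      qed
      then have "(\<Sum>i<n. \<epsilon> * of_bool (real (Suc i) * \<epsilon> < z)) = (\<Sum>i<n. \<epsilon>)"
        by (intro sum.cong) auto
      then show ?thesis by simp
    qed
    have e: "real (Suc n) * \<epsilon> = real n * \<epsilon> + \<epsilon>" by (simp add: algebra_simps)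
    show ?case
    proof (cases "real n * \<epsilon> < z")
      case True
      then show ?thesis using full[OF True] assms(1) unfolding sum.lessThan_Suc e
        by (auto simp: min_def)
    next
      case False
      then have "\<not> real (Suc n) * \<epsilon> < z" using e assms(1) by linarith
      then show ?thesis using Suc False e assms(1) by (simp add: min_def)
    qed
  qed
  from *[of n] assms show "(\<Sum>i<n. \<epsilon> * of_bool (real (Suc i) * \<epsilon> < z)) \<le> z"
    "z \<le> (\<Sum>i<n. \<epsilon> * of_bool (real (Suc i) * \<epsilon> < z)) + \<epsilon>" by linarith+
qed

section \<open>Simple elements and their integrals\<close>

abbreviation one_L0 :: "'b::complete_ba L0" where "one_L0 \<equiv> idem_L0 top"

lemma generic_one: "\<forall>\<^sup>*t. rv one_L0 t = 1"
  using generic_ultrafilter by eventually_elim simp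

text \<open>A relation and not a function of \<open>s\<close>: different representations of the same
  simple element give integrals that agree only almost everywhere
  (\<open>simple_int_eq\<close>).\<close>

definition simple_int :: "('b::complete_ba \<Rightarrow> 'w \<Rightarrow> real) \<Rightarrow> 'b L0 \<Rightarrow> ('w \<Rightarrow> real) \<Rightarrow> bool" where
  "simple_int m s g \<longleftrightarrow> (\<exists>(n::nat) c e. s = (\<Sum>i<n. c i *\<^sub>R idem_L0 (e i)) \<and> g = (\<lambda>w. \<Sum>i<n. c i * m (e i) w))"

lemma simple_int_sum:
  fixes n :: nat
  shows "simple_int m (\<Sum>i<n. c i *\<^sub>R idem_L0 (e i)) (\<lambda>w. \<Sum>i<n. c i * m (e i) w)"
  unfolding simple_int_def by (intro exI[of _ n] exI[of _ c] exI[of _ e]) simp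

lemma lower_integrals_simple: "lower_integrals m x = {g. \<exists>s. simple_int m s g \<and> 0 \<le> s \<and> s \<le> x}"
  unfolding lower_integrals_def simple_int_def by auto

lemma simple_int_snoc:
  assumes "simple_int m s g"
  shows "simple_int m (s + c *\<^sub>R idem_L0 e) (\<lambda>w. g w + c * m e w)"
proof -
  obtain n :: nat and c' e' where
    "s = (\<Sum>i<n. c' i *\<^sub>R idem_L0 (e' i))" "g = (\<lambda>w. \<Sum>i<n. c' i * m (e' i) w)"
    using assms unfolding simple_int_def by blast
  then show ?thesis unfolding simple_int_def
    by (intro exI[of _ "Suc n"] exI[of _ "c'(n := c)"] exI[of _ "e'(n := e)"]) simp
qed

lemma simple_int_zero: "simple_int m 0 (\<lambda>_. 0)"
  unfolding simple_int_def by (intro exI[of _ 0]) simp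

lemma simple_int_idem: "simple_int m (c *\<^sub>R idem_L0 e) (\<lambda>w. c * m e w)"
  using simple_int_snoc[OF simple_int_zero, where c = c and e = e and m = m] by simp

lemma simple_int_add_sum:
  fixes n :: nat
  assumes "simple_int m s g"
  shows "simple_int m (s + (\<Sum>i<n. c i *\<^sub>R idem_L0 (e i))) (\<lambda>w. g w + (\<Sum>i<n. c i * m (e i) w))"
proof (induction n)
  case (Suc n)
  from simple_int_snoc[OF this, of "c n" "e n"] show ?case by (simp add: add.assoc)
qed (simp add: assms)

lemma simple_int_add:
  assumes "simple_int m s g" "simple_int m s' g'"
  shows "simple_int m (s + s') (\<lambda>w. g w + g' w)"
  using assms(2) simple_int_add_sum[OF assms(1)] unfolding simple_int_def[of m s' g'] by auto

lemma simple_int_scale: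
  assumes "simple_int m s g"
  shows "simple_int m (c *\<^sub>R s) (\<lambda>w. c * g w)"
proof -
  obtain n :: nat and c' e' where
    "s = (\<Sum>i<n. c' i *\<^sub>R idem_L0 (e' i))" "g = (\<lambda>w. \<Sum>i<n. c' i * m (e' i) w)"
    using assms unfolding simple_int_def by blast
  then show ?thesis unfolding simple_int_def
    by (intro exI[of _ n] exI[of _ "\<lambda>i. c * c' i"] exI[of _ e'])
       (simp add: scaleR_sum_right sum_distrib_left mult.assoc)
qed

lemma simple_int_diff:
  assumes "simple_int m s g" "simple_int m s' g'"
  shows "simple_int m (s - s') (\<lambda>w. g w - g' w)"
  using simple_int_add[OF assms(1) simple_int_scale[OF assms(2), of "-1"]] by simp

lemma restr_simple:
  fixes n :: nat
  shows "restr e (\<Sum>i<n. c i *\<^sub>R idem_L0 (e' i)) = (\<Sum>i<n. c i *\<^sub>R idem_L0 (inf e (e' i)))"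
  unfolding L0_eq_generic
  using generic_sum[of "{..<n}" "\<lambda>i. c i *\<^sub>R idem_L0 (e' i)", OF finite_lessThan]
    generic_sum[of "{..<n}" "\<lambda>i. c i *\<^sub>R idem_L0 (inf e (e' i))", OF finite_lessThan]
  by eventually_elim (simp add: stone_set_inf indicator_def)

lemma simple_int_restr:
  assumes "simple_int m s g"
  shows "\<exists>g'. simple_int m (restr e s) g'"
proof -
  obtain n :: nat and c e' where s: "s = (\<Sum>i<n. c i *\<^sub>R idem_L0 (e' i))"
    using assms unfolding simple_int_def by blast
  show ?thesis unfolding s restr_simple by (rule exI, rule simple_int_sum)
qed

lemma restr_split: "restr e x + restr (- e) x = x"
  unfolding L0_eq_generic using generic_plus[of "restr e x" "restr (- e) x"] generic_ultrafilter
  by eventually_elim (auto simp: stone_set_compl)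

lemma simple_int_bounded:
  assumes "simple_int m s g"
  shows "\<exists>K. s \<le> K *\<^sub>R one_L0"
proof -
  obtain n :: nat and c e where s: "s = (\<Sum>i<n. c i *\<^sub>R idem_L0 (e i))"
    using assms unfolding simple_int_def by blast
  have "s \<le> (\<Sum>i<n. \<bar>c i\<bar>) *\<^sub>R one_L0" unfolding L0_le_generic s
    using generic_sum[of "{..<n}" "\<lambda>i. c i *\<^sub>R idem_L0 (e i)", OF finite_lessThan] generic_one
  proof eventually_elim
    case (elim t)
    have "(\<Sum>i<n. c i * indicator (stone_set (e i)) t) \<le> (\<Sum>i<n. \<bar>c i\<bar>)"
      by (intro sum_mono) (auto simp: indicator_def)
    then show ?case using elim by simp
  qed
  then show ?thesis by blast
qed

section \<open>The measure and the order completeness of L_0(Omega)\<close>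

locale L0_meas =
  fixes M :: "'w measure" and m :: "'b::complete_ba \<Rightarrow> 'w \<Rightarrow> real" and \<iota> :: "'w set \<Rightarrow> 'b"
  assumes meas: "L0_measure M m" and emb: "regular_embedding M m \<iota>" and m_top: "AE w in M. m top w = 1"
begin

lemma m_measurable [measurable, simp]: "m e \<in> borel_measurable M"
  and m_nonneg: "AE w in M. 0 \<le> m e w"
  and m_zero_iff: "(AE w in M. m e w = 0) \<longleftrightarrow> e = bot"
  and m_sup: "inf e g = bot \<Longrightarrow> AE w in M. m (sup e g) w = m e w + m g w"
  using meas unfolding L0_measure_def by simp_all

lemma m_bot: "AE w in M. m bot w = 0"
  using m_zero_iff[of bot] by simp

lemma m_split: "AE w in M. m e w = m (inf e g) w + m (inf e (- g)) w"
proof -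
  have "sup (inf e g) (inf e (- g)) = e" by (metis inf_sup_distrib1 inf_top_right sup_compl_top)
  moreover have "inf (inf e g) (inf e (- g)) = bot"
    by (metis inf.left_commute inf_commute inf_compl_bot inf_bot_right)
  ultimately show ?thesis using m_sup[of "inf e g" "inf e (- g)"] by simp
qed

lemma m_mono: assumes "a \<le> b" shows "AE w in M. m a w \<le> m b w"
  using m_split[of b a] m_nonneg[of "inf b (- a)"] by eventually_elim (simp add: assms inf.absorb2)

lemma m_compl: "AE w in M. m e w + m (- e) w = 1"
  using m_split[of top e] m_top by eventually_elim simp

lemma m_sup_le: "AE w in M. m (sup a b) w \<le> m a w + m b w"
proof -
  have "AE w in M. m (inf (sup a b) a) w \<le> m a w" "AE w in M. m (inf (sup a b) (- a)) w \<le> m b w"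
    by (intro m_mono; simp add: inf_sup_distrib2 le_infI1)+
  then show ?thesis using m_split[of "sup a b" a] by eventually_elim simp
qed

text \<open>Order continuity only speaks of the infimum in the lattice of classes. For a sequence
  the pointwise infimum is measurable, hence a lower bound in that lattice, hence zero almost
  everywhere.\<close>

lemma m_decseq:
  assumes "decseq e" "Inf (range e) = bot"
  shows "AE w in M. (\<lambda>n. m (e n) w) \<longlonglongrightarrow> 0"
proof -
  have "\<exists>c\<in>range e. c \<le> e i \<and> c \<le> e j" for i j
    using assms(1) by (intro bexI[of _ "e (max i j)"]) (auto simp: decseq_def)
  then have inf0: "L0_is_inf M (m ` range e) (\<lambda>_. 0)"
    using meas assms(2) unfolding L0_measure_def by auto
  \<comment> \<open>The truncation at 0 bounds the sequence from below at every point and not only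
    almost everywhere, as the measurability of \<open>l\<close> requires.\<close>
  define l where "l w = (INF n. max 0 (m (e n) w))" for w
  have bdd: "bdd_below (range (\<lambda>n. max 0 (m (e n) w)))" for w by (auto simp: bdd_below_def intro!: exI[of _ 0])
  have [measurable]: "l \<in> borel_measurable M" unfolding l_def
    using bdd by (intro borel_measurable_cINF) auto
  have dec: "AE w in M. \<forall>n. m (e (Suc n)) w \<le> m (e n) w \<and> 0 \<le> m (e n) w"
    unfolding AE_all_countable using assms(1)
    by (intro allI AE_conjI m_nonneg m_mono) (simp add: decseq_Suc_iff)
  have "AE w in M. l w \<le> m (e n) w" for n using m_nonneg[of "e n"]
  proof eventually_elim
    case (elim w)
    then show ?case using bdd by (auto simp: l_def intro!: cINF_lower2[where x = n])
  qed
  then have "L0_lower M (m ` range e) l" by (auto simp: L0_lower_def)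
  then have "AE w in M. l w \<le> 0" using inf0 by (auto simp: L0_is_inf_def)
  then show ?thesis using dec
  proof eventually_elim
    case (elim w)
    have eq: "max 0 (m (e n) w) = m (e n) w" for n using elim(2) by auto
    have "decseq (\<lambda>n. m (e n) w)" using elim(2) by (simp add: decseq_Suc_iff)
    then have "(\<lambda>n. m (e n) w) \<longlonglongrightarrow> l w" unfolding l_def eq
      using bdd[of w] by (intro LIMSEQ_decseq_INF) (simp_all add: eq)
    moreover have "0 \<le> l w" unfolding l_def by (rule cINF_greatest) auto
    ultimately show ?case using elim(1) by simp
  qed
qed

lemma m_incseq:
  assumes "incseq e"
  shows "AE w in M. (\<lambda>n. m (e n) w) \<longlonglongrightarrow> m (Sup (range e)) w"
proof -
  let ?s = "Sup (range e)"
  have "Inf (range (\<lambda>n. inf ?s (- e n))) = bot"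
  proof -
    let ?z = "Inf (range (\<lambda>n. inf ?s (- e n)))"
    have z: "?z \<le> inf ?s (- e n)" for n by (rule Inf_lower) simp
    have "e n \<le> - ?z" for n using z[of n] by (metis compl_le_swap1 le_inf_iff)
    then have "?s \<le> - ?z" by (intro Sup_least) auto
    moreover have "?z \<le> ?s" using z[of 0] by simp
    ultimately have "?z \<le> - ?z" by order
    then show ?thesis by (metis inf.absorb1 inf_compl_bot)
  qed
  moreover have "decseq (\<lambda>n. inf ?s (- e n))"
    using assms by (auto simp: decseq_def incseq_def intro: le_infI2)
  ultimately have "AE w in M. (\<lambda>n. m (inf ?s (- e n)) w) \<longlonglongrightarrow> 0" by (intro m_decseq)
  moreover have "AE w in M. \<forall>n. m ?s w = m (e n) w + m (inf ?s (- e n)) w"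
    unfolding AE_all_countable
  proof (intro allI, goal_cases)
    case (1 n)
    have "inf ?s (e n) = e n" by (intro inf.absorb2 Sup_upper) simp
    then show ?case using m_split[of ?s "e n"] by simp
  qed
  ultimately show ?thesis
  proof eventually_elim
    case (elim w)
    have "(\<lambda>n. m ?s w - m (inf ?s (- e n)) w) \<longlonglongrightarrow> m ?s w - 0"
      by (intro tendsto_intros elim)
    moreover have "m ?s w - m (inf ?s (- e n)) w = m (e n) w" for n using elim(2)[rule_format, of n] by linarith
    ultimately show ?case by simp
  qed
qed

lemma \<iota>_compl: "A \<in> sets M \<Longrightarrow> \<iota> (space M - A) = - \<iota> A"
  and \<iota>_null: "A \<in> sets M \<Longrightarrow> \<iota> A = bot \<longleftrightarrow> A \<in> null_sets M"
  and \<iota>_Un: "A \<in> sets M \<Longrightarrow> B \<in> sets M \<Longrightarrow> \<iota> (A \<union> B) = sup (\<iota> A) (\<iota> B)"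
  and m_\<iota>: "A \<in> sets M \<Longrightarrow> AE w in M. m (inf (\<iota> A) e) w = indicator A w * m e w"
  using emb unfolding regular_embedding_def by blast+

lemma \<iota>_le:
  assumes "A \<in> sets M" "B \<in> sets M"
  shows "\<iota> A \<le> \<iota> B \<longleftrightarrow> (AE w in M. w \<in> A \<longrightarrow> w \<in> B)"
proof -
  have "A - B = space M - ((space M - A) \<union> B)" using sets.sets_into_space[OF assms(1)] by auto
  then have "\<iota> (A - B) = inf (\<iota> A) (- \<iota> B)"
    using assms by (simp add: \<iota>_compl \<iota>_Un sets.Un sets.Diff)
  then have "\<iota> A \<le> \<iota> B \<longleftrightarrow> A - B \<in> null_sets M"
    using assms \<iota>_null[of "A - B"] by (metis inf_shunt double_compl sets.Diff)
  also have "\<dots> \<longleftrightarrow> (AE w in M. w \<notin> A - B)" using assms by (subst AE_iff_null_sets) auto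
  finally show ?thesis by simp
qed

text \<open>An uncountable family has no usable pointwise supremum. For each rational level the sets
  where a member exceeds it have a supremum in B(Omega), which the regular embedding represents by a
  measurable set \<open>A q\<close>; the function \<open>G\<close> is reassembled from these
  countably many sets.\<close>

lemma L0_sup_exists:
  assumes S: "S \<subseteq> borel_measurable M" "f0 \<in> S" and ub: "L0_upper M S g0"
  shows "\<exists>g. L0_is_sup M S g"
proof -
  have lev: "{w \<in> space M. of_rat q < f w} \<in> sets M" if "f \<in> borel_measurable M" for f :: "'w \<Rightarrow> real" and q
    using that by measurable
  have "\<exists>A\<in>sets M. \<iota> A = Sup (\<iota> ` (\<lambda>f. {w \<in> space M. of_rat q < f w}) ` S)" for q
  proof -
    have "(\<lambda>f. {w \<in> space M. of_rat q < f w}) ` S \<subseteq> sets M" using lev S(1) by blast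
    then show ?thesis using emb unfolding regular_embedding_def by blast
  qed
  then obtain A where A: "\<And>q. A q \<in> sets M" and
    \<iota>A: "\<And>q. \<iota> (A q) = Sup (\<iota> ` (\<lambda>f. {w \<in> space M. of_rat q < f w}) ` S)" by metis
  note [measurable] = A
  define G where "G w = (SUP q::rat. if w \<in> A q then ereal (of_rat q) else - \<infinity>)" for w
  have [measurable]: "G \<in> borel_measurable M" unfolding G_def by measurable
  have low: "AE w in M. ereal (f w) \<le> G w" if f: "f \<in> S" for f
  proof -
    have "AE w in M. w \<in> {w \<in> space M. of_rat q < f w} \<longrightarrow> w \<in> A q" for q
      using f S(1) by (subst \<iota>_le[symmetric]) (auto intro!: lev A Sup_upper simp: \<iota>A)
    then have "AE w in M. \<forall>q. w \<in> {w \<in> space M. of_rat q < f w} \<longrightarrow> w \<in> A q"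
      by (simp add: AE_all_countable)
    then show ?thesis using AE_space
    proof eventually_elim
      case (elim w)
      show ?case
      proof (rule ccontr)
        assume "\<not> ereal (f w) \<le> G w"
        then obtain q where q: "G w < ereal (of_rat q)" "of_rat q < f w"
          by (metis ereal_dense3 not_le less_ereal.simps(1))
        then have "w \<in> A q" using elim by auto
        then have "ereal (of_rat q) \<le> G w" unfolding G_def by (intro SUP_upper2[of q]) auto
        with q(1) show False by simp
      qed
    qed
  qed
  have up: "AE w in M. G w \<le> ereal (h w)" if h: "L0_upper M S h" for h
  proof -
    have [measurable]: "h \<in> borel_measurable M" using h by (simp add: L0_upper_def)
    have "AE w in M. w \<in> A q \<longrightarrow> w \<in> {w \<in> space M. of_rat q < h w}" for q
    proof (subst \<iota>_le[symmetric])
      show "\<iota> (A q) \<le> \<iota> {w \<in> space M. of_rat q < h w}" unfolding \<iota>A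
      proof (rule Sup_least, clarify)
        fix f assume f: "f \<in> S"
        then have "AE w in M. f w \<le> h w" using h by (auto simp: L0_upper_def)
        then show "\<iota> {w \<in> space M. of_rat q < f w} \<le> \<iota> {w \<in> space M. of_rat q < h w}"
          using f S(1) by (subst \<iota>_le) (auto intro!: lev elim!: eventually_mono)
      qed
    qed (auto intro: A)
    then have "AE w in M. \<forall>q. w \<in> A q \<longrightarrow> w \<in> {w \<in> space M. of_rat q < h w}"
      by (simp add: AE_all_countable)
    then show ?thesis unfolding G_def
      by eventually_elim (rule SUP_least, auto)
  qed
  define g where "g w = real_of_ereal (G w)" for w
  have "AE w in M. G w = ereal (g w)"
    using low[OF S(2)] up[OF ub]
    by eventually_elim (auto simp: g_def ereal_real)
  note gG = this
  have "L0_is_sup M S g" unfolding L0_is_sup_def L0_upper_def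
  proof (intro conjI ballI allI impI)
    show "g \<in> borel_measurable M" unfolding g_def by measurable
    show "AE w in M. f w \<le> g w" if "f \<in> S" for f
      using low[OF that] gG by eventually_elim simp
    show "AE w in M. g w \<le> h w" if "h \<in> borel_measurable M \<and> (\<forall>f\<in>S. AE w in M. f w \<le> h w)" for h
      using up[of h] that gG by (auto simp: L0_upper_def)
  qed
  then show ?thesis by blast
qed

lemma L0_Sup_is_sup:
  assumes "S \<subseteq> borel_measurable M" "f0 \<in> S" "L0_upper M S g0"
  shows "L0_is_sup M S (L0_Sup M S)"
  using someI_ex[OF L0_sup_exists[OF assms]] unfolding L0_Sup_def .

lemma simple_int_measurable: "simple_int m s g \<Longrightarrow> g \<in> borel_measurable M"
  unfolding simple_int_def by auto

text \<open>The element \<open>a\<close> and the constant \<open>k\<close> make the induction go through: splitting \<open>a\<close> along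
  \<open>e n\<close> absorbs the last summand into the constant.\<close>

lemma simple_sum_nonneg:
  fixes n :: nat and k :: real
  assumes "\<forall>\<^sup>*t. t \<in> stone_set a \<longrightarrow> 0 \<le> k + (\<Sum>i<n. c i * indicator (stone_set (e i)) t)"
  shows "AE w in M. 0 \<le> k * m a w + (\<Sum>i<n. c i * m (inf a (e i)) w)"
  using assms
proof (induction n arbitrary: a k)
  case 0
  show ?case
  proof (cases "a = bot")
    case True
    then show ?thesis using m_bot by auto
  next
    case False
    obtain t where "t \<in> stone_set a" "t \<in> stone_set a \<longrightarrow> 0 \<le> k + (\<Sum>i<(0::nat). c i * indicator (stone_set (e i)) t)"
      by (rule generic_meets[OF 0 False])
    then have "0 \<le> k" by simp
    then show ?thesis using m_nonneg[of a] by auto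
  qed
next
  case (Suc n)
  let ?b = "inf a (e n)" and ?b' = "inf a (- e n)"
  have "AE w in M. 0 \<le> (k + c n) * m ?b w + (\<Sum>i<n. c i * m (inf ?b (e i)) w)"
    by (rule Suc.IH) (use Suc.prems in eventually_elim, auto simp: stone_set_inf indicator_def algebra_simps)
  moreover have "AE w in M. 0 \<le> k * m ?b' w + (\<Sum>i<n. c i * m (inf ?b' (e i)) w)"
    by (rule Suc.IH) (use Suc.prems in eventually_elim, auto simp: stone_set_inf stone_set_compl indicator_def)
  moreover have "AE w in M. \<forall>i. m (inf a (e i)) w = m (inf ?b (e i)) w + m (inf ?b' (e i)) w"
    unfolding AE_all_countable
  proof (intro allI, goal_cases)
    case (1 i)
    show ?case
      using m_split[of "inf a (e i)" "e n"] by (simp add: inf.assoc inf.left_commute inf.commute)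
  qed
  ultimately show ?case using m_split[of a "e n"]
  proof eventually_elim
    case (elim w)
    have "(\<Sum>i<n. c i * m (inf a (e i)) w) =
        (\<Sum>i<n. c i * m (inf ?b (e i)) w) + (\<Sum>i<n. c i * m (inf ?b' (e i)) w)"
      using elim(3) by (simp add: algebra_simps flip: sum.distrib)
    then show ?case using elim(1,2) unfolding elim(4) by (simp add: algebra_simps)
  qed
qed

lemma simple_int_nonneg:
  assumes "simple_int m s g" "0 \<le> s"
  shows "AE w in M. 0 \<le> g w"
proof -
  obtain n :: nat and c e where s: "s = (\<Sum>i<n. c i *\<^sub>R idem_L0 (e i))" and g: "g = (\<lambda>w. \<Sum>i<n. c i * m (e i) w)"
    using assms(1) unfolding simple_int_def by blast
  have "\<forall>\<^sup>*t. 0 \<le> rv s t" using assms(2) by (simp add: L0_le_generic)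
  then have "\<forall>\<^sup>*t. t \<in> stone_set top \<longrightarrow> 0 \<le> 0 + (\<Sum>i<n. c i * indicator (stone_set (e i)) t)"
    using generic_sum[of "{..<n}" "\<lambda>i. c i *\<^sub>R idem_L0 (e i)", OF finite_lessThan]
    by eventually_elim (simp add: s)
  from simple_sum_nonneg[OF this] show ?thesis by (simp add: g)
qed

lemma simple_int_mono:
  assumes "simple_int m s g" "simple_int m s' g'" "s \<le> s'"
  shows "AE w in M. g w \<le> g' w"
  using simple_int_nonneg[OF simple_int_diff[OF assms(2,1)]] assms(3) by simp

lemma simple_int_eq:
  assumes "simple_int m s g" "simple_int m s g'"
  shows "AE w in M. g w = g' w"
  using simple_int_mono[OF assms] simple_int_mono[OF assms(2,1)] by auto

text \<open>The integral of an integrable element is the least such bound. Working with bounds lets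
  an upper estimate prove integrability and bound the integral at the same time.\<close>

abbreviation upper :: "'b L0 \<Rightarrow> ('w \<Rightarrow> real) \<Rightarrow> bool" where
  "upper x \<equiv> L0_upper M (lower_integrals m x)"

lemma upperI:
  assumes "g \<in> borel_measurable M" "\<And>s h. simple_int m s h \<Longrightarrow> 0 \<le> s \<Longrightarrow> s \<le> x \<Longrightarrow> AE w in M. h w \<le> g w"
  shows "upper x g"
  using assms unfolding L0_upper_def lower_integrals_simple by blast

lemma upperD:
  assumes "upper x g" "simple_int m s h" "0 \<le> s" "s \<le> x"
  shows "AE w in M. h w \<le> g w"
  using assms unfolding L0_upper_def lower_integrals_simple by blast

lemma upper_measurable: "L0_upper M S g \<Longrightarrow> g \<in> borel_measurable M"
  by (simp add: L0_upper_def)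

lemma upper_mono:
  assumes "upper y g" "x \<le> y"
  shows "upper x g"
  using assms by (intro upperI) (auto intro: upper_measurable upperD order_trans)

lemma simple_approx:
  assumes "0 \<le> z" "z \<le> K *\<^sub>R one_L0" "0 < \<epsilon>"
  obtains s g where "simple_int m s g" "0 \<le> s" "s \<le> z" "z \<le> s + \<epsilon> *\<^sub>R one_L0"
proof -
  obtain n :: nat where n: "K \<le> real n * \<epsilon>" using reals_Archimedean3[OF assms(3)] by (meson less_imp_le)
  let ?e = "\<lambda>i. lvl z (real (Suc i) * \<epsilon>)"
  define s where "s = (\<Sum>i<n. \<epsilon> *\<^sub>R idem_L0 (?e i))"
  have z: "\<forall>\<^sup>*t. 0 \<le> rv z t" "\<forall>\<^sup>*t. rv z t \<le> K * rv one_L0 t"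
    using assms(1,2) unfolding L0_le_generic by (simp_all only: rv_zero rv_scaleR)
  have l: "\<forall>\<^sup>*t. \<forall>i. t \<in> stone_set (?e i) \<longleftrightarrow> real (Suc i) * \<epsilon> < rv z t"
    by (intro generic_all generic_lvl)
  have rs: "\<forall>\<^sup>*t. rv s t = (\<Sum>i<n. \<epsilon> * of_bool (real (Suc i) * \<epsilon> < rv z t))"
    using generic_sum[of "{..<n}" "\<lambda>i. \<epsilon> *\<^sub>R idem_L0 (?e i)", OF finite_lessThan] l
    by eventually_elim (auto simp: s_def indicator_def intro!: sum.cong)
  have bds: "\<forall>\<^sup>*t. 0 \<le> rv s t \<and> rv s t \<le> rv z t \<and> rv z t \<le> rv s t + \<epsilon>"
    using z rs generic_one
  proof eventually_elim
    case (elim t)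
    then have "rv z t \<le> real n * \<epsilon>" using n by simp
    with staircase_sum[OF assms(3) elim(1), of n] elim(3) assms(3) show ?case
      by (auto intro!: sum_nonneg)
  qed
  show thesis
  proof (rule that)
    show "simple_int m s (\<lambda>w. \<Sum>i<n. \<epsilon> * m (?e i) w)"
      unfolding s_def by (rule simple_int_sum)
    show "0 \<le> s" "s \<le> z" unfolding L0_le_generic using bds by (auto elim: eventually_mono)
    show "z \<le> s + \<epsilon> *\<^sub>R one_L0" unfolding L0_le_generic
      using bds generic_plus[of s "\<epsilon> *\<^sub>R one_L0"] generic_one by eventually_elim simp
  qed
qed

text \<open>A simple \<open>s\<close> below \<open>y + \<epsilon>\<close> is cut along the set where
  it exceeds \<open>\<epsilon>\<close>: there \<open>s - \<epsilon>\<close> is a simple element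
  below \<open>y\<close>, elsewhere \<open>s\<close> is at most \<open>\<epsilon>\<close>. The two
  multiples of \<open>\<epsilon>\<close> add up to \<open>\<epsilon>\<close> because
  \<open>m top\<close> is 1.\<close>

lemma upper_add_const:
  assumes "upper y h" "0 \<le> y" "0 \<le> \<epsilon>"
  shows "upper (y + \<epsilon> *\<^sub>R one_L0) (\<lambda>w. h w + \<epsilon>)"
proof (rule upperI)
  show "(\<lambda>w. h w + \<epsilon>) \<in> borel_measurable M" using upper_measurable[OF assms(1)] by measurable
  fix s k assume s: "simple_int m s k" "0 \<le> s" "s \<le> y + \<epsilon> *\<^sub>R one_L0"
  let ?e = "lvl s \<epsilon>"
  obtain g1 g2 where g: "simple_int m (restr ?e s) g1" "simple_int m (restr (- ?e) s) g2"
    using simple_int_restr[OF s(1)] by metis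
  have k: "AE w in M. k w = g1 w + g2 w"
    using simple_int_eq[OF s(1)] simple_int_add[OF g] by (simp add: restr_split)
  have pt: "\<forall>\<^sup>*t. 0 \<le> rv s t \<and> rv s t \<le> rv y t + \<epsilon> \<and> 0 \<le> rv y t \<and> (t \<in> stone_set ?e \<longleftrightarrow> \<epsilon> < rv s t) \<and> t \<in> ultrafilters"
    using s(2,3) assms(2) generic_plus[of y "\<epsilon> *\<^sub>R one_L0"] generic_one generic_lvl[of s \<epsilon>] generic_ultrafilter
    unfolding L0_le_generic by eventually_elim simp
  have "AE w in M. g1 w - \<epsilon> * m ?e w \<le> h w"
  proof (rule upperD[OF assms(1) simple_int_diff[OF g(1) simple_int_idem]])
    show "0 \<le> restr ?e s - \<epsilon> *\<^sub>R idem_L0 ?e" "restr ?e s - \<epsilon> *\<^sub>R idem_L0 ?e \<le> y"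
      unfolding L0_le_generic using pt generic_minus[of "restr ?e s" "\<epsilon> *\<^sub>R idem_L0 ?e"]
      by (eventually_elim, auto simp: indicator_def)+
  qed
  moreover have "AE w in M. g2 w \<le> \<epsilon> * m (- ?e) w"
  proof (rule simple_int_mono[OF g(2) simple_int_idem])
    show "restr (- ?e) s \<le> \<epsilon> *\<^sub>R idem_L0 (- ?e)"
      unfolding L0_le_generic using pt
      by eventually_elim (auto simp: indicator_def stone_set_compl)
  qed
  ultimately show "AE w in M. k w \<le> h w + \<epsilon>" using k m_compl[of ?e]
  proof eventually_elim
    case (elim w)
    then have "\<epsilon> * m ?e w + \<epsilon> * m (- ?e) w = \<epsilon>" by (metis mult.right_neutral distrib_left)
    then show ?case using elim by linarith
  qed
qed

lemma AE_le_epsI: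
  assumes "\<And>\<epsilon>. 0 < \<epsilon> \<Longrightarrow> AE w in M. f w \<le> g w + (\<epsilon>::real)"
  shows "AE w in M. f w \<le> g w"
proof -
  have "AE w in M. \<forall>n. f w \<le> g w + 1 / real (Suc n)"
    unfolding AE_all_countable using assms by simp
  then show ?thesis
  proof eventually_elim
    case (elim w)
    show ?case
    proof (rule field_le_epsilon)
      fix e :: real assume "0 < e"
      then obtain n where "1 / real (Suc n) < e" using reals_Archimedean by (auto simp: inverse_eq_divide)
      with elim[rule_format, of n] show "f w \<le> g w + e" by linarith
    qed
  qed
qed

text \<open>Riesz decomposition of \<open>s\<close> into \<open>inf s x\<close> and a rest below
  \<open>y\<close>. As \<open>inf s x\<close> need not be simple, it is replaced by a simple element
  within \<open>\<epsilon>\<close>, and \<open>upper_add_const\<close> absorbs the error.\<close>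

lemma upper_add:
  assumes x: "upper x g" "0 \<le> x" and y: "upper y h" "0 \<le> y"
  shows "upper (x + y) (\<lambda>w. g w + h w)"
proof (rule upperI)
  show "(\<lambda>w. g w + h w) \<in> borel_measurable M"
    using upper_measurable[OF x(1)] upper_measurable[OF y(1)] by measurable
  fix s k assume s: "simple_int m s k" "0 \<le> s" "s \<le> x + y"
  obtain K where K: "s \<le> K *\<^sub>R one_L0" using simple_int_bounded[OF s(1)] by blast
  show "AE w in M. k w \<le> g w + h w"
  proof (rule AE_le_epsI)
    fix \<epsilon> :: real assume "0 < \<epsilon>"
    moreover have "0 \<le> inf s x" "inf s x \<le> K *\<^sub>R one_L0" using s(2) x(2) K by (auto intro: le_infI1)
    ultimately obtain s1 g1 where s1: "simple_int m s1 g1" "0 \<le> s1" "s1 \<le> inf s x" "inf s x \<le> s1 + \<epsilon> *\<^sub>R one_L0"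
      using simple_approx by metis
    have "AE w in M. g1 w \<le> g w" by (rule upperD[OF x(1) s1(1,2)]) (use s1(3) in simp)
    moreover have "AE w in M. k w - g1 w \<le> h w + \<epsilon>"
    proof (rule upperD[OF upper_add_const[OF y less_imp_le[OF \<open>0 < \<epsilon>\<close>]] simple_int_diff[OF s(1) s1(1)]])
      show "0 \<le> s - s1" using s1(3) by simp
      show "s - s1 \<le> y + \<epsilon> *\<^sub>R one_L0"
        using s1(4) s(3) y(2) generic_inf[of s x] generic_plus[of s1 "\<epsilon> *\<^sub>R one_L0"]
          generic_plus[of y "\<epsilon> *\<^sub>R one_L0"] generic_plus[of x y] generic_one generic_minus[of s s1]
        using s1(2,3)
        unfolding L0_le_generic by eventually_elim (use \<open>0 < \<epsilon>\<close> in \<open>auto split: if_splits simp: min_def\<close>)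
    qed
    ultimately show "AE w in M. k w \<le> g w + h w + \<epsilon>" by eventually_elim simp
  qed
qed

lemma upper_scale:
  assumes "upper x g" "0 < c"
  shows "upper (c *\<^sub>R x) (\<lambda>w. c * g w)"
proof (rule upperI)
  show "(\<lambda>w. c * g w) \<in> borel_measurable M" using upper_measurable[OF assms(1)] by measurable
  fix s k assume s: "simple_int m s k" "0 \<le> s" "s \<le> c *\<^sub>R x"
  have "(1/c) *\<^sub>R s \<le> x" using scaleR_left_mono[OF s(3), of "1/c"] assms(2) by simp
  moreover have "0 \<le> (1/c) *\<^sub>R s" using scaleR_left_mono[OF s(2), of "1/c"] assms(2) by simp
  ultimately have "AE w in M. (1/c) * k w \<le> g w"
    by (intro upperD[OF assms(1) simple_int_scale[OF s(1)]])
  then show "AE w in M. k w \<le> c * g w" by eventually_elim (use assms(2) in \<open>simp add: field_simps\<close>)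
qed

text \<open>A simple element supported in \<open>\<iota> A\<close> does not change when it is
  restricted to \<open>\<iota> A\<close>, so its integral is multiplied by the indicator of
  \<open>A\<close>.\<close>

lemma upper_restr_\<iota>:
  assumes "upper x g" "0 \<le> x" "A \<in> sets M"
  shows "upper (restr (\<iota> A) x) (\<lambda>w. indicator A w * g w)"
proof (rule upperI)
  show "(\<lambda>w. indicator A w * g w) \<in> borel_measurable M"
    using upper_measurable[OF assms(1)] assms(3) by measurable
  fix s k assume s: "simple_int m s k" "0 \<le> s" "s \<le> restr (\<iota> A) x"
  obtain n :: nat and c e where se: "s = (\<Sum>i<n. c i *\<^sub>R idem_L0 (e i))" and k: "k = (\<lambda>w. \<Sum>i<n. c i * m (e i) w)"
    using s(1) unfolding simple_int_def by blast
  have "restr (\<iota> A) s = s" using s(2,3) unfolding L0_eq_generic L0_le_generic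
    by (eventually_elim) (auto split: if_splits)
  then have "simple_int m s (\<lambda>w. \<Sum>i<n. c i * m (inf (\<iota> A) (e i)) w)"
    unfolding simple_int_def se restr_simple by metis
  from simple_int_eq[OF s(1) this] have "AE w in M. k w = (\<Sum>i<n. c i * m (inf (\<iota> A) (e i)) w)" .
  moreover have "AE w in M. \<forall>i. m (inf (\<iota> A) (e i)) w = indicator A w * m (e i) w"
    unfolding AE_all_countable using m_\<iota>[OF assms(3)] by blast
  moreover have "AE w in M. k w \<le> g w"
  proof (rule upperD[OF assms(1) s(1,2)])
    show "s \<le> x" using s(3) assms(2) unfolding L0_le_generic
      by eventually_elim (auto split: if_splits)
  qed
  ultimately show "AE w in M. k w \<le> indicator A w * g w"
    by eventually_elim (auto simp: indicator_def)
qed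

text \<open>Monotone convergence. The elements \<open>d n\<close> on which \<open>X n\<close>
  exceeds \<open>s - \<epsilon>\<close> increase to \<open>top\<close>; on \<open>d n\<close> the
  simple element \<open>s\<close> is below \<open>X n + \<epsilon>\<close>, and what
  \<open>s\<close> has outside \<open>d n\<close> disappears in the limit.\<close>

lemma upper_monotone_limit:
  assumes X: "\<And>n. upper (X n) g" "\<And>n. 0 \<le> X n" "incseq X"
    and lim: "\<forall>\<^sup>*t. (\<lambda>n. rv (X n) t) \<longlonglongrightarrow> rv x t"
  shows "upper x g"
proof (rule upperI)
  show "g \<in> borel_measurable M" using upper_measurable[OF X(1)] .
  fix s k assume s: "simple_int m s k" "0 \<le> s" "s \<le> x"
  obtain N :: nat and c e where se: "s = (\<Sum>i<N. c i *\<^sub>R idem_L0 (e i))" and k: "k = (\<lambda>w. \<Sum>i<N. c i * m (e i) w)"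
    using s(1) unfolding simple_int_def by blast
  show "AE w in M. k w \<le> g w"
  proof (rule AE_le_epsI)
    fix \<epsilon> :: real assume \<epsilon>: "0 < \<epsilon>"
    define d where "d n = lvl (X n - s) (- \<epsilon>)" for n
    have d: "\<forall>\<^sup>*t. \<forall>n. t \<in> stone_set (d n) \<longleftrightarrow> rv s t - \<epsilon> < rv (X n) t"
    proof (rule generic_all, goal_cases)
      case (1 n)
      show ?case
        unfolding d_def using generic_lvl[of "X n - s" "- \<epsilon>"] generic_minus[of "X n" s]
        by eventually_elim auto
    qed
    have "incseq d"
    proof (rule incseq_SucI)
      fix n
      have "X n \<le> X (Suc n)" using X(3) by (simp add: incseq_SucD)
      then show "d n \<le> d (Suc n)" unfolding le_generic L0_le_generic
        using d by eventually_elim auto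
    qed
    have "top \<le> Sup (range d)" unfolding le_generic
      using d lim generic_Sup[of "range d"] s(3) unfolding L0_le_generic
    proof eventually_elim
      case (elim t)
      have "\<forall>\<^sub>F n in sequentially. rv s t - \<epsilon> < rv (X n) t"
        using elim(2) by (rule order_tendstoD(1)) (use elim(4) \<epsilon> in linarith)
      then obtain n where "rv s t - \<epsilon> < rv (X n) t" by (auto dest: eventually_happens'[OF sequentially_bot])
      then show ?case using elim(1,3) by auto
    qed
    then have "Sup (range d) = top" by (simp add: top_unique)
    then have dlim: "AE w in M. (\<lambda>n. m (d n) w) \<longlonglongrightarrow> m top w" using m_incseq[OF \<open>incseq d\<close>] by simp
    have le: "AE w in M. \<forall>n. (\<Sum>i<N. c i * m (inf (d n) (e i)) w) \<le> g w + \<epsilon>"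
      unfolding AE_all_countable
    proof (intro allI, goal_cases)
      case (1 n)
      have si: "simple_int m (restr (d n) s) (\<lambda>w. \<Sum>i<N. c i * m (inf (d n) (e i)) w)"
        unfolding simple_int_def se restr_simple by metis
      show ?case
      proof (rule upperD[OF upper_add_const[OF X(1) X(2) less_imp_le[OF \<epsilon>]] si])
        show "0 \<le> restr (d n) s" using s(2) unfolding L0_le_generic by eventually_elim simp
        show "restr (d n) s \<le> X n + \<epsilon> *\<^sub>R one_L0"
          using d X(2)[of n] generic_plus[of "X n" "\<epsilon> *\<^sub>R one_L0"] generic_one
          unfolding L0_le_generic
          by eventually_elim (use \<epsilon> in \<open>auto dest: spec[of _ n]\<close>)
      qed
    qed
    \<comment> \<open>The loss in the \<open>i\<close>-th summand is at most
      \<open>m (- d n)\<close>, which tends to 0 as \<open>m (d n)\<close> tends to 1.\<close>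
    have sp: "AE w in M. \<forall>i n. m (e i) w = m (inf (d n) (e i)) w + m (inf (e i) (- d n)) w \<and>
        0 \<le> m (inf (e i) (- d n)) w \<and> m (inf (e i) (- d n)) w \<le> m (- d n) w \<and> m (d n) w + m (- d n) w = 1"
      unfolding AE_all_countable
    proof (intro allI AE_conjI m_nonneg m_compl)
      fix i n show "AE w in M. m (e i) w = m (inf (d n) (e i)) w + m (inf (e i) (- d n)) w"
        using m_split[of "e i" "d n"] by (simp add: inf.commute)
      show "AE w in M. m (inf (e i) (- d n)) w \<le> m (- d n) w" by (intro m_mono) simp
    qed
    show "AE w in M. k w \<le> g w + \<epsilon>"
      using dlim le sp m_top
    proof eventually_elim
      case (elim w)
      have "(\<lambda>n. 1 - m (d n) w) \<longlonglongrightarrow> 1 - 1" using elim(1,4) by (intro tendsto_intros) auto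
      moreover have "1 - m (d n) w = m (- d n) w" for n using elim(3) by (simp add: algebra_simps)
      ultimately have z: "(\<lambda>n. m (- d n) w) \<longlonglongrightarrow> 0" by simp
      have "(\<lambda>n. m (inf (e i) (- d n)) w) \<longlonglongrightarrow> 0" for i
        by (rule tendsto_sandwich[OF _ _ tendsto_const z]) (use elim(3) in auto)
      then have "(\<lambda>n. m (e i) w - m (inf (e i) (- d n)) w) \<longlonglongrightarrow> m (e i) w - 0" for i
        by (intro tendsto_intros)
      moreover have "m (e i) w - m (inf (e i) (- d n)) w = m (inf (d n) (e i)) w" for i n
        using elim(3) by (simp add: algebra_simps)
      ultimately have "(\<lambda>n. m (inf (d n) (e i)) w) \<longlonglongrightarrow> m (e i) w" for i by simp
      then have "(\<lambda>n. \<Sum>i<N. c i * m (inf (d n) (e i)) w) \<longlonglongrightarrow> k w"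
        unfolding k by (intro tendsto_intros)
      then show ?case using elim(2) by (auto intro: LIMSEQ_le_const2)
    qed
  qed
qed

end

section \<open>Calculus of the integral and of L_1\<close>

lemma abs_powr_one: "abs_powr x 1 = \<bar>x\<bar>"
  unfolding L0_eq_generic by simp

lemma abs_restr: "\<bar>restr e x\<bar> = restr e \<bar>x\<bar>"
  unfolding L0_eq_generic by simp

lemma restr_nonneg: "0 \<le> x \<Longrightarrow> 0 \<le> restr e x"
  unfolding L0_le_generic by (auto elim: eventually_mono)

context L0_meas begin

abbreviation intg :: "'b L0 \<Rightarrow> bool" where "intg \<equiv> m_integrable M m"
abbreviation I :: "'b L0 \<Rightarrow> 'w \<Rightarrow> real" where "I \<equiv> m_integral M m"

lemma integrableI: "0 \<le> x \<Longrightarrow> upper x g \<Longrightarrow> intg x"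
  unfolding m_integrable_def by blast

lemma integrable_nonneg: "intg x \<Longrightarrow> 0 \<le> x"
  unfolding m_integrable_def by blast

lemma integral_is_sup:
  assumes "intg x" shows "L0_is_sup M (lower_integrals m x) (I x)"
proof -
  obtain g where g: "upper x g" and "0 \<le> x"
    using assms unfolding m_integrable_def by blast
  then have "(\<lambda>_. 0) \<in> lower_integrals m x"
    unfolding lower_integrals_simple using simple_int_zero by blast
  moreover have "lower_integrals m x \<subseteq> borel_measurable M"
    unfolding lower_integrals_simple using simple_int_measurable by blast
  ultimately show ?thesis unfolding m_integral_def by (intro L0_Sup_is_sup[OF _ _ g])
qed

lemma integral_upper: "intg x \<Longrightarrow> upper x (I x)"
  using integral_is_sup unfolding L0_is_sup_def by blast

lemma integral_least: "intg x \<Longrightarrow> upper x g \<Longrightarrow> AE w in M. I x w \<le> g w"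
  using integral_is_sup unfolding L0_is_sup_def by blast

lemma integral_measurable: "intg x \<Longrightarrow> I x \<in> borel_measurable M"
  using integral_upper upper_measurable by blast

lemma integral_nonneg: "intg x \<Longrightarrow> AE w in M. 0 \<le> I x w"
  using upperD[OF integral_upper simple_int_zero] integrable_nonneg by blast

lemma integrable_mono: "0 \<le> x \<Longrightarrow> x \<le> y \<Longrightarrow> intg y \<Longrightarrow> intg x"
  using integrableI upper_mono integral_upper by blast

lemma integral_mono: "0 \<le> x \<Longrightarrow> x \<le> y \<Longrightarrow> intg y \<Longrightarrow> AE w in M. I x w \<le> I y w"
  using integral_least[OF integrable_mono] upper_mono[OF integral_upper] by blast

lemma integrable_add: "intg x \<Longrightarrow> intg y \<Longrightarrow> intg (x + y)"
  by (rule integrableI[OF add_nonneg_nonneg upper_add[OF integral_upper _ integral_upper]])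
     (assumption | erule integrable_nonneg)+

lemma integral_add:
  assumes "intg x" "intg y"
  shows "AE w in M. I (x + y) w = I x w + I y w"
proof -
  note xy = integrable_add[OF assms]
  have nn: "0 \<le> x" "0 \<le> y" using assms integrable_nonneg by auto
  have "AE w in M. I (x + y) w \<le> I x w + I y w"
    using integral_least[OF xy upper_add[OF integral_upper[OF assms(1)] nn(1) integral_upper[OF assms(2)] nn(2)]] .
  \<comment> \<open>Superadditivity: the supremum is taken first over simple elements below
    \<open>x\<close>, with one below \<open>y\<close> held fixed, and then over the latter.\<close>
  moreover have "AE w in M. I y w \<le> I (x + y) w - I x w"
  proof (rule integral_least[OF assms(2)], rule upperI)
    show "(\<lambda>w. I (x + y) w - I x w) \<in> borel_measurable M"
      using integral_measurable[OF xy] integral_measurable[OF assms(1)] by measurable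
    fix t k assume t: "simple_int m t k" "0 \<le> t" "t \<le> y"
    have "AE w in M. I x w \<le> I (x + y) w - k w"
    proof (rule integral_least[OF assms(1)], rule upperI)
      show "(\<lambda>w. I (x + y) w - k w) \<in> borel_measurable M"
        using integral_measurable[OF xy] simple_int_measurable[OF t(1)] by measurable
      fix s h assume s: "simple_int m s h" "0 \<le> s" "s \<le> x"
      have "AE w in M. h w + k w \<le> I (x + y) w"
        using upperD[OF integral_upper[OF xy] simple_int_add[OF s(1) t(1)]] s t
        by (simp add: add_mono add_nonneg_nonneg)
      then show "AE w in M. h w \<le> I (x + y) w - k w" by eventually_elim simp
    qed
    then show "AE w in M. k w \<le> I (x + y) w - I x w" by eventually_elim simp
  qed
  ultimately show ?thesis by eventually_elim simp
qed

lemma upper_idem: "upper (idem_L0 e) (m e)"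
  using simple_int_mono[OF _ simple_int_idem[where c = 1 and e = e]] by (intro upperI) auto

lemma idem_nonneg: "0 \<le> idem_L0 e"
  unfolding L0_le_generic by simp

lemma integrable_idem: "intg (idem_L0 e)"
  using integrableI[OF idem_nonneg upper_idem] .

lemma integral_idem: "AE w in M. I (idem_L0 e) w = m e w"
proof -
  have "AE w in M. 1 * m e w \<le> I (idem_L0 e) w"
    by (rule upperD[OF integral_upper[OF integrable_idem] simple_int_idem]) (auto simp: idem_nonneg)
  then show ?thesis using integral_least[OF integrable_idem upper_idem, of e] by eventually_elim simp
qed

lemma integrable_zero: "intg 0"
  using integrable_mono[OF order_refl idem_nonneg integrable_idem] .

lemma integral_zero: "AE w in M. I 0 w = 0"
  using integral_add[OF integrable_zero integrable_zero] by eventually_elim simp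

lemma integrable_scale: "intg x \<Longrightarrow> 0 \<le> c \<Longrightarrow> intg (c *\<^sub>R x)"
proof (cases "c = 0")
  case False
  assume "intg x" "0 \<le> c"
  with False have "0 < c" by simp
  then show ?thesis using upper_scale[OF integral_upper[OF \<open>intg x\<close>]] integrable_nonneg[OF \<open>intg x\<close>]
    by (intro integrableI) (auto simp: scaleR_nonneg_nonneg)
qed (simp add: integrable_zero)

lemma integral_scale:
  assumes "intg x" "0 \<le> c"
  shows "AE w in M. I (c *\<^sub>R x) w = c * I x w"
proof (cases "c = 0")
  case True
  then show ?thesis using integral_zero by simp
next
  case False
  with assms have c: "0 < c" by simp
  have 1: "AE w in M. I (c *\<^sub>R x) w \<le> c * I x w"
    by (rule integral_least[OF integrable_scale[OF assms] upper_scale[OF integral_upper[OF assms(1)] c]])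
  have "AE w in M. I ((1/c) *\<^sub>R (c *\<^sub>R x)) w \<le> (1/c) * I (c *\<^sub>R x) w"
    using c by (intro integral_least integrable_scale upper_scale integral_upper assms) auto
  then have "AE w in M. I x w \<le> (1/c) * I (c *\<^sub>R x) w" using c by simp
  with 1 show ?thesis by eventually_elim (use c in \<open>auto simp: field_simps\<close>)
qed

lemma integrable_sum: "finite A \<Longrightarrow> (\<And>i. i \<in> A \<Longrightarrow> intg (f i)) \<Longrightarrow> intg (\<Sum>i\<in>A. f i)"
  by (induction rule: finite_induct) (auto simp: integrable_zero integrable_add)

lemma integral_sum:
  assumes "finite A" "\<And>i. i \<in> A \<Longrightarrow> intg (f i)"
  shows "AE w in M. I (\<Sum>i\<in>A. f i) w = (\<Sum>i\<in>A. I (f i) w)"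
  using assms
proof (induction rule: finite_induct)
  case empty
  then show ?case using integral_zero by simp
next
  case (insert i A)
  have "AE w in M. I (f i + sum f A) w = I (f i) w + I (sum f A) w"
    using insert by (intro integral_add integrable_sum) auto
  moreover have "AE w in M. I (sum f A) w = (\<Sum>i\<in>A. I (f i) w)" using insert by auto
  ultimately show ?case by eventually_elim (simp add: insert)
qed

lemma
  fixes n :: nat
  assumes f: "\<And>i. intg (f i)" and c: "\<And>i. 0 \<le> c i"
  shows integrable_combination: "intg (\<Sum>i<n. c i *\<^sub>R f i)"
    and integral_combination: "AE w in M. I (\<Sum>i<n. c i *\<^sub>R f i) w = (\<Sum>i<n. c i * I (f i) w)"
proof -
  show "intg (\<Sum>i<n. c i *\<^sub>R f i)" by (intro integrable_sum integrable_scale f c) simp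
  have "AE w in M. \<forall>i. I (c i *\<^sub>R f i) w = c i * I (f i) w"
    unfolding AE_all_countable by (intro allI integral_scale f c)
  moreover have "AE w in M. I (\<Sum>i<n. c i *\<^sub>R f i) w = (\<Sum>i<n. I (c i *\<^sub>R f i) w)"
    by (intro integral_sum integrable_scale f c) simp
  ultimately show "AE w in M. I (\<Sum>i<n. c i *\<^sub>R f i) w = (\<Sum>i<n. c i * I (f i) w)"
    by eventually_elim simp
qed

lemma integrable_const: "0 \<le> c \<Longrightarrow> intg (c *\<^sub>R one_L0)"
  by (intro integrable_scale integrable_idem)

lemma integral_const:
  assumes "0 \<le> c" shows "AE w in M. I (c *\<^sub>R one_L0) w = c"
  using integral_scale[OF integrable_idem assms, of top] integral_idem[of top] m_top
  by eventually_elim simp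

lemma integral_le_add_const:
  assumes "0 \<le> x" "x \<le> y + c *\<^sub>R one_L0" "intg y" "0 \<le> c"
  shows "AE w in M. I x w \<le> I y w + c"
  using integral_mono[OF assms(1,2) integrable_add[OF assms(3) integrable_const[OF assms(4)]]]
    integral_add[OF assms(3) integrable_const[OF assms(4)]] integral_const[OF assms(4)]
  by eventually_elim simp

lemma restr_le: "0 \<le> x \<Longrightarrow> restr e x \<le> x"
  unfolding L0_le_generic by (auto elim: eventually_mono)

text \<open>The upper estimate holds for \<open>A\<close> and for its complement, and the two
  restrictions add up to \<open>x\<close>; so neither estimate can be strict.\<close>

lemma integral_restr_\<iota>:
  assumes "intg x" "A \<in> sets M"
  shows "AE w in M. I (restr (\<iota> A) x) w = indicator A w * I x w"
proof -
  have nn: "0 \<le> x" using integrable_nonneg[OF assms(1)] .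
  have i: "intg (restr e x)" for e
    using integrable_mono[OF restr_nonneg restr_le assms(1)] nn by blast
  have 1: "AE w in M. I (restr (\<iota> B) x) w \<le> indicator B w * I x w" if "B \<in> sets M" for B
    by (rule integral_least[OF i upper_restr_\<iota>[OF integral_upper[OF assms(1)] nn that]])
  have "AE w in M. I (restr (\<iota> A) x + restr (\<iota> (space M - A)) x) w =
      I (restr (\<iota> A) x) w + I (restr (\<iota> (space M - A)) x) w"
    by (rule integral_add[OF i i])
  then have "AE w in M. I x w = I (restr (\<iota> A) x) w + I (restr (\<iota> (space M - A)) x) w"
    using assms(2) by (simp add: \<iota>_compl restr_split)
  moreover have "AE w in M. 0 \<le> I (restr (\<iota> A) x) w" "AE w in M. 0 \<le> I (restr (\<iota> (space M - A)) x) w"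
    using integral_nonneg i by blast+
  ultimately show ?thesis using 1[OF assms(2)] 1[OF sets.compl_sets[OF assms(2)]] AE_space
    by eventually_elim (auto simp: indicator_def split: if_splits)
qed

abbreviation L1 :: "'b L0 set" where "L1 \<equiv> Lp M m 1"

lemma L1_iff: "x \<in> L1 \<longleftrightarrow> intg \<bar>x\<bar>"
  by (simp add: Lp_def abs_powr_one)

lemma L1_norm:
  assumes "x \<in> L1" shows "AE w in M. Lp_norm M m 1 x w = I \<bar>x\<bar> w"
  using integral_nonneg[of "\<bar>x\<bar>"] assms unfolding L1_iff
  by (auto simp: Lp_norm_def abs_powr_one elim: eventually_mono)

lemma L1_mono: "y \<in> L1 \<Longrightarrow> \<bar>x\<bar> \<le> \<bar>y\<bar> \<Longrightarrow> x \<in> L1"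
  unfolding L1_iff using integrable_mono abs_ge_zero by blast

lemma L1_add: "x \<in> L1 \<Longrightarrow> y \<in> L1 \<Longrightarrow> x + y \<in> L1"
  unfolding L1_iff using integrable_mono[OF abs_ge_zero abs_triangle_ineq integrable_add] by blast

lemma abs_scaleR_L0: "\<bar>c *\<^sub>R x\<bar> = \<bar>c\<bar> *\<^sub>R \<bar>x :: 'b L0\<bar>"
  unfolding L0_eq_generic by (simp add: abs_mult)

lemma L1_scale: "x \<in> L1 \<Longrightarrow> c *\<^sub>R x \<in> L1"
  unfolding L1_iff by (simp add: abs_scaleR_L0 integrable_scale)

lemma L1_zero: "0 \<in> L1"
  unfolding L1_iff by (simp add: integrable_zero)

lemma L1_uminus: "x \<in> L1 \<Longrightarrow> - x \<in> L1"
  unfolding L1_iff by simp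

lemma L1_diff: "x \<in> L1 \<Longrightarrow> y \<in> L1 \<Longrightarrow> x - y \<in> L1"
  using L1_add[of x "- y"] L1_uminus by simp

lemma L1_sum: "(\<And>i. i \<in> A \<Longrightarrow> f i \<in> L1) \<Longrightarrow> (\<Sum>i\<in>A. f i) \<in> L1"
  by (induction A rule: infinite_finite_induct) (auto simp: L1_zero L1_add)

lemma L1_bounded: "\<bar>x\<bar> \<le> K *\<^sub>R one_L0 \<Longrightarrow> x \<in> L1"
proof (rule L1_mono)
  show "K *\<^sub>R one_L0 \<in> L1" unfolding L1_iff
    by (simp add: abs_scaleR_L0 integrable_scale integrable_idem idem_nonneg)
  assume "\<bar>x\<bar> \<le> K *\<^sub>R one_L0"
  also have "\<dots> \<le> \<bar>K *\<^sub>R one_L0\<bar>" by (rule abs_ge_self)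
  finally show "\<bar>x\<bar> \<le> \<bar>K *\<^sub>R one_L0\<bar>" .
qed

lemma L1_restr: "x \<in> L1 \<Longrightarrow> restr e x \<in> L1"
  by (erule L1_mono) (simp add: abs_restr restr_le)

lemma norm_triangle:
  assumes "x \<in> L1" "y \<in> L1"
  shows "AE w in M. I \<bar>x + y\<bar> w \<le> I \<bar>x\<bar> w + I \<bar>y\<bar> w"
proof -
  have "AE w in M. I \<bar>x + y\<bar> w \<le> I (\<bar>x\<bar> + \<bar>y\<bar>) w"
    using assms unfolding L1_iff by (intro integral_mono integrable_add abs_triangle_ineq) auto
  then show ?thesis using integral_add[OF assms[unfolded L1_iff]] by eventually_elim simp
qed

end

section \<open>Contractions and the maximal inequality\<close>

locale L0_contraction = L0_meas M m \<iota> for M :: "'w measure" and m :: "'b::complete_ba \<Rightarrow> 'w \<Rightarrow> real" and \<iota> +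
  fixes T :: "'b L0 \<Rightarrow> 'b L0"
  assumes T: "T \<in> C1inf M m"
begin

lemma T_L1: "x \<in> L1 \<Longrightarrow> T x \<in> L1"
  and T_add: "x \<in> L1 \<Longrightarrow> y \<in> L1 \<Longrightarrow> T (x + y) = T x + T y"
  and T_scale: "x \<in> L1 \<Longrightarrow> T (r *\<^sub>R x) = r *\<^sub>R T x"
  using T unfolding C1inf_def by blast+

lemma T_zero: "T 0 = 0"
  using T_scale[OF L1_zero, of 0] by simp

lemma T_diff: "x \<in> L1 \<Longrightarrow> y \<in> L1 \<Longrightarrow> T (x - y) = T x - T y"
  using T_add[of x "- y"] T_scale[of y "-1"] L1_uminus by simp

lemma T_sum: "(\<And>i. i \<in> A \<Longrightarrow> f i \<in> L1) \<Longrightarrow> T (\<Sum>i\<in>A. f i) = (\<Sum>i\<in>A. T (f i))"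
  by (induction A rule: infinite_finite_induct) (auto simp: T_zero T_add L1_sum)

lemma iter_L1: "x \<in> L1 \<Longrightarrow> (T ^^ k) x \<in> L1"
  by (induction k) (auto simp: T_L1)

lemma iter_add: "x \<in> L1 \<Longrightarrow> y \<in> L1 \<Longrightarrow> (T ^^ k) (x + y) = (T ^^ k) x + (T ^^ k) y"
  by (induction k) (auto simp: T_add iter_L1)

lemma iter_scale: "x \<in> L1 \<Longrightarrow> (T ^^ k) (r *\<^sub>R x) = r *\<^sub>R (T ^^ k) x"
  by (induction k) (auto simp: T_scale iter_L1)

lemma iter_diff: "x \<in> L1 \<Longrightarrow> y \<in> L1 \<Longrightarrow> (T ^^ k) (x - y) = (T ^^ k) x - (T ^^ k) y"
  by (induction k) (auto simp: T_diff iter_L1)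

lemma iter_sum: "(\<And>i. i \<in> A \<Longrightarrow> f i \<in> L1) \<Longrightarrow> (T ^^ k) (\<Sum>i\<in>A. f i) = (\<Sum>i\<in>A. (T ^^ k) (f i))"
  by (induction k) (auto simp: T_sum iter_L1)

text \<open>\<open>L1_opnorm\<close> is a chosen representative of a supremum and bounds its set
  only once that supremum is known to exist. On the unit ball the function \<open>c\<close> from
  L_0(Omega)-boundedness is an upper bound, which secures existence.\<close>

lemma T_norm_unit:
  assumes "z \<in> L1" "AE w in M. I \<bar>z\<bar> w \<le> 1"
  shows "AE w in M. I \<bar>T z\<bar> w \<le> 1"
proof -
  let ?S = "{Lp_norm M m 1 (T x) | x. x \<in> L1 \<and> (AE w in M. Lp_norm M m 1 x w \<le> 1)}"
  obtain c where c: "c \<in> borel_measurable M" "AE w in M. 0 \<le> c w"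
    "\<And>x. x \<in> L1 \<Longrightarrow> AE w in M. Lp_norm M m 1 (T x) w \<le> c w * Lp_norm M m 1 x w"
    using T unfolding C1inf_def by blast
  have z: "Lp_norm M m 1 (T z) \<in> ?S"
  proof -
    have "AE w in M. Lp_norm M m 1 z w \<le> 1" using assms(2) L1_norm[OF assms(1)] by eventually_elim simp
    with assms(1) show ?thesis by blast
  qed
  have "L0_upper M ?S c" unfolding L0_upper_def
  proof (intro conjI ballI c(1))
    fix f assume "f \<in> ?S"
    then obtain x where x: "f = Lp_norm M m 1 (T x)" "x \<in> L1" "AE w in M. Lp_norm M m 1 x w \<le> 1" by blast
    show "AE w in M. f w \<le> c w" using c(3)[OF x(2)] c(2) x(3)
    proof eventually_elim
      case (elim w)
      then have "c w * Lp_norm M m 1 x w \<le> c w * 1" by (intro mult_left_mono) auto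
      then show ?case using elim x(1) by simp
    qed
  qed
  moreover have "?S \<subseteq> borel_measurable M"
  proof
    fix f assume "f \<in> ?S"
    then obtain x where x: "f = Lp_norm M m 1 (T x)" "x \<in> L1" by blast
    have "f = (\<lambda>w. I \<bar>T x\<bar> w powr 1)" by (auto simp: x(1) Lp_norm_def abs_powr_one)
    then show "f \<in> borel_measurable M" using integral_measurable[of "\<bar>T x\<bar>"] T_L1[OF x(2)] L1_iff by simp
  qed
  ultimately have "L0_is_sup M ?S (L1_opnorm M m T)"
    unfolding L1_opnorm_def using z by (intro L0_Sup_is_sup) auto
  then have "AE w in M. Lp_norm M m 1 (T z) w \<le> L1_opnorm M m T w"
    using z unfolding L0_is_sup_def L0_upper_def by blast
  moreover have "AE w in M. L1_opnorm M m T w \<le> 1" using T unfolding C1inf_def by blast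
  ultimately show ?thesis using L1_norm[OF T_L1[OF assms(1)]] by eventually_elim simp
qed

text \<open>The part of \<open>x\<close> off \<open>A\<close> has norm 0 on \<open>A\<close>, and
  the bound by a multiple of the norm carries this over to its image. This takes the place of
  linearity over L_0(Omega).\<close>

lemma T_local:
  assumes x: "x \<in> L1" and A: "A \<in> sets M"
  shows "AE w in M. w \<in> A \<longrightarrow> I \<bar>T x\<bar> w \<le> I \<bar>T (restr (\<iota> A) x)\<bar> w"
proof -
  let ?B = "space M - A"
  have B: "?B \<in> sets M" using A by auto
  obtain c where c: "\<And>x. x \<in> L1 \<Longrightarrow> AE w in M. Lp_norm M m 1 (T x) w \<le> c w * Lp_norm M m 1 x w"
    using T unfolding C1inf_def by blast
  note L = L1_restr[OF x, of "\<iota> A"] L1_restr[OF x, of "\<iota> ?B"]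
  have "T x = T (restr (\<iota> A) x) + T (restr (\<iota> ?B) x)"
    using T_add[OF L] A by (simp add: \<iota>_compl restr_split)
  then have "AE w in M. I \<bar>T x\<bar> w \<le> I \<bar>T (restr (\<iota> A) x)\<bar> w + I \<bar>T (restr (\<iota> ?B) x)\<bar> w"
    using norm_triangle[OF T_L1[OF L(1)] T_L1[OF L(2)]] by simp
  moreover have "AE w in M. I \<bar>T (restr (\<iota> ?B) x)\<bar> w \<le> c w * I \<bar>restr (\<iota> ?B) x\<bar> w"
    using c[OF L(2)] L1_norm[OF L(2)] L1_norm[OF T_L1[OF L(2)]] by eventually_elim simp
  moreover have "AE w in M. I \<bar>restr (\<iota> ?B) x\<bar> w = indicator ?B w * I \<bar>x\<bar> w"
    using integral_restr_\<iota>[OF _ B, of "\<bar>x\<bar>"] x by (simp add: L1_iff abs_restr)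
  ultimately show ?thesis by eventually_elim (auto simp: indicator_def)
qed

text \<open>Instead of dividing \<open>x\<close> by its L_0(Omega)-valued norm, \<open>x\<close> is
  restricted to the set where the norm is at most a positive rational, scaled into the unit ball,
  and the estimate is localised to that set. Rationals decreasing to the norm finish the proof and
  also cover points where it vanishes.\<close>

lemma T_norm:
  assumes x: "x \<in> L1"
  shows "AE w in M. I \<bar>T x\<bar> w \<le> I \<bar>x\<bar> w"
proof -
  have xi: "intg \<bar>x\<bar>" using x by (simp add: L1_iff)
  have [measurable]: "I \<bar>x\<bar> \<in> borel_measurable M" using integral_measurable[OF xi] .
  have "AE w in M. \<forall>q::rat. 0 < q \<longrightarrow> I \<bar>x\<bar> w \<le> of_rat q \<longrightarrow> I \<bar>T x\<bar> w \<le> of_rat q"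
    unfolding AE_all_countable
  proof
    fix q :: rat
    show "AE w in M. 0 < q \<longrightarrow> I \<bar>x\<bar> w \<le> of_rat q \<longrightarrow> I \<bar>T x\<bar> w \<le> of_rat q"
    proof (cases "0 < q")
      case True
      define r :: real where "r = of_rat q"
      have r: "0 < r" using True by (simp add: r_def)
      define A where "A = {w \<in> space M. I \<bar>x\<bar> w \<le> r}"
      have A: "A \<in> sets M" unfolding A_def by measurable
      define z where "z = (1 / r) *\<^sub>R restr (\<iota> A) x"
      note L = L1_restr[OF x, of "\<iota> A"]
      have zL: "z \<in> L1" unfolding z_def by (intro L1_scale L)
      have "AE w in M. I \<bar>z\<bar> w = (1 / r) * I \<bar>restr (\<iota> A) x\<bar> w"
        using integral_scale[of "\<bar>restr (\<iota> A) x\<bar>" "1 / r"] L r by (simp add: z_def abs_scaleR_L0 L1_iff)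
      moreover have "AE w in M. I \<bar>restr (\<iota> A) x\<bar> w = indicator A w * I \<bar>x\<bar> w"
        using integral_restr_\<iota>[OF xi A] by (simp add: abs_restr)
      ultimately have "AE w in M. I \<bar>z\<bar> w \<le> 1"
      proof eventually_elim
        case (elim w)
        then show ?case using r by (cases "w \<in> A") (simp_all add: A_def)
      qed
      from T_norm_unit[OF zL this] have "AE w in M. I \<bar>T z\<bar> w \<le> 1" .
      moreover have "AE w in M. I \<bar>T z\<bar> w = (1 / r) * I \<bar>T (restr (\<iota> A) x)\<bar> w"
        using integral_scale[of "\<bar>T (restr (\<iota> A) x)\<bar>" "1 / r"] T_L1[OF L] r
        by (simp add: z_def T_scale[OF L] abs_scaleR_L0 L1_iff)
      ultimately show ?thesis using T_local[OF x A] AE_space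
        by eventually_elim (use r in \<open>auto simp: A_def r_def[symmetric] field_simps\<close>)
    qed simp
  qed
  then show ?thesis using integral_nonneg[OF xi]
  proof eventually_elim
    case (elim w)
    show ?case
    proof (rule dense_ge)
      fix r assume "I \<bar>x\<bar> w < r"
      then obtain q where q: "I \<bar>x\<bar> w < of_rat q" "of_rat q < r" using of_rat_dense by blast
      then have "0 < q" using elim(2) by (metis le_less_trans zero_less_of_rat_iff)
      then show "I \<bar>T x\<bar> w \<le> r" using elim(1) q by force
    qed
  qed
qed

lemma T_bounded:
  assumes x: "\<bar>x\<bar> \<le> K *\<^sub>R one_L0" and K: "0 < K"
  shows "\<bar>T x\<bar> \<le> K *\<^sub>R one_L0"
proof -
  define z where "z = (1 / K) *\<^sub>R x"
  have xL: "x \<in> L1" using L1_bounded[OF x] .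
  have "\<bar>L0_val x t\<bar> \<le> ereal K" for t
  proof -
    have "\<bar>L0_val x t\<bar> \<le> ereal K * indicator (stone_set top) t"
      using x unfolding less_eq_L0_def val_abs val_scaleR val_idem by blast
    then show ?thesis using K by (auto simp: indicator_def split: if_splits intro: order_trans)
  qed
  then have "\<bar>L0_val z t\<bar> \<le> 1" for t
  proof -
    have "\<bar>L0_val x t\<bar> \<le> ereal K" by fact
    then show ?thesis unfolding z_def using K by (cases "L0_val x t") (auto simp: field_simps)
  qed
  note z1 = this
  have "\<bar>L0_val z t\<bar> \<noteq> \<infinity>" for t using z1[of t] by auto
  then have "z \<in> Linf" unfolding Linf_def by blast
  moreover have "Linf_norm z \<le> 1" unfolding Linf_norm_def using z1 by (intro SUP_least)
  ultimately have "Linf_norm (T z) \<le> Linf_opnorm T" unfolding Linf_opnorm_def by (intro SUP_upper) auto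
  also have "\<dots> \<le> 1" using T unfolding C1inf_def by blast
  finally have Tz: "\<bar>L0_val (T z) t\<bar> \<le> 1" for t
    unfolding Linf_norm_def by (rule order_trans[OF SUP_upper[OF UNIV_I]])
  have "\<bar>rv (T z) t\<bar> \<le> 1" for t
    using Tz[of t] unfolding rv_def by (cases "L0_val (T z) t") auto
  moreover have "T z = (1 / K) *\<^sub>R T x" unfolding z_def by (rule T_scale[OF xL])
  ultimately have "\<bar>rv (T x) t\<bar> \<le> K" for t using K by (simp add: abs_mult field_simps)
  then have bd: "rv \<bar>T x\<bar> t \<le> K" for t by simp
  show ?thesis unfolding L0_le_generic using generic_one by eventually_elim (use bd in simp)
qed

lemma iter_bounded: "\<bar>x\<bar> \<le> K *\<^sub>R one_L0 \<Longrightarrow> 0 < K \<Longrightarrow> \<bar>(T ^^ k) x\<bar> \<le> K *\<^sub>R one_L0"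
  by (induction k) (auto simp: T_bounded)

end

section \<open>Truncation and the filling scheme\<close>

definition cutoff :: "'b::complete_ba L0 \<Rightarrow> 'b L0 \<Rightarrow> 'b L0" where
  "cutoff h g = sup (- h) (inf g h)"

lemma generic_cutoff: "\<forall>\<^sup>*t. rv (cutoff h g) t = max (- rv h t) (min (rv g t) (rv h t))"
  using generic_sup[of "- h" "inf g h"] generic_inf[of g h]
  by eventually_elim (simp add: cutoff_def)

text \<open>The last clause is an equality because truncation keeps the sign; it makes the mass
  balance of the filling scheme exact.\<close>

lemma cutoff_le:
  assumes "0 \<le> h"
  shows "\<bar>cutoff h g\<bar> \<le> h" "\<bar>cutoff h g\<bar> \<le> \<bar>g\<bar>" "\<bar>g - cutoff h g\<bar> \<le> \<bar>g\<bar>"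
    "\<bar>g\<bar> = \<bar>cutoff h g\<bar> + \<bar>g - cutoff h g\<bar>"
  using assms generic_cutoff[of h g] generic_minus[of g "cutoff h g"]
    generic_plus[of "\<bar>cutoff h g\<bar>" "\<bar>g - cutoff h g\<bar>"]
  unfolding L0_le_generic L0_eq_generic by (eventually_elim, simp add: max_def min_def; linarith)+

lemma sum_triangle_swap:
  fixes F :: "nat \<Rightarrow> nat \<Rightarrow> 'a::comm_monoid_add"
  shows "(\<Sum>k<n. \<Sum>j\<le>k. F (k - j) j) = (\<Sum>i<n. \<Sum>j<n - i. F i j)"
proof (induction n)
  case (Suc n)
  have "(\<Sum>i<Suc n. \<Sum>j<Suc n - i. F i j) = (\<Sum>i<Suc n. (\<Sum>j<n - i. F i j) + F i (n - i))"
    by (intro sum.cong) (auto simp: Suc_diff_le less_Suc_eq_le)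
  also have "\<dots> = (\<Sum>i<n. \<Sum>j<n - i. F i j) + (\<Sum>i<Suc n. F i (n - i))"
    by (simp add: sum.distrib add.assoc)
  also have "(\<Sum>i<Suc n. F i (n - i)) = (\<Sum>j\<le>n. F (n - j) j)"
    using sum.nat_diff_reindex[of "\<lambda>j. F (n - j) j" "Suc n"]
    by (simp add: lessThan_Suc_atMost[symmetric] cong: sum.cong_simp)
  finally show ?case using Suc by simp
qed simp

context L0_contraction begin

text \<open>Chacon's filling scheme. With capacity \<open>h 0 = a\<close> everywhere, each step deposits as much of the
  current mass \<open>g j\<close> as fits (\<open>d j\<close>) and moves the excess \<open>r j\<close> on by \<open>T\<close>. All deposits together are bounded
  by \<open>a\<close>, so their contribution to the weighted sums is controlled by the \<open>L\<^sub>\<infinity>\<close>-contractivity alone; hence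
  the maximal function can exceed \<open>a\<close> only where some excess is left, that is, where the capacity is used up.
  Neither positivity of \<open>T\<close> nor a linear modulus is needed, and the weights come for free.\<close>

lemma maximal_inequality:
  fixes \<alpha> :: "nat \<Rightarrow> real" and N :: nat
  assumes x: "x \<in> L1" and a: "0 < a" and \<alpha>: "\<And>k. \<bar>\<alpha> k\<bar> \<le> 1"
    and e: "\<forall>\<^sup>*t. t \<in> stone_set e \<longrightarrow>
      a < \<bar>rv x t\<bar> \<or> (\<exists>n\<in>{1..N}. real n * a < \<bar>rv (\<Sum>k<n. \<alpha> k *\<^sub>R (T ^^ k) x) t\<bar>)"
    and e': "\<forall>\<^sup>*t. a < \<bar>rv x t\<bar> \<longrightarrow> t \<in> stone_set e"
  shows "AE w in M. a * m e w \<le> I (restr e \<bar>x\<bar>) w"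
proof -
  define st where "st = rec_nat (x, a *\<^sub>R one_L0) (\<lambda>_ (g, h). (T (g - cutoff h g), h - \<bar>cutoff h g\<bar>))"
  define g where "g j = fst (st j)" for j
  define h where "h j = snd (st j)" for j
  define d where "d j = cutoff (h j) (g j)" for j
  define r where "r j = g j - d j" for j
  have g0: "g 0 = x" and gS: "g (Suc j) = T (r j)" and h0: "h 0 = a *\<^sub>R one_L0"
    and hS: "h (Suc j) = h j - \<bar>d j\<bar>" for j
    by (simp_all add: g_def h_def st_def r_def d_def split_beta)
  have inv: "g j \<in> L1 \<and> 0 \<le> h j" for j
  proof (induction j)
    case 0
    then show ?case using x a by (simp add: g0 h0 scaleR_nonneg_nonneg idem_nonneg)
  next
    case (Suc j)
    then have "r j \<in> L1" using cutoff_le(3)[of "h j" "g j"] by (auto simp: r_def d_def intro: L1_mono)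
    then show ?case using cutoff_le(1)[of "h j" "g j"] Suc by (simp add: gS hS T_L1 d_def)
  qed
  have dL: "d j \<in> L1" and rL: "r j \<in> L1" for j
    using inv[of j] cutoff_le(2,3)[of "h j" "g j"] by (auto simp: r_def d_def intro: L1_mono)
  have gsplit: "\<bar>g j\<bar> = \<bar>d j\<bar> + \<bar>r j\<bar>" for j
    using cutoff_le(4)[of "h j" "g j"] inv[of j] by (simp add: d_def r_def)
  have pt: "\<forall>\<^sup>*t. \<forall>j. rv (d j) t = max (- rv (h j) t) (min (rv (g j) t) (rv (h j) t)) \<and>
      rv (r j) t = rv (g j) t - rv (d j) t \<and> rv (h (Suc j)) t = rv (h j) t - \<bar>rv (d j) t\<bar> \<and> 0 \<le> rv (h j) t"
  proof (intro generic_all, goal_cases)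
    case (1 j)
    have "\<forall>\<^sup>*t. 0 \<le> rv (h j) t" using inv[of j] by (simp add: L0_le_generic)
    then show ?case
      using generic_cutoff[of "h j" "g j"] generic_minus[of "g j" "d j"] generic_minus[of "h j" "\<bar>d j\<bar>"]
      by eventually_elim (simp add: d_def[symmetric] r_def[symmetric] hS)
  qed
  have pt0: "\<forall>\<^sup>*t. rv (h 0) t = a"
    using generic_one by eventually_elim (simp add: h0)
  have hsum: "\<forall>\<^sup>*t. \<forall>q. (\<Sum>j<q. \<bar>rv (d j) t\<bar>) = a - rv (h q) t"
    using pt pt0
  proof eventually_elim
    case (elim t)
    have "(\<Sum>j<q. \<bar>rv (d j) t\<bar>) = a - rv (h q) t" for q
      using elim by (induction q) simp_all
    then show ?case by blast
  qed
  \<comment> \<open>In the orbit of \<open>x\<close> the deposit made at step \<open>j\<close> is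
    still carried by \<open>T\<close> through the remaining \<open>k - j\<close> steps.\<close>
  have iter: "(T ^^ k) x = r k + (\<Sum>j\<le>k. (T ^^ (k - j)) (d j))" for k
  proof (induction k)
    case 0
    then show ?case by (simp add: r_def g0)
  next
    case (Suc k)
    have "(T ^^ Suc k) x = T (r k) + T (\<Sum>j\<le>k. (T ^^ (k - j)) (d j))"
      using Suc by (simp add: T_add rL L1_sum iter_L1 dL)
    also have "T (\<Sum>j\<le>k. (T ^^ (k - j)) (d j)) = (\<Sum>j\<le>k. (T ^^ (Suc k - j)) (d j))"
      by (subst T_sum) (auto simp: iter_L1 dL Suc_diff_le intro!: sum.cong)
    also have "T (r k) = d (Suc k) + r (Suc k)" using gS[of k] by (simp add: r_def[of "Suc k"])
    finally show ?case by (simp add: algebra_simps)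
  qed
  \<comment> \<open>Deposits are regrouped by the number \<open>i\<close> of applications of
    \<open>T\<close> still to come. The absolute values of all deposits sum to at most
    \<open>a\<close> at a generic point, so \<open>D n i\<close>, and with it its image under
    \<open>T ^^ i\<close>, stays within \<open>a\<close>; this gives the term
    \<open>real n * a\<close> in \<open>bound\<close>.\<close>
  define D where "D n i = (\<Sum>j<n - i. \<alpha> (i + j) *\<^sub>R d j)" for n i
  have total: "(\<Sum>k<n. \<alpha> k *\<^sub>R (T ^^ k) x) = (\<Sum>k<n. \<alpha> k *\<^sub>R r k) + (\<Sum>i<n. (T ^^ i) (D n i))" for n
  proof -
    have "(\<Sum>k<n. \<alpha> k *\<^sub>R (T ^^ k) x) = (\<Sum>k<n. \<alpha> k *\<^sub>R r k) +
        (\<Sum>k<n. \<Sum>j\<le>k. \<alpha> ((k - j) + j) *\<^sub>R (T ^^ (k - j)) (d j))"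
      by (subst iter) (simp add: scaleR_add_right scaleR_sum_right sum.distrib)
    also have "(\<Sum>k<n. \<Sum>j\<le>k. \<alpha> ((k - j) + j) *\<^sub>R (T ^^ (k - j)) (d j)) =
        (\<Sum>i<n. \<Sum>j<n - i. \<alpha> (i + j) *\<^sub>R (T ^^ i) (d j))"
      by (rule sum_triangle_swap[of "\<lambda>i j. \<alpha> (i + j) *\<^sub>R (T ^^ i) (d j)"])
    also have "\<dots> = (\<Sum>i<n. (T ^^ i) (D n i))"
      unfolding D_def by (intro sum.cong refl) (simp add: iter_sum iter_scale L1_scale dL)
    finally show ?thesis .
  qed
  have Dbd: "\<bar>D n i\<bar> \<le> a *\<^sub>R one_L0" for n i
    unfolding L0_le_generic
    using generic_sum[of "{..<n - i}" "\<lambda>j. \<alpha> (i + j) *\<^sub>R d j", OF finite_lessThan] hsum pt generic_one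
  proof eventually_elim
    case (elim t)
    have "\<bar>\<Sum>j<n - i. \<alpha> (i + j) * rv (d j) t\<bar> \<le> (\<Sum>j<n - i. \<bar>\<alpha> (i + j) * rv (d j) t\<bar>)"
      by (rule sum_abs)
    also have "\<dots> \<le> (\<Sum>j<n - i. \<bar>rv (d j) t\<bar>)"
      using \<alpha> by (intro sum_mono) (simp add: abs_mult mult_left_le_one_le)
    also have "\<dots> \<le> a" using elim(2,3) by simp
    finally show ?case using elim(1,4) by (simp add: D_def)
  qed
  have TD: "\<forall>\<^sup>*t. \<forall>n i. \<bar>rv ((T ^^ i) (D n i)) t\<bar> \<le> a"
    using iter_bounded[OF Dbd a] generic_one
    by (intro generic_all) (fastforce simp: L0_le_generic elim: eventually_elim2)
  have bound: "\<forall>\<^sup>*t. \<forall>n. \<bar>rv (\<Sum>k<n. \<alpha> k *\<^sub>R (T ^^ k) x) t\<bar> \<le> (\<Sum>k<n. \<bar>rv (r k) t\<bar>) + real n * a"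
  proof (rule generic_all, goal_cases)
    case (1 n)
    show ?case
      using generic_sum[of "{..<n}" "\<lambda>k. \<alpha> k *\<^sub>R r k", OF finite_lessThan]
        generic_sum[of "{..<n}" "\<lambda>i. (T ^^ i) (D n i)", OF finite_lessThan] TD
        generic_plus[of "\<Sum>k<n. \<alpha> k *\<^sub>R r k" "\<Sum>i<n. (T ^^ i) (D n i)"]
    proof eventually_elim
      case (elim t)
      have "\<bar>\<Sum>k<n. \<alpha> k * rv (r k) t\<bar> \<le> (\<Sum>k<n. \<bar>\<alpha> k * rv (r k) t\<bar>)" by (rule sum_abs)
      also have "\<dots> \<le> (\<Sum>k<n. \<bar>rv (r k) t\<bar>)"
        using \<alpha> by (intro sum_mono) (simp add: abs_mult mult_left_le_one_le)
      finally have 1: "\<bar>\<Sum>k<n. \<alpha> k * rv (r k) t\<bar> \<le> (\<Sum>k<n. \<bar>rv (r k) t\<bar>)" .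
      have "\<bar>\<Sum>i<n. rv ((T ^^ i) (D n i)) t\<bar> \<le> (\<Sum>i<n. \<bar>rv ((T ^^ i) (D n i)) t\<bar>)" by (rule sum_abs)
      also have "\<dots> \<le> (\<Sum>i<n. a)" using elim(3) by (intro sum_mono) simp
      finally have "\<bar>\<Sum>i<n. rv ((T ^^ i) (D n i)) t\<bar> \<le> real n * a" by simp
      with 1 elim(1,2,4) show ?case unfolding total by simp
    qed
  qed
  \<comment> \<open>On \<open>e\<close> some excess \<open>r k\<close> with \<open>k \<le> N\<close>
    is nonzero. Then step \<open>k\<close> has used up the remaining capacity, and it stays used up,
    so the deposits fill all of \<open>a\<close>.\<close>
  have full: "\<forall>\<^sup>*t. t \<in> stone_set e \<longrightarrow> (\<Sum>j<Suc N. \<bar>rv (d j) t\<bar>) = a"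
    using bound hsum pt pt0 e
  proof eventually_elim
    case (elim t)
    show ?case
    proof
      assume "t \<in> stone_set e"
      then consider "a < \<bar>rv x t\<bar>" | n where "n \<in> {1..N}" "real n * a < \<bar>rv (\<Sum>k<n. \<alpha> k *\<^sub>R (T ^^ k) x) t\<bar>"
        using elim(5) by blast
      then have "\<exists>k\<le>N. rv (r k) t \<noteq> 0"
      proof cases
        case 1
        then show ?thesis using elim(3)[rule_format, of 0] elim(4)
          by (intro exI[of _ 0]) (auto simp: g0 max_def min_def abs_if split: if_splits)
      next
        case (2 n)
        then have "0 < (\<Sum>k<n. \<bar>rv (r k) t\<bar>)" using elim(1)[rule_format, of n] by linarith
        then have "\<exists>k<n. rv (r k) t \<noteq> 0"
          by (metis (no_types, lifting) abs_zero lessThan_iff less_irrefl sum.neutral)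
        then show ?thesis using 2(1) by (meson atLeastAtMost_iff less_imp_le order_trans)
      qed
      then obtain k where k: "k \<le> N" "rv (r k) t \<noteq> 0" by blast
      have hk: "rv (h (Suc k)) t = 0"
        using elim(3)[rule_format, of k] k(2) by (auto simp: max_def min_def abs_if split: if_splits)
      have "rv (h (Suc k + i)) t \<le> 0" for i
      proof (induction i)
        case (Suc i)
        then show ?case using elim(3)[rule_format, of "Suc k + i"] by simp
      qed (simp add: hk)
      from this[of "N - k"] have "rv (h (Suc N)) t = 0"
        using k(1) elim(3)[rule_format, of "Suc N"] by simp
      then show "(\<Sum>j<Suc N. \<bar>rv (d j) t\<bar>) = a" using elim(2) by simp
    qed
  qed
  \<comment> \<open>Outside \<open>e\<close> the whole of \<open>x\<close> fits into the first
    deposit. Hence the first deposit may be counted on \<open>e\<close> only, which leaves the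
    integral over \<open>e\<close> on the right-hand side instead of the full norm.\<close>
  have r0: "\<forall>\<^sup>*t. t \<notin> stone_set e \<longrightarrow> rv (r 0) t = 0"
    using e' pt pt0
  proof eventually_elim
    case (elim t)
    then show ?case using elim(2)[rule_format, of 0] by (auto simp: g0)
  qed
  have le: "a *\<^sub>R idem_L0 e \<le> restr e \<bar>d 0\<bar> + (\<Sum>j<N. \<bar>d (Suc j)\<bar>)"
    unfolding L0_le_generic
    using full generic_plus[of "restr e \<bar>d 0\<bar>" "\<Sum>j<N. \<bar>d (Suc j)\<bar>"]
      generic_sum[of "{..<N}" "\<lambda>j. \<bar>d (Suc j)\<bar>", OF finite_lessThan]
  proof eventually_elim
    case (elim t)
    show ?case
    proof (cases "t \<in> stone_set e")
      case True
      with elim(1) have "\<bar>rv (d 0) t\<bar> + (\<Sum>j<N. \<bar>rv (d (Suc j)) t\<bar>) = a"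
        by (simp only: sum.lessThan_Suc_shift True simp_thms)
      then show ?thesis using True elim by simp
    qed (use elim in \<open>simp add: sum_nonneg\<close>)
  qed
  have int: "intg \<bar>d j\<bar>" "intg \<bar>r j\<bar>" "intg (restr e \<bar>d j\<bar>)" for j
    using dL[of j] rL[of j] L1_restr[OF dL[of j], of e] unfolding L1_iff by (simp_all add: abs_restr)
  have intS: "intg (\<Sum>j<N. \<bar>d (Suc j)\<bar>)" by (intro integrable_sum int) simp
  have "AE w in M. I (a *\<^sub>R idem_L0 e) w \<le> I (restr e \<bar>d 0\<bar> + (\<Sum>j<N. \<bar>d (Suc j)\<bar>)) w"
    using a by (intro integral_mono le integrable_add int intS) (simp add: scaleR_nonneg_nonneg idem_nonneg)
  moreover have "AE w in M. I (a *\<^sub>R idem_L0 e) w = a * I (idem_L0 e) w"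
    using a by (intro integral_scale integrable_idem) simp
  moreover note integral_idem[of e] integral_add[OF int(3) intS, of 0]
  moreover have "AE w in M. I (\<Sum>j<N. \<bar>d (Suc j)\<bar>) w = (\<Sum>j<N. I \<bar>d (Suc j)\<bar> w)"
    by (intro integral_sum int) simp
  \<comment> \<open>Mass balance: \<open>T\<close> does not increase the norm of the excess, and the
    new mass splits exactly into deposit and excess. Summed over \<open>j\<close> this
    telescopes.\<close>
  moreover have "AE w in M. \<forall>j. I \<bar>d (Suc j)\<bar> w \<le> I \<bar>r j\<bar> w - I \<bar>r (Suc j)\<bar> w \<and> 0 \<le> I \<bar>r j\<bar> w"
    unfolding AE_all_countable
  proof (intro allI, goal_cases)
    case (1 j)
    have "AE w in M. I \<bar>g (Suc j)\<bar> w = I \<bar>d (Suc j)\<bar> w + I \<bar>r (Suc j)\<bar> w"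
      unfolding gsplit by (rule integral_add[OF int(1,2)])
    moreover have "AE w in M. I \<bar>g (Suc j)\<bar> w \<le> I \<bar>r j\<bar> w" unfolding gS by (rule T_norm[OF rL])
    moreover note integral_nonneg[OF int(2), of j]
    ultimately show ?case
      by eventually_elim simp
  qed
  moreover have "restr e \<bar>x\<bar> = restr e \<bar>d 0\<bar> + \<bar>r 0\<bar>"
    unfolding L0_eq_generic using r0 generic_plus[of "restr e \<bar>d 0\<bar>" "\<bar>r 0\<bar>"]
      generic_plus[of "\<bar>d 0\<bar>" "\<bar>r 0\<bar>", folded gsplit]
    by eventually_elim (simp add: g0)
  then have "AE w in M. I (restr e \<bar>x\<bar>) w = I (restr e \<bar>d 0\<bar>) w + I \<bar>r 0\<bar> w"
    using integral_add[OF int(3,2)] by simp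
  ultimately show ?thesis
  proof eventually_elim
    case (elim w)
    have "(\<Sum>j<N. I \<bar>d (Suc j)\<bar> w) \<le> (\<Sum>j<N. I \<bar>r j\<bar> w - I \<bar>r (Suc j)\<bar> w)"
      using elim(6) by (intro sum_mono) blast
    also have "\<dots> = I \<bar>r 0\<bar> w - I \<bar>r N\<bar> w" by (rule sum_lessThan_telescope')
    also have "\<dots> \<le> I \<bar>r 0\<bar> w" using elim(6) by simp
    finally show ?case using elim by simp
  qed
qed

text \<open>Adjoining the level set of \<open>\<bar>x\<bar>\<close> to \<open>e\<close> enforces the
  second condition of \<open>maximal_inequality\<close>, at the price of the full norm on the
  right.\<close>

lemma weak_maximal_inequality:
  fixes \<alpha> :: "nat \<Rightarrow> real" and N :: nat
  assumes x: "x \<in> L1" and a: "0 < a" and \<alpha>: "\<And>k. \<bar>\<alpha> k\<bar> \<le> 1"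
    and e: "\<forall>\<^sup>*t. t \<in> stone_set e \<longrightarrow>
      (\<exists>n\<in>{1..N}. real n * a < \<bar>rv (\<Sum>k<n. \<alpha> k *\<^sub>R (T ^^ k) x) t\<bar>)"
  shows "AE w in M. a * m e w \<le> I \<bar>x\<bar> w"
proof -
  let ?e = "sup e (lvl \<bar>x\<bar> a)"
  have "AE w in M. a * m ?e w \<le> I (restr ?e \<bar>x\<bar>) w"
    by (rule maximal_inequality[OF x a \<alpha>, where N = N])
       (use e generic_lvl[of "\<bar>x\<bar>" a] in \<open>eventually_elim, auto simp: stone_set_sup\<close>)+
  moreover have "AE w in M. m e w \<le> m ?e w" by (rule m_mono) simp
  moreover have "AE w in M. I (restr ?e \<bar>x\<bar>) w \<le> I \<bar>x\<bar> w"
    using x unfolding L1_iff by (intro integral_mono restr_nonneg restr_le) auto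
  ultimately show ?thesis
  proof eventually_elim
    case (elim w)
    have "a * m e w \<le> a * m ?e w" using elim(2) a by simp
    then show ?case using elim by linarith
  qed
qed

end

section \<open>Averages with cosine weights\<close>

text \<open>Riemann sums with mesh \<open>\<delta>\<close> for the integral of
  \<open>2 * max 0 (u - a)\<close> over \<open>a\<close>. Left endpoints of a decreasing function
  give an upper sum, and the overshoot is at most the first term
  \<open>2 * \<delta> * u\<close>.\<close>

lemma riemann_square:
  fixes u \<delta> :: real
  assumes "0 \<le> u" "0 \<le> \<delta>"
  shows "u\<^sup>2 - (max 0 (u - real n * \<delta>))\<^sup>2 \<le> (\<Sum>i<n. 2 * \<delta> * max 0 (u - real i * \<delta>))"
    and "(\<Sum>i<n. 2 * \<delta> * max 0 (u - real i * \<delta>)) \<le> u\<^sup>2 + 2 * \<delta> * u"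
proof -
  have step: "(max 0 v)\<^sup>2 - (max 0 (v - \<delta>))\<^sup>2 \<le> 2 * \<delta> * max 0 v"
    "2 * \<delta> * max 0 (v - \<delta>) \<le> (max 0 v)\<^sup>2 - (max 0 (v - \<delta>))\<^sup>2" for v :: real
  proof -
    have "v\<^sup>2 \<le> 2 * \<delta> * v" if "0 \<le> v" "v < \<delta>"
      using mult_right_mono[of v "2 * \<delta>" v] that by (simp add: power2_eq_square)
    then show "(max 0 v)\<^sup>2 - (max 0 (v - \<delta>))\<^sup>2 \<le> 2 * \<delta> * max 0 v"
      using assms(2) by (cases "v < 0"; cases "v < \<delta>") (auto simp: max_def power2_diff)
    show "2 * \<delta> * max 0 (v - \<delta>) \<le> (max 0 v)\<^sup>2 - (max 0 (v - \<delta>))\<^sup>2"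
      using assms(2) zero_le_square[of \<delta>]
      by (cases "v < \<delta>") (auto simp: max_def power2_eq_square algebra_simps)
  qed
  have sh: "u - real (Suc i) * \<delta> = (u - real i * \<delta>) - \<delta>" for i by (simp add: algebra_simps)
  show "u\<^sup>2 - (max 0 (u - real n * \<delta>))\<^sup>2 \<le> (\<Sum>i<n. 2 * \<delta> * max 0 (u - real i * \<delta>))"
  proof (induction n)
    case (Suc n)
    then show ?case using step(1)[of "u - real n * \<delta>"] unfolding sh sum.lessThan_Suc by linarith
  qed (use assms in simp)
  have *: "(\<Sum>i<Suc n. 2 * \<delta> * max 0 (u - real i * \<delta>)) \<le> u\<^sup>2 + 2 * \<delta> * u - (max 0 (u - real n * \<delta>))\<^sup>2" for n
  proof (induction n)
    case (Suc n)
    then show ?case using step(2)[of "u - real n * \<delta>"] unfolding sh sum.lessThan_Suc[of _ "Suc n"] by linarith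
  qed (use assms in simp)
  show "(\<Sum>i<n. 2 * \<delta> * max 0 (u - real i * \<delta>)) \<le> u\<^sup>2 + 2 * \<delta> * u"
  proof (cases n)
    case (Suc k)
    have "0 \<le> (max 0 (u - real k * \<delta>))\<^sup>2" by simp
    then show ?thesis using *[of k] unfolding Suc by linarith
  qed (use assms in simp)
qed

lemma shifted_sum_diff:
  fixes p :: "nat \<Rightarrow> real"
  assumes "\<And>i. \<bar>p i\<bar> \<le> K"
  shows "\<bar>(\<Sum>i<n. p (i + l)) - (\<Sum>i<n. p i)\<bar> \<le> 2 * real l * K"
proof (induction l)
  case (Suc l)
  have "(\<Sum>i<n. p (i + Suc l)) - (\<Sum>i<n. p (i + l)) = p (n + l) - p l"
    using sum_lessThan_telescope[of "\<lambda>i. p (i + l)" n] by (simp add: sum_subtractf)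
  then have "\<bar>(\<Sum>i<n. p (i + Suc l)) - (\<Sum>i<n. p (i + l))\<bar> \<le> 2 * K"
    using assms[of "n + l"] assms[of l] by linarith
  then show ?case using Suc by (simp add: algebra_simps)
qed simp

text \<open>Averaging the \<open>n\<close>-th average again over \<open>m\<close> shifts changes it
  only by edge terms, of order \<open>m / n\<close>.\<close>

lemma double_average_close:
  fixes p :: "nat \<Rightarrow> real"
  assumes p: "\<And>i. \<bar>p i\<bar> \<le> K" and "0 < n" "0 < m"
  shows "\<bar>1 / real n * (\<Sum>i<n. 1 / real m * (\<Sum>l<m. p (l + i))) - 1 / real n * (\<Sum>i<n. p i)\<bar>
    \<le> 2 * real m * K / real n"
proof -
  have K: "0 \<le> K" using p[of 0] by linarith
  have eq: "1 / real n * (\<Sum>i<n. 1 / real m * (\<Sum>l<m. p (l + i))) - 1 / real n * (\<Sum>i<n. p i) =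
      1 / (real n * real m) * (\<Sum>l<m. (\<Sum>i<n. p (i + l)) - (\<Sum>i<n. p i))"
  proof -
    have "(\<Sum>i<n. 1 / real m * (\<Sum>l<m. p (l + i))) = 1 / real m * (\<Sum>l<m. \<Sum>i<n. p (i + l))"
      unfolding sum_distrib_left[symmetric] by (subst sum.swap) (simp add: add.commute)
    then show ?thesis using assms(2,3) by (simp add: sum_subtractf field_simps)
  qed
  have "\<bar>\<Sum>l<m. (\<Sum>i<n. p (i + l)) - (\<Sum>i<n. p i)\<bar> \<le> (\<Sum>l<m. 2 * real m * K)"
  proof (rule order_trans[OF sum_abs sum_mono])
    fix l assume "l \<in> {..<m}"
    then have "2 * real l * K \<le> 2 * real m * K" using K by (intro mult_right_mono) auto
    then show "\<bar>(\<Sum>i<n. p (i + l)) - (\<Sum>i<n. p i)\<bar> \<le> 2 * real m * K"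
      using shifted_sum_diff[where p = p and K = K and n = n and l = l, OF p] by linarith
  qed
  then have "1 / (real n * real m) * \<bar>\<Sum>l<m. (\<Sum>i<n. p (i + l)) - (\<Sum>i<n. p i)\<bar>
      \<le> 1 / (real n * real m) * (real m * (2 * real m * K))"
    by (intro mult_left_mono) auto
  also have "\<dots> = 2 * real m * K / real n" using assms(3) by simp
  finally show ?thesis unfolding eq using assms(2,3) by (simp add: abs_mult)
qed

text \<open>The usual argument that a minimising sequence in a convex set of a Hilbert space is Cauchy, in the form that
  applies at almost every point of \<open>\<Omega>\<close>: \<open>Q n\<close> and \<open>W n k\<close> are the squared norms of the \<open>n\<close>-th average and of the
  midpoint of the \<open>n\<close>-th and the \<open>k\<close>-th.\<close>

lemma nearly_minimal_parallelogram:
  fixes Q :: "nat \<Rightarrow> real" and W D :: "nat \<Rightarrow> nat \<Rightarrow> real"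
  assumes Q0: "\<And>n. 0 \<le> Q n" and WQ: "\<And>n. W n n = Q n"
    and QW: "\<And>N n k. 0 < N \<Longrightarrow> 0 < n \<Longrightarrow> 0 < k \<Longrightarrow> Q N \<le> W n k + C * real (max n k) / real N"
    and D: "\<And>n k. D n k = 2 * Q n + 2 * Q k - 4 * W n k" and "0 < \<delta>"
  shows "\<exists>n0>0. \<forall>n\<ge>n0. \<forall>k\<ge>n0. D n k \<le> \<delta>"
proof -
  define \<gamma> where "\<gamma> = Inf (Q ` {0<..})"
  have bdd: "bdd_below (Q ` {0<..})" using Q0 by (auto simp: bdd_below_def)
  have low: "\<gamma> \<le> Q n" if "0 < n" for n unfolding \<gamma>_def using that bdd by (intro cInf_lower) auto
  have lim: "(\<lambda>N. c + C * d / real N) \<longlonglongrightarrow> c" for c d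
  proof -
    have "(\<lambda>N. c + C * d / real N) \<longlonglongrightarrow> c + 0" by (intro tendsto_add tendsto_const lim_const_over_n)
    then show ?thesis by simp
  qed
  have W: "\<gamma> \<le> W n k" if "0 < n" "0 < k" for n k
  proof (rule LIMSEQ_le_const[OF lim[of "W n k" "real (max n k)"]], intro exI[of _ 1] allI impI)
    fix N :: nat assume "1 \<le> N"
    then show "\<gamma> \<le> W n k + C * real (max n k) / real N" using QW[of N n k] low[of N] that by simp
  qed
  have "\<exists>y\<in>Q ` {0<..}. y < \<gamma> + \<delta> / 8"
    unfolding \<gamma>_def using \<open>0 < \<delta>\<close> by (intro cInf_lessD) auto
  then obtain k where k: "0 < k" "Q k < \<gamma> + \<delta> / 8" by auto
  have "\<forall>\<^sub>F N in sequentially. Q k + C * real k / real N < \<gamma> + \<delta> / 8"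
    by (rule order_tendstoD(2)[OF lim k(2)])
  then obtain N0 where N0: "\<And>N. N \<ge> N0 \<Longrightarrow> Q k + C * real k / real N < \<gamma> + \<delta> / 8"
    by (auto simp: eventually_sequentially)
  show ?thesis
  proof (intro exI[of _ "max 1 N0"] conjI allI impI)
    fix i j assume ij: "max 1 N0 \<le> i" "max 1 N0 \<le> j"
    have *: "Q n \<le> \<gamma> + \<delta> / 8" if "max 1 N0 \<le> n" for n
      using QW[of n k k] N0[of n] that k(1) by (simp add: WQ)
    show "D i j \<le> \<delta>" using *[OF ij(1)] *[OF ij(2)] W[of i j] ij \<open>0 < \<delta>\<close> unfolding D by simp
  qed simp
qed

section \<open>Squares, excesses and the contraction of L_2\<close>

abbreviation sq :: "'b::complete_ba L0 \<Rightarrow> 'b L0" where "sq x \<equiv> abs_powr x 2"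

lemma rv_sq [simp]: "rv (sq x) t = (rv x t)\<^sup>2"
  by (simp add: powr_numeral)

lemma sq_nonneg: "0 \<le> sq x"
  unfolding L0_le_generic by simp

definition exc :: "real \<Rightarrow> 'b::complete_ba L0 \<Rightarrow> 'b L0" where
  "exc a x = \<bar>x - cutoff (a *\<^sub>R one_L0) x\<bar>"

lemma generic_exc:
  assumes "0 \<le> a"
  shows "\<forall>\<^sup>*t. rv (exc a x) t = max 0 (\<bar>rv x t\<bar> - a)"
  using generic_cutoff[of "a *\<^sub>R one_L0" x] generic_minus[of x "cutoff (a *\<^sub>R one_L0) x"] generic_one
  by eventually_elim (use assms in \<open>auto simp: exc_def max_def min_def abs_if\<close>)

context L0_meas begin

lemma generic_bounded: "\<bar>x\<bar> \<le> K *\<^sub>R one_L0 \<longleftrightarrow> (\<forall>\<^sup>*t. \<bar>rv x t\<bar> \<le> K)"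
proof -
  have "(\<forall>\<^sup>*t. rv \<bar>x\<bar> t \<le> rv (K *\<^sub>R one_L0) t) \<longleftrightarrow> (\<forall>\<^sup>*t. \<bar>rv x t\<bar> \<le> K)"
    by (rule eventually_cong[OF generic_one]) simp
  then show ?thesis by (simp only: L0_le_generic)
qed

lemma integrable_sq:
  assumes "\<bar>x\<bar> \<le> K *\<^sub>R one_L0"
  shows "intg (sq x)"
proof (rule integrable_mono[OF sq_nonneg])
  show "sq x \<le> K\<^sup>2 *\<^sub>R one_L0" unfolding L0_le_generic
    using assms[unfolded generic_bounded] generic_one
  proof eventually_elim
    case (elim t)
    have "\<bar>rv x t\<bar>\<^sup>2 \<le> K\<^sup>2" using elim(1) by (intro power_mono) auto
    then show ?case using elim(2) by simp
  qed
qed (rule integrable_const, simp)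

text \<open>The arithmetic-geometric mean inequality with a scalar parameter \<open>\<eta>\<close>,
  in the role of Cauchy-Schwarz: it is linear in the integral, and \<open>\<eta>\<close> can be
  adapted at each point of Omega later.\<close>

lemma norm_le_sq:
  assumes "\<bar>x\<bar> \<le> K *\<^sub>R one_L0" "0 < \<eta>"
  shows "AE w in M. I \<bar>x\<bar> w \<le> \<eta> / 2 + I (sq x) w / (2 * \<eta>)"
proof -
  have le: "\<bar>x\<bar> \<le> (\<eta> / 2) *\<^sub>R one_L0 + (1 / (2 * \<eta>)) *\<^sub>R sq x"
    unfolding L0_le_generic
    using generic_one generic_plus[of "(\<eta> / 2) *\<^sub>R one_L0" "(1 / (2 * \<eta>)) *\<^sub>R sq x"]
  proof eventually_elim
    case (elim t)
    have "0 \<le> (\<bar>rv x t\<bar> - \<eta>)\<^sup>2" by simp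
    then have "2 * \<eta> * \<bar>rv x t\<bar> \<le> \<eta>\<^sup>2 + (rv x t)\<^sup>2" by (simp add: power2_diff algebra_simps)
    then have "\<bar>rv x t\<bar> \<le> \<eta> / 2 + (rv x t)\<^sup>2 / (2 * \<eta>)"
      using assms(2) by (simp add: field_simps power2_eq_square)
    then show ?case using elim by simp
  qed
  have i: "intg ((\<eta> / 2) *\<^sub>R one_L0)" "intg ((1 / (2 * \<eta>)) *\<^sub>R sq x)"
    using assms by (auto intro!: integrable_const integrable_scale integrable_sq)
  have c: "AE w in M. I ((\<eta> / 2) *\<^sub>R one_L0) w = \<eta> / 2" using assms(2) by (intro integral_const) simp
  have s: "AE w in M. I ((1 / (2 * \<eta>)) *\<^sub>R sq x) w = 1 / (2 * \<eta>) * I (sq x) w"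
    using assms by (intro integral_scale integrable_sq) auto
  show ?thesis
    using integral_mono[OF abs_ge_zero le integrable_add[OF i]] integral_add[OF i] c s
    by eventually_elim simp
qed

text \<open>The index \<open>j\<close> may depend on \<open>w\<close>. The infimum of the family
  still has measure 0 almost everywhere, so it is \<open>bot\<close>, and a generic point lies
  outside some member.\<close>

lemma generic_escape:
  fixes E :: "nat \<Rightarrow> 'b"
  assumes "AE w in M. \<forall>\<delta>>0. \<exists>j. m (E j) w \<le> \<delta>"
  shows "\<forall>\<^sup>*t. \<exists>j. t \<notin> stone_set (E j)"
proof -
  let ?e = "Inf (range E)"
  have "AE w in M. \<forall>j. m ?e w \<le> m (E j) w"
    unfolding AE_all_countable by (intro allI m_mono Inf_lower) simp
  then have "AE w in M. m ?e w = 0" using assms m_nonneg[of ?e]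
  proof eventually_elim
    case (elim w)
    have "m ?e w \<le> 0"
    proof (rule field_le_epsilon)
      fix \<delta> :: real assume "0 < \<delta>"
      then obtain j where "m (E j) w \<le> \<delta>" using elim(2) by blast
      then show "m ?e w \<le> 0 + \<delta>" using elim(1)[rule_format, of j] by linarith
    qed
    with elim(3) show ?case by simp
  qed
  then have bot: "?e = bot" using m_zero_iff by blast
  have "- Sup (range (\<lambda>j. - E j)) \<le> E j" for j
    by (metis Sup_upper compl_le_swap2 rangeI)
  then have "- Sup (range (\<lambda>j. - E j)) \<le> ?e" by (intro Inf_greatest) auto
  then have top: "Sup (range (\<lambda>j. - E j)) = top" unfolding bot
    by (metis bot_unique compl_bot_eq double_compl)
  show ?thesis using generic_Sup[of "range (\<lambda>j. - E j)"] generic_ultrafilter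
    unfolding top by eventually_elim (auto simp: stone_set_compl)
qed

end

context L0_contraction begin

text \<open>Truncating \<open>x\<close> at \<open>a\<close> leaves a part whose image is again
  bounded by \<open>a\<close>, so any excess of \<open>T x\<close> over \<open>a\<close> must come
  from the image of the rest, whose norm does not grow.\<close>

lemma excess_T:
  assumes x: "x \<in> L1" and a: "0 \<le> a"
  shows "AE w in M. I (exc a (T x)) w \<le> I (exc a x) w"
proof (cases "a = 0")
  case True
  have "exc 0 y = \<bar>y\<bar>" for y :: "'b L0"
    unfolding L0_eq_generic using generic_exc[OF order_refl, of y] by eventually_elim simp
  then show ?thesis using T_norm[OF x] by (simp add: True)
next
  case False
  then have a: "0 < a" using assms by simp
  then have nn: "0 \<le> a *\<^sub>R one_L0" by (simp add: scaleR_nonneg_nonneg idem_nonneg)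
  define p where "p = cutoff (a *\<^sub>R one_L0) x"
  define q where "q = x - p"
  have pL: "p \<in> L1" and qL: "q \<in> L1"
    using cutoff_le(2,3)[OF nn, of x] x L1_mono unfolding p_def q_def by blast+
  have eq: "T x = T p + T q" using T_add[OF pL qL] by (simp add: q_def)
  have Tp: "\<bar>T p\<bar> \<le> a *\<^sub>R one_L0"
    by (rule T_bounded[OF _ a]) (simp add: p_def cutoff_le(1)[OF nn])
  have "exc a (T x) \<le> \<bar>T q\<bar>"
    unfolding L0_le_generic
    using generic_exc[OF assms(2), of "T x"] Tp[unfolded generic_bounded] generic_plus[of "T p" "T q", folded eq]
    by eventually_elim auto
  then have "AE w in M. I (exc a (T x)) w \<le> I \<bar>T q\<bar> w"
    using T_L1[OF qL] unfolding L1_iff by (intro integral_mono) (auto simp: exc_def)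
  moreover have "AE w in M. I \<bar>T q\<bar> w \<le> I (exc a x) w"
    using T_norm[OF qL] by (simp add: q_def p_def exc_def)
  ultimately show ?thesis by eventually_elim simp
qed

text \<open>Integrate the bound on the excess over all levels \<open>a\<close>: \<open>u\<^sup>2\<close> is twice the integral of \<open>max 0 (u - a)\<close>.\<close>

lemma sq_T:
  assumes x: "\<bar>x\<bar> \<le> K *\<^sub>R one_L0" and K: "0 < K"
  shows "AE w in M. I (sq (T x)) w \<le> I (sq x) w"
proof (rule AE_le_epsI)
  fix \<epsilon> :: real assume "0 < \<epsilon>"
  \<comment> \<open>The mesh \<open>K / n\<close> makes the levels end exactly at the bound
    \<open>K\<close>, so the remainder in \<open>riemann_square\<close> vanishes, and
    \<open>n\<close> is large enough for the overshoot \<open>2 * \<delta> * K\<close> to stay below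
    \<open>\<epsilon>\<close>.\<close>
  obtain n :: nat where n: "2 * K\<^sup>2 / \<epsilon> < real n" using reals_Archimedean2 by blast
  have n0: "0 < real n" using n K \<open>0 < \<epsilon>\<close> by (smt (verit) divide_nonneg_pos zero_le_power2)
  define \<delta> where "\<delta> = K / real n"
  have \<delta>: "0 < \<delta>" using n0 K by (simp add: \<delta>_def)
  have nd: "real n * \<delta> = K" using n0 by (simp add: \<delta>_def)
  have d2: "2 * \<delta> * K \<le> \<epsilon>" using n n0 \<open>0 < \<epsilon>\<close> by (simp add: \<delta>_def field_simps power2_eq_square)
  have xL: "x \<in> L1" by (rule L1_bounded[OF x])
  define R where "R y = (\<Sum>i<n. (2 * \<delta>) *\<^sub>R exc (real i * \<delta>) y)" for y :: "'b L0"
  have Rv: "\<forall>\<^sup>*t. rv (R y) t = (\<Sum>i<n. 2 * \<delta> * max 0 (\<bar>rv y t\<bar> - real i * \<delta>))" for y :: "'b L0"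
  proof -
    have "\<forall>\<^sup>*t. \<forall>i. rv (exc (real i * \<delta>) y) t = max 0 (\<bar>rv y t\<bar> - real i * \<delta>)"
      using \<delta> by (intro generic_all generic_exc) simp
    then show ?thesis
      using generic_sum[of "{..<n}" "\<lambda>i. (2 * \<delta>) *\<^sub>R exc (real i * \<delta>) y", OF finite_lessThan]
      by eventually_elim (simp add: R_def)
  qed
  have ie: "intg (exc (real i * \<delta>) y)" if "y \<in> L1" for y i
  proof (rule integrable_mono)
    show "exc (real i * \<delta>) y \<le> \<bar>y\<bar>" unfolding exc_def
      using \<delta> by (intro cutoff_le) (simp add: scaleR_nonneg_nonneg idem_nonneg)
  qed (use that in \<open>simp_all add: exc_def L1_iff\<close>)
  have IR: "AE w in M. I (R y) w = (\<Sum>i<n. 2 * \<delta> * I (exc (real i * \<delta>) y) w)" if "y \<in> L1" for y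
    unfolding R_def using \<delta> that by (intro integral_combination ie) auto
  have iR: "intg (R y)" if "y \<in> L1" for y
    unfolding R_def using \<delta> that by (intro integrable_combination ie) auto
  have "sq (T x) \<le> R (T x)" unfolding L0_le_generic
    using Rv[of "T x"] T_bounded[OF x K, unfolded generic_bounded]
  proof eventually_elim
    case (elim t)
    then show ?case
      using riemann_square(1)[of "\<bar>rv (T x) t\<bar>" \<delta> n] \<delta> by (simp add: nd)
  qed
  then have 1: "AE w in M. I (sq (T x)) w \<le> I (R (T x)) w"
    by (intro integral_mono sq_nonneg iR T_L1 xL)
  have le: "R x \<le> sq x + (2 * \<delta> * K) *\<^sub>R one_L0" unfolding L0_le_generic
    using Rv[of x] x[unfolded generic_bounded] generic_plus[of "sq x" "(2 * \<delta> * K) *\<^sub>R one_L0"] generic_one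
  proof eventually_elim
    case (elim t)
    have "2 * \<delta> * \<bar>rv x t\<bar> \<le> 2 * \<delta> * K" using elim(2) \<delta> by (intro mult_left_mono) auto
    then have "rv (R x) t \<le> \<bar>rv x t\<bar>\<^sup>2 + 2 * \<delta> * K"
      unfolding elim(1) using riemann_square(2)[of "\<bar>rv x t\<bar>" \<delta> n] \<delta> by linarith
    then show ?case using elim by simp
  qed
  have c0: "0 \<le> 2 * \<delta> * K" using \<delta> K by simp
  have R0: "0 \<le> R x" using integrable_nonneg[OF iR[OF xL]] .
  have 2: "AE w in M. I (R x) w \<le> I (sq x) w + 2 * \<delta> * K"
    by (rule integral_le_add_const[OF R0 le integrable_sq[OF x] c0])
  have "AE w in M. \<forall>i. I (exc (real i * \<delta>) (T x)) w \<le> I (exc (real i * \<delta>) x) w"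
    unfolding AE_all_countable using \<delta> xL by (intro allI excess_T) auto
  then show "AE w in M. I (sq (T x)) w \<le> I (sq x) w + \<epsilon>"
    using 1 2 IR[OF xL] IR[OF T_L1[OF xL]]
  proof eventually_elim
    case (elim w)
    have "(\<Sum>i<n. 2 * \<delta> * I (exc (real i * \<delta>) (T x)) w) \<le> (\<Sum>i<n. 2 * \<delta> * I (exc (real i * \<delta>) x) w)"
      using elim(1) \<delta> by (intro sum_mono mult_left_mono) auto
    then show ?case using elim d2 by linarith
  qed
qed

lemma sq_iter:
  assumes x: "\<bar>x\<bar> \<le> K *\<^sub>R one_L0" and K: "0 < K"
  shows "AE w in M. I (sq ((T ^^ i) x)) w \<le> I (sq x) w"
proof (induction i)
  case (Suc i)
  then show ?case using sq_T[OF iter_bounded[OF x K, of i] K] by eventually_elim simp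
qed simp

end

lemma average_square_le:
  fixes u :: "nat \<Rightarrow> real"
  assumes "0 < N"
  shows "(1 / real N * (\<Sum>i<N. u i))\<^sup>2 \<le> 1 / real N * (\<Sum>i<N. (u i)\<^sup>2)"
proof -
  have "(\<Sum>i<N. u i)\<^sup>2 \<le> (\<Sum>i<N. (u i)\<^sup>2) * real N"
    using sum_squared_le_sum_of_squares[of u "{..<N}"] by simp
  then show ?thesis using assms by (simp add: power_divide power2_eq_square field_simps)
qed

lemma square_perturb:
  fixes A X K \<eta> :: real
  assumes "\<bar>A\<bar> \<le> K" "\<bar>X\<bar> \<le> K" "\<bar>A - X\<bar> \<le> \<eta>"
  shows "A\<^sup>2 \<le> X\<^sup>2 + 2 * K * \<eta>"
proof -
  have "A\<^sup>2 - X\<^sup>2 = (A + X) * (A - X)" by (simp add: power2_eq_square algebra_simps)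
  also have "\<dots> \<le> \<bar>A + X\<bar> * \<bar>A - X\<bar>" by (metis abs_ge_self abs_mult)
  also have "\<dots> \<le> (2 * K) * \<eta>" using assms by (intro mult_mono) auto
  finally show ?thesis by simp
qed

lemma average_abs_le:
  fixes p :: "nat \<Rightarrow> real"
  assumes "\<And>i. \<bar>p i\<bar> \<le> K"
  shows "\<bar>1 / real n * (\<Sum>i<n. p i)\<bar> \<le> K"
proof (cases "n = 0")
  case True
  then show ?thesis using assms[of 0] by simp
next
  case False
  have "\<bar>\<Sum>i<n. p i\<bar> \<le> (\<Sum>i<n. K)" by (rule order_trans[OF sum_abs sum_mono]) (rule assms)
  then show ?thesis using False by (simp add: abs_mult field_simps)
qed

section \<open>Mean convergence of rotated averages in L_2\<close>

context L0_contraction begin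

context
  fixes x :: "'b L0" and K \<theta> \<phi> :: real
  assumes x: "\<bar>x\<bar> \<le> K *\<^sub>R one_L0" and K: "0 < K"
begin

text \<open>Real and imaginary parts of the orbit of \<open>cis \<phi> x\<close> under \<open>U = cis \<theta> T\<close>, of its averages, and of its iterated
  averages; \<open>rotc\<close> and \<open>rots\<close> are the components of \<open>U ^ i (u + \<i> v)\<close>.\<close>

definition cosT :: "nat \<Rightarrow> 'b L0" where "cosT k = cos (real k * \<theta> + \<phi>) *\<^sub>R (T ^^ k) x"
definition sinT :: "nat \<Rightarrow> 'b L0" where "sinT k = sin (real k * \<theta> + \<phi>) *\<^sub>R (T ^^ k) x"
definition cosA :: "nat \<Rightarrow> 'b L0" where "cosA n = (1 / real n) *\<^sub>R (\<Sum>k<n. cosT k)"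
definition sinA :: "nat \<Rightarrow> 'b L0" where "sinA n = (1 / real n) *\<^sub>R (\<Sum>k<n. sinT k)"
definition cosAA :: "nat \<Rightarrow> nat \<Rightarrow> 'b L0" where
  "cosAA n j = (1 / real n) *\<^sub>R (\<Sum>i<n. (1 / real j) *\<^sub>R (\<Sum>l<j. cosT (l + i)))"
definition sinAA :: "nat \<Rightarrow> nat \<Rightarrow> 'b L0" where
  "sinAA n j = (1 / real n) *\<^sub>R (\<Sum>i<n. (1 / real j) *\<^sub>R (\<Sum>l<j. sinT (l + i)))"
definition rotc :: "'b L0 \<Rightarrow> 'b L0 \<Rightarrow> nat \<Rightarrow> 'b L0" where
  "rotc u v i = cos (real i * \<theta>) *\<^sub>R (T ^^ i) u - sin (real i * \<theta>) *\<^sub>R (T ^^ i) v"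
definition rots :: "'b L0 \<Rightarrow> 'b L0 \<Rightarrow> nat \<Rightarrow> 'b L0" where
  "rots u v i = sin (real i * \<theta>) *\<^sub>R (T ^^ i) u + cos (real i * \<theta>) *\<^sub>R (T ^^ i) v"

lemma x_in_L1: "x \<in> L1" using L1_bounded[OF x] .

lemma cosT_L1: "cosT k \<in> L1" and sinT_L1: "sinT k \<in> L1"
  unfolding cosT_def sinT_def by (intro L1_scale iter_L1 x_in_L1)+

lemma cosA_L1: "cosA n \<in> L1" and sinA_L1: "sinA n \<in> L1"
  unfolding cosA_def sinA_def by (intro L1_scale L1_sum cosT_L1 sinT_L1)+

lemma trig_terms_bounded: "\<forall>\<^sup>*t. \<forall>k. \<bar>rv (cosT k) t\<bar> \<le> K \<and> \<bar>rv (sinT k) t\<bar> \<le> K"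
proof (rule generic_all, goal_cases)
  case (1 k)
  show ?case
    using iter_bounded[OF x K, of k, unfolded generic_bounded]
  proof eventually_elim
    case (elim t)
    have "\<bar>c\<bar> * \<bar>rv ((T ^^ k) x) t\<bar> \<le> 1 * K" if "\<bar>c\<bar> \<le> 1" for c
      using that elim by (intro mult_mono) auto
    then show ?case by (simp add: cosT_def sinT_def abs_mult)
  qed
qed

lemma generic_averages: "\<forall>\<^sup>*t. \<forall>n. rv (cosA n) t = 1 / real n * (\<Sum>k<n. rv (cosT k) t) \<and>
    rv (sinA n) t = 1 / real n * (\<Sum>k<n. rv (sinT k) t)"
proof (rule generic_all, goal_cases)
  case (1 n)
  show ?case
    using generic_sum[OF finite_lessThan, of cosT n] generic_sum[OF finite_lessThan, of sinT n]
    by eventually_elim (simp add: cosA_def sinA_def)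
qed

lemma generic_iterated_averages: "\<forall>\<^sup>*t. \<forall>n j.
    rv (cosAA n j) t = 1 / real n * (\<Sum>i<n. 1 / real j * (\<Sum>l<j. rv (cosT (l + i)) t)) \<and>
    rv (sinAA n j) t = 1 / real n * (\<Sum>i<n. 1 / real j * (\<Sum>l<j. rv (sinT (l + i)) t))"
proof (intro generic_all, goal_cases)
  case (1 n j)
  have "\<forall>\<^sup>*t. \<forall>i. rv (\<Sum>l<j. cosT (l + i)) t = (\<Sum>l<j. rv (cosT (l + i)) t) \<and>
     rv (\<Sum>l<j. sinT (l + i)) t = (\<Sum>l<j. rv (sinT (l + i)) t)"
    by (intro generic_all eventually_conj generic_sum) auto
  then show ?case
    using generic_sum[OF finite_lessThan, of "\<lambda>i. (1 / real j) *\<^sub>R (\<Sum>l<j. cosT (l + i))" n]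
      generic_sum[OF finite_lessThan, of "\<lambda>i. (1 / real j) *\<^sub>R (\<Sum>l<j. sinT (l + i))" n]
    by eventually_elim (simp add: cosAA_def sinAA_def)
qed

lemma cosAA_close: "\<forall>\<^sup>*t. \<forall>n j. 0 < n \<longrightarrow> 0 < j \<longrightarrow>
    \<bar>rv (cosAA n j) t - rv (cosA n) t\<bar> \<le> 2 * real j * K / real n \<and>
    \<bar>rv (sinAA n j) t - rv (sinA n) t\<bar> \<le> 2 * real j * K / real n"
  using generic_iterated_averages generic_averages trig_terms_bounded
proof eventually_elim
  case (elim t)
  then show ?case
    using double_average_close[of "\<lambda>k. rv (cosT k) t" K] double_average_close[of "\<lambda>k. rv (sinT k) t" K]
    by simp
qed

lemma all_bounded: "\<forall>\<^sup>*t. \<forall>n j. \<bar>rv (cosA n) t\<bar> \<le> K \<and> \<bar>rv (sinA n) t\<bar> \<le> K \<and>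
    \<bar>rv (cosAA n j) t\<bar> \<le> K \<and> \<bar>rv (sinAA n j) t\<bar> \<le> K"
  using generic_iterated_averages generic_averages trig_terms_bounded
proof eventually_elim
  case (elim t)
  then show ?case by (auto simp only: intro!: average_abs_le)
qed

text \<open>Averages of powers of one operator commute. The symmetry allows \<open>cosAA n k\<close>
  to be read as an average of index \<open>k\<close> disturbed by a short averaging of length
  \<open>n\<close>.\<close>

lemma cosAA_sym: "0 < n \<Longrightarrow> 0 < j \<Longrightarrow> cosAA n j = cosAA j n"
  unfolding cosAA_def scaleR_sum_right
  by (subst sum.swap) (simp add: add.commute mult.commute)

text \<open>By the addition theorems, \<open>i\<close> applications of the rotated operator to an
  average just shift its terms by \<open>i\<close>. Consequently \<open>cosAA N n\<close> is the
  \<open>N\<close>-th average of that operator applied to the \<open>n\<close>-th average.\<close>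

lemma rot_averages: "rotc (cosA n) (sinA n) i = (1 / real n) *\<^sub>R (\<Sum>l<n. cosT (l + i))"
  "rots (cosA n) (sinA n) i = (1 / real n) *\<^sub>R (\<Sum>l<n. sinT (l + i))"
proof -
  have Ta: "(T ^^ i) (cosA n) = (1 / real n) *\<^sub>R (\<Sum>l<n. cos (real l * \<theta> + \<phi>) *\<^sub>R (T ^^ (l + i)) x)"
    unfolding cosA_def by (simp add: iter_scale iter_sum L1_sum cosT_L1)
      (simp add: cosT_def iter_scale iter_L1 x_in_L1 funpow_add add.commute[of _ i])
  have Tb: "(T ^^ i) (sinA n) = (1 / real n) *\<^sub>R (\<Sum>l<n. sin (real l * \<theta> + \<phi>) *\<^sub>R (T ^^ (l + i)) x)"
    unfolding sinA_def by (simp add: iter_scale iter_sum L1_sum sinT_L1)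
      (simp add: sinT_def iter_scale iter_L1 x_in_L1 funpow_add add.commute[of _ i])
  have "real (l + i) * \<theta> + \<phi> = real i * \<theta> + (real l * \<theta> + \<phi>)" for l
    by (simp add: algebra_simps)
  then have ang: "cos (real (l + i) * \<theta> + \<phi>) =
      cos (real i * \<theta>) * cos (real l * \<theta> + \<phi>) - sin (real i * \<theta>) * sin (real l * \<theta> + \<phi>)"
    "sin (real (l + i) * \<theta> + \<phi>) =
      sin (real i * \<theta>) * cos (real l * \<theta> + \<phi>) + cos (real i * \<theta>) * sin (real l * \<theta> + \<phi>)" for l
    by (simp_all only: cos_add[of "real i * \<theta>"] sin_add[of "real i * \<theta>"])
  show "rotc (cosA n) (sinA n) i = (1 / real n) *\<^sub>R (\<Sum>l<n. cosT (l + i))"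
    unfolding rotc_def Ta Tb cosT_def ang
    by (simp add: scaleR_sum_right scaleR_left_diff_distrib scaleR_diff_right sum_subtractf mult_ac)
  show "rots (cosA n) (sinA n) i = (1 / real n) *\<^sub>R (\<Sum>l<n. sinT (l + i))"
    unfolding rots_def Ta Tb sinT_def ang
    by (simp add: scaleR_sum_right scaleR_left_distrib scaleR_add_right sum.distrib mult_ac)
qed

lemma rot_diff:
  assumes "u \<in> L1" "v \<in> L1" "u' \<in> L1" "v' \<in> L1"
  shows "rotc (u - u') (v - v') i = rotc u v i - rotc u' v' i"
  unfolding rotc_def by (simp add: iter_diff assms scaleR_diff_right)

lemma rot_half:
  assumes "u \<in> L1" "v \<in> L1" "u' \<in> L1" "v' \<in> L1"
  shows "rotc ((1/2) *\<^sub>R (u + u')) ((1/2) *\<^sub>R (v + v')) i = (1/2) *\<^sub>R (rotc u v i + rotc u' v' i)"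
    "rots ((1/2) *\<^sub>R (u + u')) ((1/2) *\<^sub>R (v + v')) i = (1/2) *\<^sub>R (rots u v i + rots u' v' i)"
  unfolding rotc_def rots_def
  by (simp_all add: iter_add iter_scale L1_add L1_scale assms algebra_simps)

text \<open>Averages of the rotated operator contract L_2: convexity of the square, invariance of
  the sum of the two squares under rotation at each generic point, and
  \<open>sq_iter\<close>.\<close>

lemma average_rotation_sq:
  assumes u: "\<bar>u\<bar> \<le> K *\<^sub>R one_L0" and v: "\<bar>v\<bar> \<le> K *\<^sub>R one_L0" and N: "0 < N"
    and bd: "\<bar>(1 / real N) *\<^sub>R (\<Sum>i<N. rotc u v i)\<bar> \<le> K *\<^sub>R one_L0"
      "\<bar>(1 / real N) *\<^sub>R (\<Sum>i<N. rots u v i)\<bar> \<le> K *\<^sub>R one_L0"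
  shows "AE w in M. I (sq ((1 / real N) *\<^sub>R (\<Sum>i<N. rotc u v i))) w +
      I (sq ((1 / real N) *\<^sub>R (\<Sum>i<N. rots u v i))) w \<le> I (sq u) w + I (sq v) w"
proof -
  let ?U = "(1 / real N) *\<^sub>R (\<Sum>i<N. rotc u v i)" and ?V = "(1 / real N) *\<^sub>R (\<Sum>i<N. rots u v i)"
  let ?f = "\<lambda>i. (1 / real N) *\<^sub>R (sq ((T ^^ i) u) + sq ((T ^^ i) v))"
  have rot: "\<forall>\<^sup>*t. \<forall>i. (rv (rotc u v i) t)\<^sup>2 + (rv (rots u v i) t)\<^sup>2 =
      (rv ((T ^^ i) u) t)\<^sup>2 + (rv ((T ^^ i) v) t)\<^sup>2"
  proof (rule generic_all, goal_cases)
    case (1 i)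
    show ?case
      using generic_minus[of "cos (real i * \<theta>) *\<^sub>R (T ^^ i) u" "sin (real i * \<theta>) *\<^sub>R (T ^^ i) v"]
        generic_plus[of "sin (real i * \<theta>) *\<^sub>R (T ^^ i) u" "cos (real i * \<theta>) *\<^sub>R (T ^^ i) v"]
    proof eventually_elim
      case (elim t)
      have "(c * p - s * q)\<^sup>2 + (s * p + c * q)\<^sup>2 = (s\<^sup>2 + c\<^sup>2) * (p\<^sup>2 + q\<^sup>2)" for c s p q :: real
        by (simp add: power2_eq_square algebra_simps)
      then show ?case using elim by (simp add: rotc_def rots_def)
    qed
  qed
  have "\<forall>\<^sup>*t. \<forall>i. rv (sq ((T ^^ i) u) + sq ((T ^^ i) v)) t = (rv ((T ^^ i) u) t)\<^sup>2 + (rv ((T ^^ i) v) t)\<^sup>2"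
  proof (rule generic_all, goal_cases)
    case (1 i)
    show ?case
      using generic_plus[of "sq ((T ^^ i) u)" "sq ((T ^^ i) v)"]
      by eventually_elim simp
  qed
  then have le: "sq ?U + sq ?V \<le> (\<Sum>i<N. ?f i)" unfolding L0_le_generic
    using rot generic_plus[of "sq ?U" "sq ?V"]
      generic_sum[OF finite_lessThan, of ?f N] generic_sum[OF finite_lessThan, of "rotc u v" N]
      generic_sum[OF finite_lessThan, of "rots u v" N]
  proof eventually_elim
    case (elim t)
    have "rv (sq ?U + sq ?V) t = (1 / real N * (\<Sum>i<N. rv (rotc u v i) t))\<^sup>2 + (1 / real N * (\<Sum>i<N. rv (rots u v i) t))\<^sup>2"
      using elim(3,5,6) by simp
    also have "\<dots> \<le> 1 / real N * (\<Sum>i<N. (rv (rotc u v i) t)\<^sup>2) + 1 / real N * (\<Sum>i<N. (rv (rots u v i) t)\<^sup>2)"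
      by (intro add_mono average_square_le N)
    also have "\<dots> = 1 / real N * (\<Sum>i<N. (rv (rotc u v i) t)\<^sup>2 + (rv (rots u v i) t)\<^sup>2)"
      by (simp add: sum.distrib algebra_simps)
    also have "\<dots> = rv (\<Sum>i<N. ?f i) t" unfolding elim(4) using elim(1,2) by (simp add: sum_distrib_left)
    finally show ?case .
  qed
  have iT: "intg (sq ((T ^^ i) u))" "intg (sq ((T ^^ i) v))" for i
    using iter_bounded[OF u K] iter_bounded[OF v K] integrable_sq by blast+
  have iUV: "intg (sq ?U)" "intg (sq ?V)" using bd integrable_sq by blast+
  have isum: "intg (sq ((T ^^ i) u) + sq ((T ^^ i) v))" for i by (intro integrable_add iT)
  have "AE w in M. I (sq ?U + sq ?V) w \<le> I (\<Sum>i<N. ?f i) w"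
    by (intro integral_mono le integrable_combination isum add_nonneg_nonneg sq_nonneg) simp
  moreover have "AE w in M. I (\<Sum>i<N. ?f i) w = (\<Sum>i<N. 1 / real N * I (sq ((T ^^ i) u) + sq ((T ^^ i) v)) w)"
    by (intro integral_combination isum) simp
  moreover have "AE w in M. \<forall>i. I (sq ((T ^^ i) u) + sq ((T ^^ i) v)) w \<le> I (sq u) w + I (sq v) w"
    unfolding AE_all_countable
  proof (intro allI, goal_cases)
    case (1 i)
    show ?case
      using integral_add[OF iT, of i i] sq_iter[OF u K, of i] sq_iter[OF v K, of i]
      by eventually_elim simp
  qed
  ultimately show ?thesis using integral_add[OF iUV]
  proof eventually_elim
    case (elim w)
    have "(\<Sum>i<N. 1 / real N * I (sq ((T ^^ i) u) + sq ((T ^^ i) v)) w)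
        \<le> (\<Sum>i<N. 1 / real N * (I (sq u) w + I (sq v) w))"
      using elim(3) by (intro sum_mono mult_left_mono) auto
    also have "\<dots> = I (sq u) w + I (sq v) w" using N by simp
    finally show ?case using elim by linarith
  qed
qed

lemma averages_bounded: "\<bar>cosA n\<bar> \<le> K *\<^sub>R one_L0" "\<bar>sinA n\<bar> \<le> K *\<^sub>R one_L0"
  "\<bar>cosAA n j\<bar> \<le> K *\<^sub>R one_L0" "\<bar>sinAA n j\<bar> \<le> K *\<^sub>R one_L0"
  unfolding generic_bounded using all_bounded by (auto elim: eventually_mono)

lemma half_bounded:
  assumes "\<bar>u\<bar> \<le> K *\<^sub>R one_L0" "\<bar>v\<bar> \<le> K *\<^sub>R one_L0"
  shows "\<bar>(1/2) *\<^sub>R (u + v)\<bar> \<le> K *\<^sub>R one_L0"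
  using assms generic_plus[of u v] unfolding generic_bounded
  by eventually_elim simp

text \<open>The \<open>N\<close>-th average is close to the \<open>N\<close>-th average of the
  rotated operator applied to the midpoint, whose L_2 norm does not exceed that of the midpoint.
  Each of the two components contributes an error of
  \<open>4 * K\<^sup>2 * real (max n k) / real N\<close>.\<close>

lemma square_step:
  assumes N: "0 < N" and n: "0 < n" "0 < k"
  shows "AE w in M. I (sq (cosA N)) w + I (sq (sinA N)) w \<le>
    I (sq ((1/2) *\<^sub>R (cosA n + cosA k))) w + I (sq ((1/2) *\<^sub>R (sinA n + sinA k))) w + 8 * K\<^sup>2 * real (max n k) / real N"
proof -
  let ?u = "(1/2) *\<^sub>R (cosA n + cosA k)" and ?v = "(1/2) *\<^sub>R (sinA n + sinA k)"
  let ?A = "(1/2) *\<^sub>R (cosAA N n + cosAA N k)" and ?B = "(1/2) *\<^sub>R (sinAA N n + sinAA N k)"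
  have rot: "(1 / real N) *\<^sub>R (\<Sum>i<N. rotc ?u ?v i) = ?A" "(1 / real N) *\<^sub>R (\<Sum>i<N. rots ?u ?v i) = ?B"
    unfolding rot_half[OF cosA_L1 sinA_L1 cosA_L1 sinA_L1] rot_averages cosAA_def sinAA_def
    by (simp_all only: sum.distrib scaleR_sum_right[symmetric] scaleR_add_right scaleR_left_commute[of "1/2"])
  define c where "c = 4 * K\<^sup>2 * real (max n k) / real N"
  have c0: "0 \<le> c" by (simp add: c_def)
  have le: "sq (cosA N) \<le> sq ?A + c *\<^sub>R one_L0" "sq (sinA N) \<le> sq ?B + c *\<^sub>R one_L0"
  proof -
    have *: "X\<^sup>2 \<le> (1/2 * (Y + Z))\<^sup>2 + c"
      if "\<bar>X\<bar> \<le> K" "\<bar>Y\<bar> \<le> K" "\<bar>Z\<bar> \<le> K" "\<bar>Y - X\<bar> \<le> 2 * real n * K / real N" "\<bar>Z - X\<bar> \<le> 2 * real k * K / real N"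
      for X Y Z
    proof -
      define D where "D = 2 * real (max n k) * K / real N"
      have "2 * real n * K / real N \<le> D" "2 * real k * K / real N \<le> D"
        unfolding D_def using K by (intro divide_right_mono mult_right_mono; simp)+
      then have "\<bar>Y - X\<bar> \<le> D" "\<bar>Z - X\<bar> \<le> D" using that(4,5) by (meson order_trans)+
      then have "\<bar>X - 1/2 * (Y + Z)\<bar> \<le> 2 * real (max n k) * K / real N"
        unfolding D_def[symmetric] abs_le_iff by (auto simp: field_simps)
      moreover have "\<bar>1/2 * (Y + Z)\<bar> \<le> K" using that(2,3) by (auto simp: abs_le_iff)
      ultimately have "X\<^sup>2 \<le> (1/2 * (Y + Z))\<^sup>2 + 2 * K * (2 * real (max n k) * K / real N)"
        using that(1) by (intro square_perturb)
      then show ?thesis by (simp add: c_def power2_eq_square mult_ac)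
    qed
    show "sq (cosA N) \<le> sq ?A + c *\<^sub>R one_L0" unfolding L0_le_generic
      using all_bounded cosAA_close generic_plus[of "sq ?A" "c *\<^sub>R one_L0"] generic_plus[of "cosAA N n" "cosAA N k"] generic_one
      by eventually_elim (use * N n in \<open>simp add: \<close>)
    show "sq (sinA N) \<le> sq ?B + c *\<^sub>R one_L0" unfolding L0_le_generic
      using all_bounded cosAA_close generic_plus[of "sq ?B" "c *\<^sub>R one_L0"] generic_plus[of "sinAA N n" "sinAA N k"] generic_one
      by eventually_elim (use * N n in \<open>simp add: \<close>)
  qed
  have bA: "\<bar>?A\<bar> \<le> K *\<^sub>R one_L0" "\<bar>?B\<bar> \<le> K *\<^sub>R one_L0" by (intro half_bounded averages_bounded)+
  have "AE w in M. I (sq ?A) w + I (sq ?B) w \<le> I (sq ?u) w + I (sq ?v) w"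
    using average_rotation_sq[of ?u ?v N] bA N unfolding rot by (simp add: half_bounded averages_bounded)
  then show ?thesis
    using integral_le_add_const[OF sq_nonneg le(1) integrable_sq[OF bA(1)] c0]
      integral_le_add_const[OF sq_nonneg le(2) integrable_sq[OF bA(2)] c0]
    by eventually_elim (simp add: c_def)
qed

lemma parallelogram:
  assumes u: "\<bar>u\<bar> \<le> K *\<^sub>R one_L0" and v: "\<bar>v\<bar> \<le> K *\<^sub>R one_L0"
  shows "AE w in M. I (sq (u - v)) w = 2 * I (sq u) w + 2 * I (sq v) w - 4 * I (sq ((1/2) *\<^sub>R (u + v))) w"
proof -
  let ?h = "(1/2) *\<^sub>R (u + v)"
  have "\<bar>u - v\<bar> \<le> (2 * K) *\<^sub>R one_L0"
    using u v generic_minus[of u v] unfolding generic_bounded by eventually_elim simp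
  then have i: "intg (sq (u - v))" "intg (sq ?h)" "intg (sq u)" "intg (sq v)"
    using half_bounded[OF u v] u v integrable_sq by blast+
  define h where "h = ?h"
  have "\<forall>\<^sup>*t. rv h t = (rv u t + rv v t) / 2"
    using generic_plus[of u v] unfolding h_def rv_scaleR by eventually_elim simp
  \<comment> \<open>Arranged without subtraction of squares, since the integral is additive on
    nonnegative elements.\<close>
  then have "sq (u - v) + 4 *\<^sub>R sq h = 2 *\<^sub>R sq u + 2 *\<^sub>R sq v"
    unfolding L0_eq_generic
    using generic_plus[of "sq (u - v)" "4 *\<^sub>R sq h"] generic_plus[of "2 *\<^sub>R sq u" "2 *\<^sub>R sq v"]
      generic_minus[of u v]
  proof eventually_elim
    case (elim t)
    show ?case using elim(2-4) by (simp add: elim(1) power2_eq_square field_simps)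
  qed
  note this[unfolded h_def]
  then have "AE w in M. I (sq (u - v) + 4 *\<^sub>R sq ?h) w = I (2 *\<^sub>R sq u + 2 *\<^sub>R sq v) w" by simp
  then show ?thesis
    using integral_add[OF i(1) integrable_scale[OF i(2) zero_le_numeral], of "num.Bit0 (num.Bit0 num.One)"]
      integral_add[OF integrable_scale[OF i(3) zero_le_numeral] integrable_scale[OF i(4) zero_le_numeral],
        of "num.Bit0 num.One" "num.Bit0 num.One"]
      integral_scale[OF i(2), of 4, OF zero_le_numeral]
      integral_scale[OF i(3), of 2, OF zero_le_numeral] integral_scale[OF i(4), of 2, OF zero_le_numeral]
    by eventually_elim simp
qed

text \<open>The index \<open>n0\<close> depends on \<open>w\<close>: the nearly minimal average is
  selected separately at almost every point, after countably many null sets have been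
  discarded.\<close>

lemma averages_L2_Cauchy:
  "AE w in M. \<forall>\<delta>>0. \<exists>n0>0. \<forall>n\<ge>n0. \<forall>k\<ge>n0. I (sq (cosA n - cosA k)) w + I (sq (sinA n - sinA k)) w \<le> \<delta>"
proof -
  have 1: "AE w in M. \<forall>n. 0 \<le> I (sq (cosA n)) w + I (sq (sinA n)) w"
    unfolding AE_all_countable
  proof (intro allI, goal_cases)
    case (1 n)
    show ?case
      using integral_nonneg[OF integrable_sq[OF averages_bounded(1)], of n] integral_nonneg[OF integrable_sq[OF averages_bounded(2)], of n]
      by eventually_elim simp
  qed
  have 2: "AE w in M. \<forall>N n k. 0 < N \<longrightarrow> 0 < n \<longrightarrow> 0 < k \<longrightarrow> I (sq (cosA N)) w + I (sq (sinA N)) w \<le>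
    I (sq ((1/2) *\<^sub>R (cosA n + cosA k))) w + I (sq ((1/2) *\<^sub>R (sinA n + sinA k))) w + 8 * K\<^sup>2 * real (max n k) / real N"
    unfolding AE_all_countable
  proof (intro allI)
    fix N n k :: nat
    show "AE w in M. 0 < N \<longrightarrow> 0 < n \<longrightarrow> 0 < k \<longrightarrow> I (sq (cosA N)) w + I (sq (sinA N)) w \<le>
    I (sq ((1/2) *\<^sub>R (cosA n + cosA k))) w + I (sq ((1/2) *\<^sub>R (sinA n + sinA k))) w + 8 * K\<^sup>2 * real (max n k) / real N"
      using square_step[of N n k] by (cases "0 < N \<and> 0 < n \<and> 0 < k") auto
  qed
  have 3: "AE w in M. \<forall>n k. I (sq (cosA n - cosA k)) w = 2 * I (sq (cosA n)) w + 2 * I (sq (cosA k)) w - 4 * I (sq ((1/2) *\<^sub>R (cosA n + cosA k))) w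
     \<and> I (sq (sinA n - sinA k)) w = 2 * I (sq (sinA n)) w + 2 * I (sq (sinA k)) w - 4 * I (sq ((1/2) *\<^sub>R (sinA n + sinA k))) w"
    unfolding AE_all_countable by (intro allI AE_conjI parallelogram averages_bounded)
  have half: "(1/2) *\<^sub>R (u + u) = u" for u :: "'b L0"
    by (simp flip: scaleR_2)
  show ?thesis using 1 2 3
  proof eventually_elim
    case (elim w)
    show ?case
    proof (intro allI impI)
      fix \<delta> :: real assume "0 < \<delta>"
      show "\<exists>n0>0. \<forall>n\<ge>n0. \<forall>k\<ge>n0. I (sq (cosA n - cosA k)) w + I (sq (sinA n - sinA k)) w \<le> \<delta>"
        by (rule nearly_minimal_parallelogram[where Q = "\<lambda>n. I (sq (cosA n)) w + I (sq (sinA n)) w"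
              and W = "\<lambda>n k. I (sq ((1/2) *\<^sub>R (cosA n + cosA k))) w + I (sq ((1/2) *\<^sub>R (sinA n + sinA k))) w"
              and C = "8 * K\<^sup>2"])
          (use elim \<open>0 < \<delta>\<close> in \<open>simp_all only: half, simp_all\<close>)
    qed
  qed
qed

text \<open>Marks where the first \<open>N\<close> averages of the \<open>j\<close>-th average
  oscillate by more than \<open>\<epsilon>\<close>. The finite \<open>N\<close> keeps it within
  reach of the maximal inequality; the supremum over \<open>N\<close> is taken by continuity of
  \<open>m\<close>.\<close>

definition osc :: "real \<Rightarrow> nat \<Rightarrow> nat \<Rightarrow> 'b" where
  "osc \<epsilon> j N = Sup ((\<lambda>i. lvl (case i of (n, n') \<Rightarrow> \<bar>cosAA n j - cosAA n' j\<bar>) \<epsilon>) ` ({1..N} \<times> {1..N}))"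

lemma generic_osc: "\<forall>\<^sup>*t. t \<in> stone_set (osc \<epsilon> j N) \<longleftrightarrow>
    (\<exists>n\<in>{1..N}. \<exists>n'\<in>{1..N}. \<epsilon> < \<bar>rv (cosAA n j) t - rv (cosAA n' j) t\<bar>)"
proof -
  have "\<forall>\<^sup>*t. \<forall>n n'. rv (cosAA n j - cosAA n' j) t = rv (cosAA n j) t - rv (cosAA n' j) t"
    by (intro generic_all generic_minus)
  then show ?thesis
    using generic_Sup_lvl[of "\<lambda>(n, n'). \<bar>cosAA n j - cosAA n' j\<bar>" "\<lambda>_. \<epsilon>" "{1..N} \<times> {1..N}"]
    unfolding osc_def by eventually_elim (simp add: case_prod_unfold)
qed

text \<open>For \<open>k\<close> much larger than \<open>N\<close> the average with index \<open>k\<close> is almost invariant under the first \<open>N\<close> averages.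
  It replaces the invariant limit of the mean ergodic theorem, whose existence would require completeness.\<close>

lemma osc_measure:
  assumes \<epsilon>: "0 < \<epsilon>" and \<eta>: "0 < \<eta>" and jk: "0 < j" "0 < k" and big: "16 * real N * K \<le> \<epsilon> * real k"
  shows "AE w in M. m (osc \<epsilon> j N) w \<le>
    8 / \<epsilon> * (\<eta> + (I (sq (cosA j - cosA k)) w + I (sq (sinA j - sinA k)) w) / (2 * \<eta>))"
proof -
  let ?u = "cosA j - cosA k" and ?v = "sinA j - sinA k"
  let ?cs = "\<lambda>n. \<Sum>i<n. cos (real i * \<theta>) *\<^sub>R (T ^^ i) ?u" and ?sn = "\<lambda>n. \<Sum>i<n. sin (real i * \<theta>) *\<^sub>R (T ^^ i) ?v"
  let ?e1 = "Sup ((\<lambda>n. lvl \<bar>?cs n\<bar> (real n * (\<epsilon> / 8))) ` {1..N})"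
  let ?e2 = "Sup ((\<lambda>n. lvl \<bar>?sn n\<bar> (real n * (\<epsilon> / 8))) ` {1..N})"
  have uL: "?u \<in> L1" and vL: "?v \<in> L1" by (intro L1_diff cosA_L1 sinA_L1)+
  have e1: "\<forall>\<^sup>*t. t \<in> stone_set ?e1 \<longleftrightarrow> (\<exists>n\<in>{1..N}. real n * (\<epsilon> / 8) < \<bar>rv (?cs n) t\<bar>)"
    unfolding rv_abs[symmetric] by (rule generic_Sup_lvl)
  have e2: "\<forall>\<^sup>*t. t \<in> stone_set ?e2 \<longleftrightarrow> (\<exists>n\<in>{1..N}. real n * (\<epsilon> / 8) < \<bar>rv (?sn n) t\<bar>)"
    unfolding rv_abs[symmetric] by (rule generic_Sup_lvl)
  have m1: "AE w in M. \<epsilon> / 8 * m ?e1 w \<le> I \<bar>?u\<bar> w"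
    by (rule weak_maximal_inequality[OF uL, where N = N and \<alpha> = "\<lambda>i. cos (real i * \<theta>)"])
       (use \<epsilon> e1 in \<open>auto elim: eventually_mono\<close>)
  have m2: "AE w in M. \<epsilon> / 8 * m ?e2 w \<le> I \<bar>?v\<bar> w"
    by (rule weak_maximal_inequality[OF vL, where N = N and \<alpha> = "\<lambda>i. sin (real i * \<theta>)"])
       (use \<epsilon> e2 in \<open>auto elim: eventually_mono\<close>)
  have diff: "\<forall>\<^sup>*t. \<forall>n. real n * (rv (cosAA n j) t - rv (cosAA n k) t) = rv (?cs n) t - rv (?sn n) t"
  proof (rule generic_all, goal_cases)
    case (1 n)
    have "cosAA n j - cosAA n k = (1 / real n) *\<^sub>R (\<Sum>i<n. rotc ?u ?v i)"
      unfolding rot_diff[OF cosA_L1 sinA_L1 cosA_L1 sinA_L1] rot_averages cosAA_def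
      by (simp add: sum_subtractf scaleR_diff_right)
    also have "(\<Sum>i<n. rotc ?u ?v i) = ?cs n - ?sn n"
      unfolding rotc_def by (simp add: sum_subtractf)
    finally have eq: "cosAA n j - cosAA n k = (1 / real n) *\<^sub>R (?cs n - ?sn n)" .
    show ?case
      using generic_minus[of "cosAA n j" "cosAA n k", unfolded eq rv_scaleR] generic_minus[of "?cs n" "?sn n"]
    proof eventually_elim
      case (elim t)
      then show ?case by (cases "n = 0") (simp_all add: field_simps)
    qed
  qed
  have "osc \<epsilon> j N \<le> sup ?e1 ?e2" unfolding le_generic
    using generic_osc[of \<epsilon> j N] e1 e2 diff cosAA_close
  proof eventually_elim
    case (elim t)
    \<comment> \<open>By symmetry, short averages of the \<open>k\<close>-th average barely move it;
      the condition \<open>big\<close> is tuned so that the shift error is at most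
      \<open>\<epsilon> / 8\<close>.\<close>
    have ak: "\<bar>rv (cosAA n k) t - rv (cosA k) t\<bar> \<le> \<epsilon> / 8" if "n \<in> {1..N}" for n
    proof -
      have "2 * real n * K / real k \<le> 2 * real N * K / real k"
        using that K by (intro divide_right_mono mult_right_mono) auto
      also have "\<dots> \<le> \<epsilon> / 8" using big jk by (simp add: field_simps)
      finally show ?thesis using elim(5)[rule_format, of k n] that jk cosAA_sym[of n k] by simp
    qed
    show ?case
    proof
      assume "t \<in> stone_set (osc \<epsilon> j N)"
      then obtain n n' where n: "n \<in> {1..N}" "n' \<in> {1..N}" and big: "\<epsilon> < \<bar>rv (cosAA n j) t - rv (cosAA n' j) t\<bar>"
        using elim(1) by blast
      \<comment> \<open>Otherwise the oscillation would be at most twice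
        \<open>\<epsilon> / 4\<close> plus twice \<open>\<epsilon> / 8\<close>, which is less than
        \<open>\<epsilon>\<close>. The remaining \<open>\<epsilon> / 4\<close> is shared by the
        cosine and the sine sums, hence the level \<open>\<epsilon> / 8\<close>.\<close>
      have "\<exists>n\<in>{1..N}. \<epsilon> / 4 < \<bar>rv (cosAA n j) t - rv (cosAA n k) t\<bar>"
      proof (rule ccontr)
        assume "\<not> ?thesis"
        then have "\<bar>rv (cosAA n j) t - rv (cosAA n k) t\<bar> \<le> \<epsilon> / 4" "\<bar>rv (cosAA n' j) t - rv (cosAA n' k) t\<bar> \<le> \<epsilon> / 4"
          using n by (auto simp: not_less)
        then show False using ak[OF n(1)] ak[OF n(2)] big \<epsilon> by linarith
      qed
      then obtain p where p: "p \<in> {1..N}" "\<epsilon> / 4 < \<bar>rv (cosAA p j) t - rv (cosAA p k) t\<bar>" by blast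
      then have "real p * (\<epsilon> / 4) < real p * \<bar>rv (cosAA p j) t - rv (cosAA p k) t\<bar>"
        by (intro mult_strict_left_mono) auto
      also have "\<dots> = \<bar>rv (?cs p) t - rv (?sn p) t\<bar>"
        unfolding elim(4)[rule_format, symmetric] by (simp add: abs_mult)
      finally have "real p * (\<epsilon> / 8) < \<bar>rv (?cs p) t\<bar> \<or> real p * (\<epsilon> / 8) < \<bar>rv (?sn p) t\<bar>" by linarith
      then show "t \<in> stone_set (sup ?e1 ?e2)" using p(1) elim(2,3) by (auto simp: stone_set_sup)
    qed
  qed
  from m_mono[OF this] have mE: "AE w in M. m (osc \<epsilon> j N) w \<le> m (sup ?e1 ?e2) w" .
  have bd: "\<bar>?u\<bar> \<le> (2 * K) *\<^sub>R one_L0" "\<bar>?v\<bar> \<le> (2 * K) *\<^sub>R one_L0"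
  proof -
    show "\<bar>?u\<bar> \<le> (2 * K) *\<^sub>R one_L0" unfolding generic_bounded
      using all_bounded generic_minus[of "cosA j" "cosA k"]
      by eventually_elim (smt (verit, ccfv_threshold))
    show "\<bar>?v\<bar> \<le> (2 * K) *\<^sub>R one_L0" unfolding generic_bounded
      using all_bounded generic_minus[of "sinA j" "sinA k"]
      by eventually_elim (smt (verit, ccfv_threshold))
  qed
  show ?thesis using mE m_sup_le[of ?e1 ?e2] m1 m2 norm_le_sq[OF bd(1) \<eta>] norm_le_sq[OF bd(2) \<eta>]
  proof eventually_elim
    case (elim w)
    have "\<epsilon> / 8 * m (osc \<epsilon> j N) w \<le> \<epsilon> / 8 * m ?e1 w + \<epsilon> / 8 * m ?e2 w"
      unfolding distrib_left[symmetric] using elim(1,2) \<epsilon> by (intro mult_left_mono) auto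
    also have "\<dots> \<le> (\<eta> / 2 + I (sq ?u) w / (2 * \<eta>)) + (\<eta> / 2 + I (sq ?v) w / (2 * \<eta>))"
      using elim by linarith
    also have "\<dots> = \<eta> + (I (sq ?u) w + I (sq ?v) w) / (2 * \<eta>)" by (simp add: add_divide_distrib)
    finally show ?case using \<epsilon> by (simp add: field_simps)
  qed
qed

lemma osc_small:
  assumes \<epsilon>: "0 < \<epsilon>"
  shows "AE w in M. \<forall>\<delta>>0. \<exists>j. m (Sup (range (osc \<epsilon> (Suc j)))) w \<le> \<delta>"
proof -
  have inc: "incseq (osc \<epsilon> (Suc j))" for j
    unfolding osc_def by (intro incseq_SucI Sup_subset_mono image_mono) auto
  have lim: "AE w in M. \<forall>j. (\<lambda>N. m (osc \<epsilon> (Suc j) N) w) \<longlonglongrightarrow> m (Sup (range (osc \<epsilon> (Suc j)))) w"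
    unfolding AE_all_countable by (intro allI m_incseq inc)
  have meas: "AE w in M. \<forall>r j k N. 0 < k \<longrightarrow> 16 * real N * K \<le> \<epsilon> * real k \<longrightarrow>
    m (osc \<epsilon> (Suc j) N) w \<le> 8 / \<epsilon> * (1 / real (Suc r) +
      (I (sq (cosA (Suc j) - cosA k)) w + I (sq (sinA (Suc j) - sinA k)) w) / (2 * (1 / real (Suc r))))"
    unfolding AE_all_countable
  proof (intro allI, goal_cases)
    case (1 r j k N)
    show ?case
      using osc_measure[OF \<epsilon>, of "1 / real (Suc r)" "Suc j" k N]
      by (cases "0 < k \<and> 16 * real N * K \<le> \<epsilon> * real k") auto
  qed
  show ?thesis using lim meas averages_L2_Cauchy
  proof eventually_elim
    case (elim w)
    show ?case
    proof (intro allI impI)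
      fix \<delta> :: real assume \<delta>: "0 < \<delta>"
      \<comment> \<open>With L_2 distances of at most \<open>2 * \<eta>\<^sup>2\<close> the bound of
        \<open>osc_measure\<close> becomes \<open>16 * \<eta> / \<epsilon>\<close>. Here
        \<open>k\<close> may grow with \<open>N\<close> while \<open>j\<close> stays fixed, so the
        bound survives the limit in \<open>N\<close>.\<close>
      obtain r where "inverse (real (Suc r)) < \<delta> * \<epsilon> / 16"
        using reals_Archimedean[of "\<delta> * \<epsilon> / 16"] \<delta> \<epsilon> by auto
      define \<eta> where "\<eta> = 1 / real (Suc r)"
      have \<eta>: "0 < \<eta>" "16 * \<eta> \<le> \<delta> * \<epsilon>"
        using \<open>inverse (real (Suc r)) < \<delta> * \<epsilon> / 16\<close> by (simp_all add: \<eta>_def inverse_eq_divide)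
      then obtain n0 where n0: "n0 > 0"
        "\<And>n k. n \<ge> n0 \<Longrightarrow> k \<ge> n0 \<Longrightarrow> I (sq (cosA n - cosA k)) w + I (sq (sinA n - sinA k)) w \<le> 2 * \<eta>\<^sup>2"
        using elim(3)[rule_format, of "2 * \<eta>\<^sup>2"] by auto
      define j where "j = n0 - 1"
      have j: "Suc j = n0" using n0(1) by (simp add: j_def)
      have "m (osc \<epsilon> (Suc j) N) w \<le> \<delta>" for N
      proof -
        obtain k0 :: nat where k0: "16 * real N * K / \<epsilon> \<le> real k0" using real_arch_simple by blast
        define k where "k = max n0 k0"
        have k: "0 < k" "n0 \<le> k" "16 * real N * K \<le> \<epsilon> * real k"
        proof -
          have "16 * real N * K / \<epsilon> \<le> real k" using k0 by (simp add: k_def)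
          then show "16 * real N * K \<le> \<epsilon> * real k" using \<epsilon> by (simp add: field_simps)
        qed (use n0(1) in \<open>auto simp: k_def\<close>)
        have "m (osc \<epsilon> (Suc j) N) w \<le> 8 / \<epsilon> * (\<eta> + (I (sq (cosA (Suc j) - cosA k)) w + I (sq (sinA (Suc j) - sinA k)) w) / (2 * \<eta>))"
          using elim(2) k(1,3) unfolding \<eta>_def by blast
        also have "\<dots> \<le> 8 / \<epsilon> * (\<eta> + 2 * \<eta>\<^sup>2 / (2 * \<eta>))"
          using n0(2)[of "Suc j" k] k(2) j \<epsilon> \<eta>(1)
          by (intro mult_left_mono add_left_mono divide_right_mono) auto
        also have "\<dots> = 16 * \<eta> / \<epsilon>" using \<eta>(1) by (simp add: power2_eq_square)
        also have "\<dots> \<le> \<delta>" using \<eta>(2) \<epsilon> by (simp add: field_simps)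
        finally show ?thesis .
      qed
      then have "m (Sup (range (osc \<epsilon> (Suc j)))) w \<le> \<delta>"
        using elim(1) by (intro LIMSEQ_le_const2[OF elim(1)[rule_format, of j]]) auto
      then show "\<exists>j. m (Sup (range (osc \<epsilon> (Suc j)))) w \<le> \<delta>" by blast
    qed
  qed
qed

text \<open>A three-epsilon argument at a generic point: for a suitable \<open>j\<close> the
  averages of the \<open>j\<close>-th average oscillate by at most \<open>\<epsilon>\<close>, and
  for large \<open>n\<close> they are within \<open>\<epsilon>\<close> of the \<open>n\<close>-th
  average itself.\<close>

lemma cosA_convergent: "\<forall>\<^sup>*t. convergent (\<lambda>n. rv (cosA n) t)"
proof -
  have "\<forall>\<^sup>*t. \<forall>r. \<exists>j. t \<notin> stone_set (Sup (range (osc (1 / real (Suc r)) (Suc j))))"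
    by (intro generic_all generic_escape osc_small) simp
  moreover have "\<forall>\<^sup>*t. \<forall>r j N. t \<in> stone_set (osc (1 / real (Suc r)) j N) \<longleftrightarrow>
    (\<exists>n\<in>{1..N}. \<exists>n'\<in>{1..N}. 1 / real (Suc r) < \<bar>rv (cosAA n j) t - rv (cosAA n' j) t\<bar>)"
    by (intro generic_all generic_osc)
  ultimately show ?thesis using cosAA_close
  proof eventually_elim
    case (elim t)
    have "Cauchy (\<lambda>n. rv (cosA n) t)"
    proof (rule metric_CauchyI)
      fix e :: real assume "0 < e"
      then obtain r where "inverse (real (Suc r)) < e / 3" using reals_Archimedean[of "e / 3"] by auto
      define \<epsilon> where "\<epsilon> = 1 / real (Suc r)"
      have \<epsilon>: "0 < \<epsilon>" "3 * \<epsilon> < e"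
        using \<open>inverse (real (Suc r)) < e / 3\<close> by (simp_all add: \<epsilon>_def inverse_eq_divide)
      obtain j where j: "t \<notin> stone_set (Sup (range (osc \<epsilon> (Suc j))))"
        using elim(1) unfolding \<epsilon>_def by blast
      have close: "\<bar>rv (cosAA n (Suc j)) t - rv (cosAA n' (Suc j)) t\<bar> \<le> \<epsilon>" if "0 < n" "0 < n'" for n n'
      proof -
        have "osc \<epsilon> (Suc j) (max n n') \<le> Sup (range (osc \<epsilon> (Suc j)))" by (rule Sup_upper) simp
        then have "t \<notin> stone_set (osc \<epsilon> (Suc j) (max n n'))" using j stone_set_mono by blast
        then have "\<forall>p\<in>{1..max n n'}. \<forall>q\<in>{1..max n n'}. \<not> \<epsilon> < \<bar>rv (cosAA p (Suc j)) t - rv (cosAA q (Suc j)) t\<bar>"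
          using elim(2) unfolding \<epsilon>_def by blast
        moreover have "n \<in> {1..max n n'}" "n' \<in> {1..max n n'}" using that by auto
        ultimately show ?thesis by (meson not_less)
      qed
      obtain n1 :: nat where n1: "2 * real (Suc j) * K / \<epsilon> \<le> real n1" using real_arch_simple by blast
      have near: "\<bar>rv (cosAA n (Suc j)) t - rv (cosA n) t\<bar> \<le> \<epsilon>" if "Suc n1 \<le> n" for n
      proof -
        have "\<bar>rv (cosAA n (Suc j)) t - rv (cosA n) t\<bar> \<le> 2 * real (Suc j) * K / real n"
          using elim(3)[rule_format, of n "Suc j"] that by (simp del: of_nat_Suc)
        also have "\<dots> \<le> \<epsilon>"
        proof -
          have "2 * real (Suc j) * K / \<epsilon> \<le> real n" using n1 that by linarith
          then show ?thesis using \<epsilon>(1) that by (simp add: field_simps)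
        qed
        finally show ?thesis .
      qed
      show "\<exists>N. \<forall>n\<ge>N. \<forall>n'\<ge>N. dist (rv (cosA n) t) (rv (cosA n') t) < e"
      proof (intro exI[of _ "Suc n1"] allI impI)
        fix n n' assume "Suc n1 \<le> n" "Suc n1 \<le> n'"
        then show "dist (rv (cosA n) t) (rv (cosA n') t) < e"
          using near[of n] near[of n'] close[of n n'] \<epsilon>(2) unfolding dist_real_def by linarith
      qed
    qed
    then show ?case by (rule Cauchy_convergent)
  qed
qed

end

lemma cosine_averages_converge:
  assumes "\<bar>x\<bar> \<le> K *\<^sub>R one_L0" "0 < K"
  shows "\<forall>\<^sup>*t. convergent (\<lambda>n. 1 / real n * (\<Sum>k<n. cos (real k * \<theta> + \<phi>) * rv ((T ^^ k) x) t))"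
  using cosA_convergent[OF assms, of \<theta> \<phi>] generic_averages[OF assms, of \<theta> \<phi>]
  by eventually_elim (simp add: cosT_def[OF assms])

end

section \<open>Besicovitch weights\<close>

context L0_meas begin

lemma integral_monotone_limit:
  assumes X: "\<And>n. 0 \<le> X n" "\<And>n. X n \<le> x" "incseq X" and x: "intg x"
    and lim: "\<forall>\<^sup>*t. (\<lambda>n. rv (X n) t) \<longlonglongrightarrow> rv x t"
  shows "AE w in M. (\<lambda>n. I (X n) w) \<longlonglongrightarrow> I x w"
proof -
  have i: "intg (X n)" for n using integrable_mono[OF X(1,2) x] .
  define g where "g w = lim (\<lambda>n. I (X n) w)" for w
  have [measurable]: "g \<in> borel_measurable M"
    unfolding g_def by (intro borel_measurable_lim_metric integral_measurable i)
  have "AE w in M. \<forall>n. I (X n) w \<le> I (X (Suc n)) w \<and> I (X n) w \<le> I x w"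
    unfolding AE_all_countable
    by (intro allI AE_conjI integral_mono X i x) (use X(3) in \<open>simp add: incseq_Suc_iff\<close>)
  then have lg: "AE w in M. (\<lambda>n. I (X n) w) \<longlonglongrightarrow> g w \<and> (\<forall>n. I (X n) w \<le> g w) \<and> g w \<le> I x w"
  proof eventually_elim
    case (elim w)
    then have "incseq (\<lambda>n. I (X n) w)" by (simp add: incseq_Suc_iff)
    then obtain L where L: "(\<lambda>n. I (X n) w) \<longlonglongrightarrow> L" "\<forall>n. I (X n) w \<le> L"
      using incseq_convergent[of "\<lambda>n. I (X n) w" "I x w"] elim by blast
    then have "g w = L" unfolding g_def by (intro limI)
    moreover have "L \<le> I x w" using L(1) elim by (intro LIMSEQ_le_const2) auto
    ultimately show ?case using L by simp
  qed
  have "upper (X n) g" for n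
  proof (rule upperI)
    fix s h assume "simple_int m s h" "0 \<le> s" "s \<le> X n"
    then have "AE w in M. h w \<le> I (X n) w" by (rule upperD[OF integral_upper[OF i]])
    then show "AE w in M. h w \<le> g w" using lg by eventually_elim (meson order_trans)
  qed simp
  \<comment> \<open>The pointwise limit of the integrals bounds each \<open>X n\<close>, hence also
    their limit \<open>x\<close>.\<close>
  then have "upper x g"
    by (rule upper_monotone_limit[OF _ X(1,3) lim])
  then have "AE w in M. I x w \<le> g w" by (rule integral_least[OF x])
  then show ?thesis using lg by eventually_elim (metis order.antisym)
qed

lemma truncation_error:
  assumes x: "x \<in> L1"
  shows "AE w in M. (\<lambda>j. I \<bar>x - cutoff (real j *\<^sub>R one_L0) x\<bar> w) \<longlonglongrightarrow> 0"
proof -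
  let ?c = "\<lambda>j. cutoff (real j *\<^sub>R one_L0) x"
  have nn: "0 \<le> real j *\<^sub>R one_L0" for j :: nat
    by (simp add: scaleR_nonneg_nonneg idem_nonneg)
  have xi: "intg \<bar>x\<bar>" using x by (simp add: L1_iff)
  have v: "\<forall>\<^sup>*t. \<forall>j. \<bar>rv (?c j) t\<bar> = min (\<bar>rv x t\<bar>) (real j)"
  proof (rule generic_all, goal_cases)
    case (1 j)
    show ?case
      using generic_cutoff[of "real j *\<^sub>R one_L0" x] generic_one
      by eventually_elim (auto simp: min_def max_def)
  qed
  have "incseq (\<lambda>j. \<bar>?c j\<bar>)"
  proof (rule incseq_SucI)
    show "\<bar>?c j\<bar> \<le> \<bar>?c (Suc j)\<bar>" for j
      unfolding L0_le_generic rv_abs using v by eventually_elim (simp del: of_nat_Suc)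
  qed
  moreover have "\<forall>\<^sup>*t. (\<lambda>j. rv \<bar>?c j\<bar> t) \<longlonglongrightarrow> rv \<bar>x\<bar> t"
    using v
  proof eventually_elim
    case (elim t)
    obtain j0 :: nat where "\<bar>rv x t\<bar> \<le> real j0" using real_arch_simple by blast
    then have "rv \<bar>?c j\<bar> t = rv \<bar>x\<bar> t" if "j0 \<le> j" for j
      using elim that by (auto simp: min_def)
    then show ?case by (intro tendsto_eventually) (auto simp: eventually_sequentially)
  qed
  ultimately have "AE w in M. (\<lambda>j. I \<bar>?c j\<bar> w) \<longlonglongrightarrow> I \<bar>x\<bar> w"
    by (intro integral_monotone_limit xi cutoff_le nn abs_ge_zero)
  moreover have "AE w in M. \<forall>j. I \<bar>x\<bar> w = I \<bar>?c j\<bar> w + I \<bar>x - ?c j\<bar> w"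
    unfolding AE_all_countable
  proof (intro allI, goal_cases)
    case (1 j)
    have "intg \<bar>?c j\<bar>" "intg \<bar>x - ?c j\<bar>"
      using integrable_mono[OF abs_ge_zero cutoff_le(2)[OF nn] xi] integrable_mono[OF abs_ge_zero cutoff_le(3)[OF nn] xi] by auto
    from integral_add[OF this] show ?case
      by (simp flip: cutoff_le(4)[OF nn])
  qed
  ultimately show ?thesis
  proof eventually_elim
    case (elim w)
    have "(\<lambda>j. I \<bar>x\<bar> w - I \<bar>?c j\<bar> w) \<longlonglongrightarrow> I \<bar>x\<bar> w - I \<bar>x\<bar> w"
      by (intro tendsto_diff tendsto_const elim)
    moreover have "I \<bar>x\<bar> w - I \<bar>?c j\<bar> w = I \<bar>x - ?c j\<bar> w" for j using elim(2)[rule_format, of j] by linarith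
    ultimately show ?case by simp
  qed
qed

end

text \<open>Polar coordinates turn the real part of a term into
  \<open>cmod (r j) * cos (real k * Arg (l j) + Arg (r j))\<close>. This is where the phase in the
  cosine weights comes from.\<close>

lemma trig_poly_cos:
  assumes "trig_poly Q"
  obtains s :: nat and c \<theta> \<phi> :: "nat \<Rightarrow> real" where
    "\<And>k::nat. Re (Q (int k)) = (\<Sum>j=1..s. c j * cos (real k * \<theta> j + \<phi> j))"
proof -
  obtain s :: nat and r l where l: "\<And>j. j \<in> {1..s} \<Longrightarrow> cmod (l j) = 1"
    and Q: "Q = (\<lambda>k. \<Sum>j=1..s. r j * l j powi k)"
    using assms unfolding trig_poly_def by blast
  have "Re (Q (int k)) = (\<Sum>j=1..s. cmod (r j) * cos (real k * Arg (l j) + Arg (r j)))" for k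
  proof -
    have "Re (r j * l j ^ k) = cmod (r j) * cos (real k * Arg (l j) + Arg (r j))" if "j \<in> {1..s}" for j
    proof -
      have "r j = rcis (cmod (r j)) (Arg (r j))" "l j = rcis 1 (Arg (l j))"
        using l[OF that] by (metis rcis_cmod_Arg)+
      then have "r j * l j ^ k = rcis (cmod (r j)) (Arg (r j)) * rcis 1 (Arg (l j)) ^ k" by metis
      also have "\<dots> = rcis (cmod (r j)) (Arg (r j) + real k * Arg (l j))"
        by (simp add: DeMoivre2 rcis_mult)
      finally show ?thesis by (simp add: Re_rcis add.commute)
    qed
    then show ?thesis unfolding Q by (simp add: power_int_of_nat)
  qed
  then show thesis by (rule that)
qed

lemma convergent_approx:
  fixes A :: "nat \<Rightarrow> real"
  assumes "\<And>e. 0 < e \<Longrightarrow> \<exists>B N. convergent B \<and> (\<forall>n\<ge>N. \<bar>A n - B n\<bar> < e)"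
  shows "convergent A"
proof (rule Cauchy_convergent, rule metric_CauchyI)
  fix e :: real assume "0 < e"
  then have e3: "0 < e / 3" by simp
  obtain B N where B: "convergent B" "\<And>n. n \<ge> N \<Longrightarrow> \<bar>A n - B n\<bar> < e / 3" using assms[OF e3] by blast
  obtain N' where N': "\<And>n n'. n \<ge> N' \<Longrightarrow> n' \<ge> N' \<Longrightarrow> dist (B n) (B n') < e / 3"
    using metric_CauchyD[OF convergent_Cauchy[OF B(1)] e3] by blast
  show "\<exists>N. \<forall>n\<ge>N. \<forall>n'\<ge>N. dist (A n) (A n') < e"
  proof (intro exI[of _ "max N N'"] allI impI)
    fix n n' assume "max N N' \<le> n" "max N N' \<le> n'"
    then have "\<bar>A n - B n\<bar> < e / 3" "\<bar>A n' - B n'\<bar> < e / 3" "dist (B n) (B n') < e / 3"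
      using B(2) N' by auto
    then show "dist (A n) (A n') < e" unfolding dist_real_def by linarith
  qed
qed

context L0_contraction begin

text \<open>The weights are real, so the real part of an approximating polynomial approximates them
  at least as well. On a bounded orbit the mean error of the weights, times \<open>K\<close>, bounds
  the error of the averages.\<close>

lemma Besicovitch_averages_converge_bounded:
  assumes \<alpha>: "BB_sequence (\<lambda>k. complex_of_real (\<alpha> k))" and x: "\<bar>x\<bar> \<le> K *\<^sub>R one_L0" and K: "0 < K"
  shows "\<forall>\<^sup>*t. convergent (\<lambda>n. 1 / real n * (\<Sum>k<n. \<alpha> (int k) * rv ((T ^^ k) x) t))"
proof -
  have "\<forall>r. \<exists>Q. trig_poly Q \<and> limsup (\<lambda>n. ereal (1 / real n *
      (\<Sum>k<n. cmod (complex_of_real (\<alpha> (int k)) - Q (int k))))) < ereal (1 / real (Suc r))"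
    using \<alpha> unfolding BB_sequence_def by simp
  then obtain Q where Q: "\<And>r. trig_poly (Q r)"
    "\<And>r. limsup (\<lambda>n. ereal (1 / real n * (\<Sum>k<n. cmod (complex_of_real (\<alpha> (int k)) - Q r (int k))))) < ereal (1 / real (Suc r))"
    by metis
  have err: "\<exists>N. \<forall>n\<ge>N. 1 / real n * (\<Sum>k<n. \<bar>\<alpha> (int k) - Re (Q r (int k))\<bar>) \<le> 1 / real (Suc r)" for r
  proof -
    obtain N where N: "\<And>n. n \<ge> N \<Longrightarrow> 1 / real n * (\<Sum>k<n. cmod (complex_of_real (\<alpha> (int k)) - Q r (int k))) < 1 / real (Suc r)"
      using Limsup_lessD[OF Q(2)[of r]] by (auto simp: eventually_sequentially)
    have "1 / real n * (\<Sum>k<n. \<bar>\<alpha> (int k) - Re (Q r (int k))\<bar>) \<le> 1 / real (Suc r)" if "n \<ge> N" for n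
    proof -
      have "\<bar>\<alpha> (int k) - Re (Q r (int k))\<bar> \<le> cmod (complex_of_real (\<alpha> (int k)) - Q r (int k))" for k
        using abs_Re_le_cmod[of "complex_of_real (\<alpha> (int k)) - Q r (int k)"] by simp
      then have "1 / real n * (\<Sum>k<n. \<bar>\<alpha> (int k) - Re (Q r (int k))\<bar>)
          \<le> 1 / real n * (\<Sum>k<n. cmod (complex_of_real (\<alpha> (int k)) - Q r (int k)))"
        by (intro mult_left_mono sum_mono) auto
      then show ?thesis using N[OF that] by linarith
    qed
    then show ?thesis by blast
  qed
  have "\<forall>\<^sup>*t. \<forall>r. convergent (\<lambda>n. 1 / real n * (\<Sum>k<n. Re (Q r (int k)) * rv ((T ^^ k) x) t))"
  proof (rule generic_all, goal_cases)
    case (1 r)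
    obtain s :: nat and c \<theta> \<phi> :: "nat \<Rightarrow> real" where
      Qr: "\<And>k::nat. Re (Q r (int k)) = (\<Sum>j=1..s. c j * cos (real k * \<theta> j + \<phi> j))"
      using trig_poly_cos[OF Q(1)] by metis
    have "\<forall>\<^sup>*t. \<forall>j. convergent (\<lambda>n. 1 / real n * (\<Sum>k<n. cos (real k * \<theta> j + \<phi> j) * rv ((T ^^ k) x) t))"
      by (intro generic_all cosine_averages_converge[OF x K])
    then show ?case
    proof eventually_elim
      case (elim t)
      have "1 / real n * (\<Sum>k<n. Re (Q r (int k)) * rv ((T ^^ k) x) t) =
          (\<Sum>j=1..s. c j * (1 / real n * (\<Sum>k<n. cos (real k * \<theta> j + \<phi> j) * rv ((T ^^ k) x) t)))" for n
      proof -
        have "(\<Sum>k<n. Re (Q r (int k)) * rv ((T ^^ k) x) t) =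
            (\<Sum>j=1..s. \<Sum>k<n. c j * cos (real k * \<theta> j + \<phi> j) * rv ((T ^^ k) x) t)"
          unfolding Qr sum_distrib_right by (rule sum.swap)
        then show ?thesis by (simp add: sum_distrib_left mult.assoc mult.left_commute)
      qed
      moreover have "convergent (\<lambda>n. c j * (1 / real n * (\<Sum>k<n. cos (real k * \<theta> j + \<phi> j) * rv ((T ^^ k) x) t)))" for j
        by (rule convergent_mult[OF convergent_const]) (use elim in blast)
      ultimately show ?case by (simp only: convergent_sum)
    qed
  qed
  moreover have "\<forall>\<^sup>*t. \<forall>k. \<bar>rv ((T ^^ k) x) t\<bar> \<le> K"
    by (intro generic_all) (use iter_bounded[OF x K] in \<open>simp add: generic_bounded\<close>)
  ultimately show ?thesis
  proof eventually_elim
    case (elim t)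
    let ?A = "\<lambda>n. 1 / real n * (\<Sum>k<n. \<alpha> (int k) * rv ((T ^^ k) x) t)"
    let ?B = "\<lambda>r n. 1 / real n * (\<Sum>k<n. Re (Q r (int k)) * rv ((T ^^ k) x) t)"
    show ?case
    proof (rule convergent_approx)
      fix e :: real assume "0 < e"
      then obtain r where "inverse (real (Suc r)) < e / K" using reals_Archimedean[of "e / K"] K by auto
      then have r: "K * (1 / real (Suc r)) < e" using K by (simp add: field_simps)
      obtain N where N: "\<And>n. n \<ge> N \<Longrightarrow> 1 / real n * (\<Sum>k<n. \<bar>\<alpha> (int k) - Re (Q r (int k))\<bar>) \<le> 1 / real (Suc r)"
        using err by blast
      have near: "\<bar>?A n - ?B r n\<bar> < e" if "n \<ge> N" for n
      proof -
        have "?A n - ?B r n = 1 / real n * (\<Sum>k<n. (\<alpha> (int k) - Re (Q r (int k))) * rv ((T ^^ k) x) t)"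
          by (simp add: left_diff_distrib sum_subtractf right_diff_distrib diff_divide_distrib)
        then have "\<bar>?A n - ?B r n\<bar> = 1 / real n * \<bar>\<Sum>k<n. (\<alpha> (int k) - Re (Q r (int k))) * rv ((T ^^ k) x) t\<bar>"
          by (simp add: abs_mult)
        also have "\<dots> \<le> 1 / real n * (\<Sum>k<n. \<bar>\<alpha> (int k) - Re (Q r (int k))\<bar> * K)"
          using elim(2) by (intro mult_left_mono order_trans[OF sum_abs sum_mono]) (auto simp: abs_mult intro: mult_left_mono)
        also have "\<dots> = K * (1 / real n * (\<Sum>k<n. \<bar>\<alpha> (int k) - Re (Q r (int k))\<bar>))"
          by (simp add: sum_distrib_right[symmetric])
        also have "\<dots> \<le> K * (1 / real (Suc r))" using N[OF that] K by (intro mult_left_mono) auto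
        finally show ?thesis using r by linarith
      qed
      have "convergent (?B r)" using elim(1) by blast
      with near show "\<exists>B N. convergent B \<and> (\<forall>n\<ge>N. \<bar>?A n - B n\<bar> < e)" by blast
    qed
  qed
qed

text \<open>Banach's principle: the truncations \<open>c j\<close> have convergent averages, and the
  maximal inequality makes the set where some average of the remainder \<open>d j\<close> is large
  arbitrarily small.\<close>

lemma Besicovitch_averages_converge:
  assumes BB: "BB_sequence (\<lambda>k. complex_of_real (\<alpha> k))" and x: "x \<in> L1"
  shows "\<forall>\<^sup>*t. convergent (\<lambda>n. 1 / real n * (\<Sum>k<n. \<alpha> (int k) * rv ((T ^^ k) x) t))"
proof -
  have "\<exists>A>0. \<forall>k. \<bar>\<alpha> k\<bar> \<le> A"
  proof -
    obtain B where "\<And>k. \<bar>\<alpha> k\<bar> \<le> B" using BB unfolding BB_sequence_def bdd_above_def by auto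
    then have "\<bar>\<alpha> k\<bar> \<le> max B 1" for k by (simp add: le_max_iff_disj)
    then show ?thesis by (intro exI[of _ "max B 1"]) auto
  qed
  then obtain A where A: "0 < A" "\<And>k. \<bar>\<alpha> k\<bar> \<le> A" by blast
  define c where "c j = cutoff (real (Suc j) *\<^sub>R one_L0) x" for j
  define d where "d j = x - c j" for j
  have nn: "0 \<le> real (Suc j) *\<^sub>R one_L0" for j :: nat
    by (intro scaleR_nonneg_nonneg idem_nonneg) simp
  have cb: "\<bar>c j\<bar> \<le> real (Suc j) *\<^sub>R one_L0" for j unfolding c_def by (rule cutoff_le(1)[OF nn])
  have cL: "c j \<in> L1" and dL: "d j \<in> L1" for j
    using L1_mono[OF x cutoff_le(2)[OF nn]] L1_mono[OF x cutoff_le(3)[OF nn]] by (auto simp: c_def d_def)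
  let ?S = "\<lambda>j n. \<Sum>k<n. (\<alpha> (int k) / A) *\<^sub>R (T ^^ k) (d j)"
  \<comment> \<open>Dividing the weights by \<open>A\<close> brings them into the range of the
    maximal inequality. Off \<open>V r j N\<close> the first \<open>N\<close> averages of the
    remainder \<open>d j\<close> with the original weights are at most
    \<open>A / real (Suc r)\<close>.\<close>
  define V where "V r j N = Sup ((\<lambda>n. lvl \<bar>?S j n\<bar> (real n * (1 / real (Suc r)))) ` {1..N})" for r j N :: nat
  have V: "\<forall>\<^sup>*t. \<forall>r j N. t \<in> stone_set (V r j N) \<longleftrightarrow>
      (\<exists>n\<in>{1..N}. real n * (1 / real (Suc r)) < \<bar>rv (?S j n) t\<bar>)"
    unfolding rv_abs[symmetric] V_def by (intro generic_all generic_Sup_lvl)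
  have inc: "incseq (V r j)" for r j
    unfolding V_def by (intro incseq_SucI Sup_subset_mono image_mono) auto
  have "AE w in M. \<forall>r j. (\<lambda>N. m (V r j N) w) \<longlonglongrightarrow> m (Sup (range (V r j))) w"
    unfolding AE_all_countable by (intro allI m_incseq inc)
  moreover have "AE w in M. \<forall>r j N. 1 / real (Suc r) * m (V r j N) w \<le> I \<bar>d j\<bar> w"
    unfolding AE_all_countable
  proof (intro allI, goal_cases)
    case (1 r j N)
    show ?case
    proof (rule weak_maximal_inequality[OF dL, where N = N and \<alpha> = "\<lambda>k. \<alpha> (int k) / A"])
      show "\<forall>\<^sup>*t. t \<in> stone_set (V r j N) \<longrightarrow>
          (\<exists>n\<in>{1..N}. real n * (1 / real (Suc r)) < \<bar>rv (?S j n) t\<bar>)"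
        using V by eventually_elim blast
    qed (use A in auto)
  qed
  moreover have "AE w in M. (\<lambda>j. I \<bar>d j\<bar> w) \<longlonglongrightarrow> 0"
    using truncation_error[OF x] unfolding d_def c_def
    by eventually_elim (drule LIMSEQ_Suc, simp)
  ultimately have esc: "AE w in M. \<forall>r. \<forall>\<delta>>0. \<exists>j. m (Sup (range (V r j))) w \<le> \<delta>"
  proof eventually_elim
    case (elim w)
    show ?case
    proof (intro allI impI)
      fix r :: nat and \<delta> :: real assume "0 < \<delta>"
      then have "0 < 1 / real (Suc r) * \<delta>" by simp
      from order_tendstoD(2)[OF elim(3) this] obtain j where j: "I \<bar>d j\<bar> w < 1 / real (Suc r) * \<delta>"
        by (auto dest: eventually_happens'[OF sequentially_bot])
      have "m (V r j N) w \<le> \<delta>" for N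
      proof -
        have "1 / real (Suc r) * m (V r j N) w \<le> 1 / real (Suc r) * \<delta>"
          using elim(2)[rule_format, of r j N] j by linarith
        then show ?thesis by (simp add: divide_le_cancel)
      qed
      then have "m (Sup (range (V r j))) w \<le> \<delta>"
        using elim(1) by (intro LIMSEQ_le_const2[OF elim(1)[rule_format, of r j]]) auto
      then show "\<exists>j. m (Sup (range (V r j))) w \<le> \<delta>" by blast
    qed
  qed
  have out: "\<forall>\<^sup>*t. \<forall>r. \<exists>j. t \<notin> stone_set (Sup (range (V r j)))"
    by (intro generic_all generic_escape) (use esc in eventually_elim, blast)
  have conv: "\<forall>\<^sup>*t. \<forall>j. convergent (\<lambda>n. 1 / real n * (\<Sum>k<n. \<alpha> (int k) * rv ((T ^^ k) (c j)) t))"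
    by (intro generic_all Besicovitch_averages_converge_bounded[OF BB cb]) simp
  have split: "\<forall>\<^sup>*t. \<forall>j k. rv ((T ^^ k) x) t = rv ((T ^^ k) (c j)) t + rv ((T ^^ k) (d j)) t"
  proof (intro generic_all, goal_cases)
    case (1 j k)
    have "(T ^^ k) x = (T ^^ k) (c j) + (T ^^ k) (d j)"
      using iter_add[OF cL[of j] dL[of j], of k] by (simp add: d_def)
    then show ?case
      using generic_plus by metis
  qed
  have Sv: "\<forall>\<^sup>*t. \<forall>j n. rv (?S j n) t = (\<Sum>k<n. \<alpha> (int k) / A * rv ((T ^^ k) (d j)) t)"
  proof (intro generic_all, goal_cases)
    case (1 j n)
    show ?case
      using generic_sum[OF finite_lessThan, of "\<lambda>k. (\<alpha> (int k) / A) *\<^sub>R (T ^^ k) (d j)" n]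
      by eventually_elim simp
  qed
  show ?thesis using out conv split Sv V
  proof eventually_elim
    case (elim t)
    let ?A = "\<lambda>n. 1 / real n * (\<Sum>k<n. \<alpha> (int k) * rv ((T ^^ k) x) t)"
    let ?B = "\<lambda>j n. 1 / real n * (\<Sum>k<n. \<alpha> (int k) * rv ((T ^^ k) (c j)) t)"
    let ?D = "\<lambda>j n. 1 / real n * (\<Sum>k<n. \<alpha> (int k) * rv ((T ^^ k) (d j)) t)"
    have eq: "?A n = ?B j n + ?D j n" for j n
    proof -
      have "rv ((T ^^ k) x) t = rv ((T ^^ k) (c j)) t + rv ((T ^^ k) (d j)) t" for k
        using elim(3) by blast
      then show ?thesis by (simp add: distrib_left sum.distrib add_divide_distrib)
    qed
    show ?case
    proof (rule convergent_approx)
      fix e :: real assume "0 < e"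
      then obtain r where "inverse (real (Suc r)) < e / A" using reals_Archimedean[of "e / A"] A by auto
      then have r: "A * (1 / real (Suc r)) < e" using A by (simp add: field_simps)
      obtain j where j: "t \<notin> stone_set (Sup (range (V r j)))" using elim(1) by blast
      have near: "\<bar>?D j n\<bar> < e" if "0 < n" for n
      proof -
        have "V r j n \<le> Sup (range (V r j))" by (rule Sup_upper) simp
        then have "t \<notin> stone_set (V r j n)" using j stone_set_mono by blast
        then have "\<not> real n * (1 / real (Suc r)) < \<bar>rv (?S j n) t\<bar>" using elim(5) that by auto
        then have "\<bar>\<Sum>k<n. \<alpha> (int k) / A * rv ((T ^^ k) (d j)) t\<bar> \<le> real n * (1 / real (Suc r))"
          using elim(4) by auto
        moreover have "(\<Sum>k<n. \<alpha> (int k) * rv ((T ^^ k) (d j)) t) = A * (\<Sum>k<n. \<alpha> (int k) / A * rv ((T ^^ k) (d j)) t)"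
          using A(1) by (simp add: sum_distrib_left)
        ultimately have "\<bar>\<Sum>k<n. \<alpha> (int k) * rv ((T ^^ k) (d j)) t\<bar> \<le> A * (real n * (1 / real (Suc r)))"
          unfolding abs_mult using A(1) by (simp only: abs_mult abs_of_pos mult_left_mono less_imp_le)
        then have "1 / real n * \<bar>\<Sum>k<n. \<alpha> (int k) * rv ((T ^^ k) (d j)) t\<bar> \<le> 1 / real n * (A * (real n * (1 / real (Suc r))))"
          by (intro mult_left_mono) auto
        then have "\<bar>?D j n\<bar> \<le> 1 / real n * (A * (real n * (1 / real (Suc r))))"
          by (simp add: abs_mult del: of_nat_Suc)
        also have "\<dots> = A * (1 / real (Suc r))" using that by simp
        finally show ?thesis using r by linarith
      qed
      have "convergent (?B j)" using elim(2) by blast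
      moreover have "\<forall>n\<ge>1. \<bar>?A n - ?B j n\<bar> < e" using near by (simp only: eq[of _ j] add_diff_cancel_left') simp
      ultimately show "\<exists>B N. convergent B \<and> (\<forall>n\<ge>N. \<bar>?A n - B n\<bar> < e)" by blast
    qed
  qed
qed

end

section \<open>The maximal function in \<open>L\<^sub>p\<close>\<close>

text \<open>A layer cake sum that rounds \<open>v\<close> up to the grid: the increments over all
  cells whose lower end is below \<open>v\<close> telescope to the grid value just above
  \<open>v\<close>.\<close>

lemma grid_power_bound:
  fixes b :: "nat \<Rightarrow> real"
  assumes b: "decseq b" "\<And>i. 0 \<le> b i" and v: "0 \<le> v" "v \<le> b 0" and p: "0 < p"
  shows "v powr p \<le> (\<Sum>i<n. (b i powr p - b (Suc i) powr p) * of_bool (b (Suc i) < v)) + b n powr p"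
proof (induction n)
  case 0
  then show ?case using v p by (simp add: powr_mono2)
next
  case (Suc n)
  show ?case
  proof (cases "b (Suc n) < v")
    case True
    then show ?thesis using Suc by simp
  next
    case False
    have "\<not> b (Suc i) < v" if "i < Suc n" for i
      using decseqD[OF b(1), of "Suc i" "Suc n"] that False by simp
    then have "(\<Sum>i<Suc n. (b i powr p - b (Suc i) powr p) * of_bool (b (Suc i) < v)) = 0"
      by (intro sum.neutral) auto
    then show ?thesis using False v p by (simp add: powr_mono2)
  qed
qed

text \<open>The counterpart that rounds \<open>v\<close> down: each level is paired with the
  increment over the cell below it, so the sum telescopes from the largest level below
  \<open>v\<close>.\<close>

lemma grid_power_bound':
  fixes b :: "nat \<Rightarrow> real"
  assumes b: "decseq b" "\<And>i. 0 \<le> b i" and v: "0 \<le> v" and q: "0 < q"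
  shows "(\<Sum>i<n. (b (Suc i) powr q - b (Suc (Suc i)) powr q) * of_bool (b (Suc i) < v))
    \<le> max 0 (v powr q - b (Suc n) powr q)"
proof (induction n)
  case (Suc n)
  show ?case
  proof (cases "b (Suc n) < v")
    case True
    then have "b (Suc n) powr q \<le> v powr q" using b(2) q by (intro powr_mono2) auto
    then show ?thesis using Suc True by simp
  next
    case False
    have "\<not> b (Suc i) < v" if "i < Suc n" for i
      using decseqD[OF b(1), of "Suc i" "Suc n"] that False by simp
    then have "(\<Sum>i<Suc n. (b (Suc i) powr q - b (Suc (Suc i)) powr q) * of_bool (b (Suc i) < v)) = 0"
      by (intro sum.neutral) auto
    then show ?thesis by simp
  qed
qed simp

text \<open>Divided by \<open>1 / real (Suc j)\<close>, numerator and denominator are difference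
  quotients at 1 of the powers with exponents \<open>p\<close> and \<open>1 - p\<close>.\<close>

lemma grid_constant_limit:
  assumes "1 < (p::real)"
  shows "(\<lambda>j. ((1 + 1 / real (Suc j)) powr p - 1) / (1 - (1 + 1 / real (Suc j)) powr (1 - p))) \<longlonglongrightarrow> p / (p - 1)"
proof -
  have d: "((\<lambda>r. r powr q) has_real_derivative q) (at 1)" for q :: real
    using has_real_derivative_powr[of 1 q] by simp
  have seq: "filterlim (\<lambda>j. 1 + 1 / real (Suc j)) (at 1) sequentially"
  proof -
    have "(\<lambda>j. 1 + 1 / real (Suc j)) \<longlonglongrightarrow> 1 + 0"
      by (intro tendsto_add tendsto_const LIMSEQ_Suc[OF lim_1_over_n])
    then show ?thesis unfolding filterlim_at by (auto intro!: always_eventually)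
  qed
  have *: "(\<lambda>j. ((1 + 1 / real (Suc j)) powr q - 1) / (1 / real (Suc j))) \<longlonglongrightarrow> q" for q
    using filterlim_compose[OF d[of q, unfolded has_field_derivative_iff] seq] by simp
  have "(\<lambda>j. (((1 + 1 / real (Suc j)) powr p - 1) / (1 / real (Suc j))) /
      (- (((1 + 1 / real (Suc j)) powr (1 - p) - 1) / (1 / real (Suc j))))) \<longlonglongrightarrow> p / (- (1 - p))"
    by (intro tendsto_divide tendsto_minus *) (use assms in simp)
  moreover have "(u / (1 / real (Suc j))) / (- (v / (1 / real (Suc j)))) = u / (- v)" for u v :: real and j
    by (simp del: of_nat_Suc)
  ultimately show ?thesis by (simp only: minus_diff_eq)
qed

context L0_meas begin

lemma abs_powr_nonneg: "0 < p \<Longrightarrow> 0 \<le> abs_powr x p"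
  unfolding L0_le_generic by simp

lemma abs_powr_mono: "0 < p \<Longrightarrow> \<bar>x\<bar> \<le> \<bar>y\<bar> \<Longrightarrow> abs_powr x p \<le> abs_powr y p"
  unfolding L0_le_generic by (auto elim!: eventually_mono intro: powr_mono2)

text \<open>A layer cake sum over the levels \<open>K r\<^sup>-\<^sup>i\<close>, followed by Young's inequality instead of Hoelder's so that
  everything stays linear in the integral; the constant \<open>p / (p - 1)\<close> appears as \<open>r\<close> tends to \<open>1\<close>.\<close>

lemma Doob_inequality_bounded:
  assumes p: "1 < p" and x: "x \<in> L1" "intg (abs_powr x p)"
    and h: "0 \<le> h" "h \<le> K *\<^sub>R one_L0" and K: "0 < K"
    and weak: "\<And>a. 0 < a \<Longrightarrow> AE w in M. a * m (lvl h a) w \<le> I (restr (lvl h a) \<bar>x\<bar>) w"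
  shows "AE w in M. I (abs_powr h p) w \<le> (p / (p - 1)) powr p * I (abs_powr x p) w"
proof -
  define C where "C r = (r powr p - 1) / (1 - r powr (1 - p))" for r :: real
  define R where "R j = 1 + 1 / real (Suc j)" for j
  have R: "1 < R j" for j by (simp add: R_def)
  have ih: "intg (abs_powr h p)"
  proof (rule integrable_mono)
    show "abs_powr h p \<le> (K powr p) *\<^sub>R one_L0" unfolding L0_le_generic
      using h generic_one unfolding L0_le_generic by eventually_elim (use p in \<open>simp add: powr_mono2\<close>)
  qed (use p in \<open>auto intro: abs_powr_nonneg integrable_const\<close>)
  have hv: "\<forall>\<^sup>*t. 0 \<le> rv h t \<and> rv h t \<le> K"
    using h generic_one unfolding L0_le_generic by eventually_elim simp
  have main: "AE w in M. I (abs_powr h p) w \<le> C r powr p * I (abs_powr x p) w + p * (K * (1 / r) ^ n) powr p"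
    if r: "1 < r" for r n
  proof -
    define b where "b i = K * (1 / r) ^ i" for i
    have b0: "0 < b i" for i using K r by (simp add: b_def)
    have bS: "b i = r * b (Suc i)" for i using r by (simp add: b_def)
    have "decseq b"
      by (rule decseq_SucI) (use bS b0 r in \<open>metis less_imp_le mult_le_cancel_right1 not_less\<close>)
    note b = this less_imp_le[OF b0]
    define c where "c i = b i powr p - b (Suc i) powr p" for i
    have c0: "0 \<le> c i" for i
      using powr_mono2[of p "b (Suc i)" "b i"] p b0 less_imp_le[OF b0] decseqD[OF b(1), of i "Suc i"] by (simp add: c_def)
    let ?l = "\<lambda>i. lvl h (b (Suc i))"
    have Cpos: "0 < 1 - r powr (1 - p)" using powr_less_one[of r "1 - p"] r p by simp
    \<comment> \<open>On a geometric grid this ratio is the same in every cell. It trades increments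
      of the power \<open>p\<close>, divided by the level, for increments of the power
      \<open>p - 1\<close>, at the cost of moving down one cell.\<close>
    have c_eq: "c i / b (Suc i) = C r * (b (Suc i) powr (p - 1) - b (Suc (Suc i)) powr (p - 1))" for i
    proof -
      have "b (Suc (Suc i)) = b (Suc i) / r" using bS[of "Suc i"] r by simp
      moreover have "r powr (1 - p) = 1 / r powr (p - 1)" using powr_minus_divide[of r "p - 1"] by simp
      ultimately have "b (Suc (Suc i)) powr (p - 1) = b (Suc i) powr (p - 1) * r powr (1 - p)"
        using b0[of "Suc i"] r by (simp add: powr_divide)
      then have "C r * (b (Suc i) powr (p - 1) - b (Suc (Suc i)) powr (p - 1)) = (r powr p - 1) * b (Suc i) powr (p - 1)"
        using Cpos by (simp add: C_def field_simps)
      moreover have "c i = (r powr p - 1) * b (Suc i) powr p"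
        unfolding c_def bS[of i] using b0[of "Suc i"] r by (simp add: powr_mult left_diff_distrib)
      moreover have "b (Suc i) powr (p - 1) = b (Suc i) powr p / b (Suc i)"
        using b0[of "Suc i"] by (simp add: powr_diff)
      ultimately show ?thesis by simp
    qed
    have Cr: "0 \<le> C r" using Cpos r p ge_one_powr_ge_zero[of r p] by (simp add: C_def)
    have lv: "\<forall>\<^sup>*t. \<forall>i. t \<in> stone_set (?l i) \<longleftrightarrow> b (Suc i) < rv h t"
      by (intro generic_all generic_lvl)
    define S where "S = (\<Sum>i<n. c i *\<^sub>R idem_L0 (?l i))"
    define X where "X = (\<Sum>i<n. (c i / b (Suc i)) *\<^sub>R restr (?l i) \<bar>x\<bar>)"
    have le1: "abs_powr h p \<le> S + (b n powr p) *\<^sub>R one_L0"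
      unfolding L0_le_generic
      using hv lv generic_sum[OF finite_lessThan, of "\<lambda>i. c i *\<^sub>R idem_L0 (?l i)" n]
        generic_plus[of S "(b n powr p) *\<^sub>R one_L0"] generic_one
    proof eventually_elim
      case (elim t)
      have "rv h t powr p \<le> (\<Sum>i<n. c i * of_bool (b (Suc i) < rv h t)) + b n powr p"
        unfolding c_def using p elim(1) by (intro grid_power_bound b) (auto simp: b_def)
      also have "(\<Sum>i<n. c i * of_bool (b (Suc i) < rv h t)) = rv S t"
        unfolding S_def elim(3) using elim(2) by (simp add: indicator_def)
      finally show ?case using elim p by simp
    qed
    have le2: "X \<le> (C r powr p / p) *\<^sub>R abs_powr x p + (1 - 1 / p) *\<^sub>R abs_powr h p"
      unfolding L0_le_generic
      using hv lv generic_sum[OF finite_lessThan, of "\<lambda>i. (c i / b (Suc i)) *\<^sub>R restr (?l i) \<bar>x\<bar>" n]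
        generic_plus[of "(C r powr p / p) *\<^sub>R abs_powr x p" "(1 - 1 / p) *\<^sub>R abs_powr h p"]
    proof eventually_elim
      case (elim t)
      let ?v = "rv h t"
      have "rv X t = (\<Sum>i<n. c i / b (Suc i) * (of_bool (b (Suc i) < ?v) * \<bar>rv x t\<bar>))"
        unfolding X_def elim(3) using elim(2) by (intro sum.cong) auto
      also have "\<dots> = C r * \<bar>rv x t\<bar> * (\<Sum>i<n. (b (Suc i) powr (p - 1) - b (Suc (Suc i)) powr (p - 1)) * of_bool (b (Suc i) < ?v))"
        unfolding c_eq sum_distrib_left by (intro sum.cong) auto
      also have "\<dots> \<le> C r * \<bar>rv x t\<bar> * max 0 (?v powr (p - 1) - b (Suc n) powr (p - 1))"
        using Cr p elim(1) by (intro mult_left_mono grid_power_bound' b) auto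
      also have "\<dots> \<le> (C r * \<bar>rv x t\<bar>) * ?v powr (p - 1)"
        using Cr by (intro mult_left_mono) auto
      \<comment> \<open>Young's inequality with the exponents \<open>p\<close> and
        \<open>p / (p - 1)\<close>; the second one restores the full power \<open>p\<close> of
        \<open>h\<close>.\<close>
      also have "\<dots> \<le> (C r * \<bar>rv x t\<bar>) powr p / p + (?v powr (p - 1)) powr (p / (p - 1)) / (p / (p - 1))"
        using p Cr by (intro Youngs_inequality) (auto simp: field_simps)
      also have "(?v powr (p - 1)) powr (p / (p - 1)) = ?v powr p" using p by (simp add: powr_powr)
      also have "?v powr p / (p / (p - 1)) = (1 - 1 / p) * ?v powr p" using p by (simp add: field_simps)
      also have "(C r * \<bar>rv x t\<bar>) powr p = C r powr p * \<bar>rv x t\<bar> powr p" using Cr by (simp add: powr_mult)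
      finally show ?case using elim p by simp
    qed
    have iS: "intg S" unfolding S_def by (intro integrable_combination integrable_idem c0)
    have ir: "intg (restr e \<bar>x\<bar>)" for e using L1_restr[OF x(1), of e] by (simp add: L1_iff abs_restr)
    have cb: "0 \<le> c i / b (Suc i)" for i using c0[of i] b0[of "Suc i"] by simp
    have iX: "intg X" unfolding X_def by (intro integrable_combination ir cb)
    have cC: "0 \<le> C r powr p / p" "0 \<le> 1 - 1 / p" "0 \<le> b n powr p" using p by auto
    note iC = integrable_scale[OF x(2) cC(1)] integrable_scale[OF ih cC(2)]
    have s1: "AE w in M. I S w = (\<Sum>i<n. c i * I (idem_L0 (?l i)) w)"
      unfolding S_def by (intro integral_combination integrable_idem c0)
    have s2: "AE w in M. I X w = (\<Sum>i<n. c i / b (Suc i) * I (restr (?l i) \<bar>x\<bar>) w)"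
      unfolding X_def by (intro integral_combination ir cb)
    have s3: "AE w in M. \<forall>i. I (idem_L0 (?l i)) w = m (?l i) w \<and> b (Suc i) * m (?l i) w \<le> I (restr (?l i) \<bar>x\<bar>) w"
      unfolding AE_all_countable by (intro allI AE_conjI integral_idem weak b0)
    have SX: "AE w in M. I S w \<le> I X w" using s1 s2 s3
    proof eventually_elim
      case (elim w)
      show ?case unfolding elim(1,2)
      proof (rule sum_mono)
        fix i
        have "c i * m (?l i) w = c i / b (Suc i) * (b (Suc i) * m (?l i) w)" using b0[of "Suc i"] by simp
        also have "\<dots> \<le> c i / b (Suc i) * I (restr (?l i) \<bar>x\<bar>) w"
          using elim(3) cb by (intro mult_left_mono) auto
        finally show "c i * I (idem_L0 (?l i)) w \<le> c i / b (Suc i) * I (restr (?l i) \<bar>x\<bar>) w"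
          using elim(3) by simp
      qed
    qed
    have "0 \<le> abs_powr h p" using p by (intro abs_powr_nonneg) simp
    from integral_le_add_const[OF this le1 iS cC(3)]
    show ?thesis
      using SX
        integral_mono[OF integrable_nonneg[OF iX] le2 integrable_add[OF iC(1,2)]]
        integral_add[OF iC(1,2)] integral_scale[OF x(2) cC(1)] integral_scale[OF ih cC(2)]
    proof eventually_elim
      case (elim w)
      let ?H = "I (abs_powr h p) w" and ?Y = "I (abs_powr x p) w"
      \<comment> \<open>The term \<open>(1 - 1 / p) * ?H\<close> is moved to the left. This is where
        the boundedness of \<open>h\<close> matters: it makes \<open>?H\<close> a genuine, finite
        integral.\<close>
      have "?H \<le> C r powr p / p * ?Y + (1 - 1 / p) * ?H + b n powr p" using elim by linarith
      then have "p * ?H \<le> p * (C r powr p / p * ?Y + (1 - 1 / p) * ?H + b n powr p)"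
        using p by (intro mult_left_mono) auto
      also have "\<dots> = C r powr p * ?Y + (p - 1) * ?H + p * b n powr p"
        using p by (simp add: algebra_simps)
      finally show ?case unfolding b_def by (simp add: algebra_simps)
    qed
  qed
  have "AE w in M. \<forall>j n. I (abs_powr h p) w \<le> C (R j) powr p * I (abs_powr x p) w + p * (K * (1 / R j) ^ n) powr p"
    unfolding AE_all_countable using main R by blast
  then show ?thesis
  proof eventually_elim
    case (elim w)
    have "I (abs_powr h p) w \<le> C (R j) powr p * I (abs_powr x p) w" for j
    proof (rule LIMSEQ_le_const)
      have "(\<lambda>n. (1 / R j) ^ n) \<longlonglongrightarrow> 0" using R[of j] by (intro LIMSEQ_power_zero) simp
      then have "(\<lambda>n. K * (1 / R j) ^ n) \<longlonglongrightarrow> K * 0" by (intro tendsto_mult tendsto_const)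
      then have "(\<lambda>n. (K * (1 / R j) ^ n) powr p) \<longlonglongrightarrow> 0"
        using p K R[of j] by (intro tendsto_zero_powrI[OF _ tendsto_const]) (auto intro!: always_eventually)
      then have "(\<lambda>n. C (R j) powr p * I (abs_powr x p) w + p * (K * (1 / R j) ^ n) powr p)
          \<longlonglongrightarrow> C (R j) powr p * I (abs_powr x p) w + p * 0"
        by (intro tendsto_add tendsto_mult tendsto_const)
      then show "(\<lambda>n. C (R j) powr p * I (abs_powr x p) w + p * (K * (1 / R j) ^ n) powr p)
          \<longlonglongrightarrow> C (R j) powr p * I (abs_powr x p) w" by simp
    qed (use elim in blast)
    moreover have "(\<lambda>j. C (R j)) \<longlonglongrightarrow> p / (p - 1)"
      using grid_constant_limit[OF p] unfolding C_def R_def .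
    then have "(\<lambda>j. C (R j) powr p * I (abs_powr x p) w) \<longlonglongrightarrow> (p / (p - 1)) powr p * I (abs_powr x p) w"
      using p by (intro tendsto_mult tendsto_powr tendsto_const) auto
    ultimately show ?case by (intro LIMSEQ_le_const) auto
  qed
qed

text \<open>Truncation supplies the boundedness: \<open>h j\<close> has the same spectral elements
  as \<open>g\<close> below its bound and trivial ones above, so it inherits the weak estimate, and
  monotone convergence removes the truncation.\<close>

lemma Doob_inequality:
  assumes p: "1 < p" and x: "x \<in> L1" "intg (abs_powr x p)" and g: "0 \<le> g"
    and weak: "\<And>a. 0 < a \<Longrightarrow> AE w in M. a * m (lvl g a) w \<le> I (restr (lvl g a) \<bar>x\<bar>) w"
  shows "upper (abs_powr g p) (\<lambda>w. (p / (p - 1)) powr p * I (abs_powr x p) w)"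
proof -
  define h where "h j = inf g (real (Suc j) *\<^sub>R one_L0)" for j
  have nn: "0 \<le> real (Suc j) *\<^sub>R one_L0" for j :: nat
    by (intro scaleR_nonneg_nonneg idem_nonneg) simp
  have h0: "0 \<le> h j" for j using g nn by (simp add: h_def)
  have hv: "\<forall>\<^sup>*t. \<forall>j. rv (h j) t = min (rv g t) (real (Suc j))"
  proof (rule generic_all, goal_cases)
    case (1 j)
    show ?case
      using generic_inf[of g "real (Suc j) *\<^sub>R one_L0"] generic_one unfolding h_def
      by eventually_elim simp
  qed
  have weak': "AE w in M. a * m (lvl (h j) a) w \<le> I (restr (lvl (h j) a) \<bar>x\<bar>) w" if "0 < a" for a j
  proof (cases "a < real (Suc j)")
    case True
    have "lvl (h j) a \<le> lvl g a" "lvl g a \<le> lvl (h j) a" unfolding le_generic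
      using hv generic_lvl[of "h j" a] generic_lvl[of g a]
      by (eventually_elim, use True in auto)+
    then show ?thesis using weak[OF that] by (simp add: order.antisym)
  next
    case False
    have "lvl (h j) a \<le> bot" unfolding le_generic
      using hv generic_lvl[of "h j" a] by eventually_elim (use False in auto)
    then have eq: "lvl (h j) a = bot" by (simp add: bot_unique)
    have eq0: "restr bot \<bar>x\<bar> = 0" unfolding L0_eq_generic by simp
    show ?thesis unfolding eq eq0 using m_bot integral_zero by eventually_elim simp
  qed
  have up: "upper (abs_powr (h j) p) (\<lambda>w. (p / (p - 1)) powr p * I (abs_powr x p) w)" for j
  proof (rule upperI)
    show "(\<lambda>w. (p / (p - 1)) powr p * I (abs_powr x p) w) \<in> borel_measurable M"
      using integral_measurable[OF x(2)] by measurable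
    have le: "h j \<le> real (Suc j) *\<^sub>R one_L0" by (simp add: h_def)
    have ih: "intg (abs_powr (h j) p)"
    proof (rule integrable_mono)
      show "abs_powr (h j) p \<le> (real (Suc j) powr p) *\<^sub>R one_L0" unfolding L0_le_generic
        using h0[of j] le generic_one unfolding L0_le_generic by eventually_elim (use p in \<open>simp add: powr_mono2\<close>)
    qed (use p in \<open>auto intro: abs_powr_nonneg integrable_const\<close>)
    fix s k assume "simple_int m s k" "0 \<le> s" "s \<le> abs_powr (h j) p"
    then have "AE w in M. k w \<le> I (abs_powr (h j) p) w" by (rule upperD[OF integral_upper[OF ih]])
    moreover have "AE w in M. I (abs_powr (h j) p) w \<le> (p / (p - 1)) powr p * I (abs_powr x p) w"
      by (rule Doob_inequality_bounded[OF p x h0 le _ weak']) auto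
    ultimately show "AE w in M. k w \<le> (p / (p - 1)) powr p * I (abs_powr x p) w"
      by eventually_elim simp
  qed
  show ?thesis
  proof (rule upper_monotone_limit[OF up])
    show "0 \<le> abs_powr (h j) p" for j using p by (intro abs_powr_nonneg) simp
    show "incseq (\<lambda>j. abs_powr (h j) p)"
    proof (rule incseq_SucI)
      fix j show "abs_powr (h j) p \<le> abs_powr (h (Suc j)) p"
        unfolding L0_le_generic using hv g[unfolded L0_le_generic]
        by eventually_elim (use p in \<open>auto intro!: powr_mono2\<close>)
    qed
    show "\<forall>\<^sup>*t. (\<lambda>j. rv (abs_powr (h j) p) t) \<longlonglongrightarrow> rv (abs_powr g p) t"
      using hv
    proof eventually_elim
      case (elim t)
      obtain j0 :: nat where "rv g t \<le> real j0" using real_arch_simple by blast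
      then have "rv (abs_powr (h j) p) t = rv (abs_powr g p) t" if "j0 \<le> j" for j
        using elim that p by (auto simp: min_def)
      then show ?case by (intro tendsto_eventually) (auto simp: eventually_sequentially)
    qed
  qed
qed

lemma Lp_subset_L1:
  assumes "1 < p" "x \<in> Lp M m p"
  shows "x \<in> L1"
proof -
  have "\<bar>x\<bar> \<le> one_L0 + abs_powr x p" unfolding L0_le_generic
    using generic_one generic_plus[of one_L0 "abs_powr x p"]
  proof eventually_elim
    case (elim t)
    have "u \<le> 1 + u powr p" if "0 \<le> u" for u :: real
    proof (cases "u \<le> 1")
      case False
      then have "u powr 1 \<le> u powr p" using assms(1) by (intro powr_mono) auto
      then show ?thesis using False by simp
    qed (simp add: add_increasing2)
    from this[of "\<bar>rv x t\<bar>"] show ?case using elim assms(1) by simp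
  qed
  then show ?thesis unfolding L1_iff
    using assms(2) by (intro integrable_mono[OF abs_ge_zero _ integrable_add[OF integrable_idem]]) (auto simp: Lp_def)
qed

end

section \<open>Domination of the weighted averages\<close>

context L0_contraction begin

lemma generic_weighted_avg:
  "\<forall>\<^sup>*t. \<forall>n. rv (weighted_avg \<alpha> T n x) t = 1 / real n * (\<Sum>k<n. \<alpha> (int k) * rv ((T ^^ k) x) t)"
proof (rule generic_all, goal_cases)
  case (1 n)
  show ?case
    using generic_sum[OF finite_lessThan, of "\<lambda>k. \<alpha> (int k) *\<^sub>R (T ^^ k) x" n]
    by eventually_elim (simp add: weighted_avg_def)
qed

lemma weighted_avg_converges:
  assumes "BB_sequence (\<lambda>k. complex_of_real (\<alpha> k))" "x \<in> L1"
  shows "\<forall>\<^sup>*t. convergent (\<lambda>n. rv (weighted_avg \<alpha> T n x) t)"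
  using Besicovitch_averages_converge[OF assms] generic_weighted_avg[of \<alpha> x]
  by eventually_elim simp

lemma dominated_weighted_avg:
  assumes BB: "BB_sequence (\<lambda>k. complex_of_real (\<alpha> k))" and A: "0 < A" "\<And>k. \<bar>\<alpha> k\<bar> \<le> A"
    and p: "1 < p" and x: "x \<in> Lp M m p"
  obtains y where "\<And>n. 0 < n \<Longrightarrow> \<bar>weighted_avg \<alpha> T n x\<bar> \<le> y"
    "upper (abs_powr y p) (\<lambda>w. (A * (p / (p - 1))) powr p * I (abs_powr x p) w)"
proof -
  have xL: "x \<in> L1" using Lp_subset_L1[OF p x] .
  have xp: "intg (abs_powr x p)" using x by (simp add: Lp_def)
  define W where "W n = weighted_avg \<alpha> T n x" for n
  \<comment> \<open>The finite maxima start from \<open>\<bar>x\<bar>\<close>, so that their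
    spectral elements contain those of \<open>\<bar>x\<bar>\<close>, as the strong form of the
    maximal inequality demands.\<close>
  define g where "g = rec_nat \<bar>x\<bar> (\<lambda>N g. sup g ((1 / A) *\<^sub>R \<bar>W (Suc N)\<bar>))"
  have g0: "g 0 = \<bar>x\<bar>" and gS: "g (Suc N) = sup (g N) ((1 / A) *\<^sub>R \<bar>W (Suc N)\<bar>)" for N
    by (simp_all add: g_def)
  have inc: "incseq g" by (rule incseq_SucI) (simp add: gS)
  have gnn: "0 \<le> g N" for N using incseqD[OF inc, of 0 N] g0 by (metis abs_ge_zero order_trans zero_le)
  have gv: "\<forall>\<^sup>*t. \<forall>N. rv (g (Suc N)) t = max (rv (g N) t) (1 / A * \<bar>rv (W (Suc N)) t\<bar>)"
  proof (rule generic_all, goal_cases)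
    case (1 N)
    show ?case
      using generic_sup[of "g N" "(1 / A) *\<^sub>R \<bar>W (Suc N)\<bar>"] by eventually_elim (simp add: gS)
  qed
  have gl: "\<forall>\<^sup>*t. \<forall>N c. c < rv (g N) t \<longleftrightarrow> c < \<bar>rv x t\<bar> \<or> (\<exists>n\<in>{1..N}. c < 1 / A * \<bar>rv (W n) t\<bar>)"
    using gv
  proof eventually_elim
    case (elim t)
    have "c < rv (g N) t \<longleftrightarrow> c < \<bar>rv x t\<bar> \<or> (\<exists>n\<in>{1..N}. c < 1 / A * \<bar>rv (W n) t\<bar>)" for N c
    proof (induction N)
      case (Suc N)
      have "{1..Suc N} = insert (Suc N) {1..N}" by auto
      then show ?case using Suc elim by (auto simp: less_max_iff_disj)
    qed (simp add: g0)
    then show ?case by blast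
  qed
  have sv: "\<forall>\<^sup>*t. \<forall>n. \<bar>rv (\<Sum>k<n. (\<alpha> (int k) / A) *\<^sub>R (T ^^ k) x) t\<bar> = real n * (1 / A * \<bar>rv (W n) t\<bar>)"
  proof (rule generic_all, goal_cases)
    case (1 n)
    show ?case
    proof (rule always_eventually, intro allI)
      fix t
      have "W n = (A / real n) *\<^sub>R (\<Sum>k<n. (\<alpha> (int k) / A) *\<^sub>R (T ^^ k) x)"
        using A(1) by (simp add: W_def weighted_avg_def scaleR_sum_right)
      then show "\<bar>rv (\<Sum>k<n. (\<alpha> (int k) / A) *\<^sub>R (T ^^ k) x) t\<bar> = real n * (1 / A * \<bar>rv (W n) t\<bar>)"
        using A(1) by (cases "n = 0") (simp_all add: abs_mult)
    qed
  qed
  have weak: "AE w in M. c * m (lvl (g N) c) w \<le> I (restr (lvl (g N) c) \<bar>x\<bar>) w" if "0 < c" for c N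
  proof (rule maximal_inequality[OF xL that, where N = N and \<alpha> = "\<lambda>k. \<alpha> (int k) / A"])
    show "\<bar>\<alpha> (int k) / A\<bar> \<le> 1" for k using A by simp
    show "\<forall>\<^sup>*t. t \<in> stone_set (lvl (g N) c) \<longrightarrow> c < \<bar>rv x t\<bar> \<or>
        (\<exists>n\<in>{1..N}. real n * c < \<bar>rv (\<Sum>k<n. (\<alpha> (int k) / A) *\<^sub>R (T ^^ k) x) t\<bar>)"
      using generic_lvl[of "g N" c] gl sv
    proof eventually_elim
      case (elim t)
      show ?case
      proof
        assume "t \<in> stone_set (lvl (g N) c)"
        then have "c < \<bar>rv x t\<bar> \<or> (\<exists>n\<in>{1..N}. c < 1 / A * \<bar>rv (W n) t\<bar>)" using elim(1,2) by blast
        then show "c < \<bar>rv x t\<bar> \<or> (\<exists>n\<in>{1..N}. real n * c < \<bar>rv (\<Sum>k<n. (\<alpha> (int k) / A) *\<^sub>R (T ^^ k) x) t\<bar>)"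
          unfolding elim(3)[rule_format] by (meson atLeastAtMost_iff le_eq_less_or_eq
              less_le_trans mult_strict_left_mono of_nat_0_less_iff zero_less_one)
      qed
    qed
    show "\<forall>\<^sup>*t. c < \<bar>rv x t\<bar> \<longrightarrow> t \<in> stone_set (lvl (g N) c)"
      using generic_lvl[of "g N" c] gl by eventually_elim blast
  qed
  have up: "upper (abs_powr (g N) p) (\<lambda>w. (p / (p - 1)) powr p * I (abs_powr x p) w)" for N
    by (rule Doob_inequality[OF p xL xp gnn weak])
  \<comment> \<open>Convergence at generic points bounds the averages there, which is what the
    existence of the supremum in \<open>L0\<close> requires.\<close>
  have bdd: "\<forall>\<^sup>*t. bdd_above (range (\<lambda>N. rv (g N) t))"
    using weighted_avg_converges[OF BB xL] gl
  proof eventually_elim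
    case (elim t)
    then have "Bseq (\<lambda>n. rv (W n) t)" unfolding W_def by (intro convergent_imp_Bseq)
    then obtain B where B: "\<And>n. \<bar>rv (W n) t\<bar> \<le> B" by (auto simp: Bseq_def)
    have "rv (g N) t \<le> max \<bar>rv x t\<bar> (1 / A * B)" for N
    proof (rule ccontr)
      assume "\<not> ?thesis"
      then have "max \<bar>rv x t\<bar> (1 / A * B) < rv (g N) t" by (simp only: not_le)
      then obtain n where "max \<bar>rv x t\<bar> (1 / A * B) < 1 / A * \<bar>rv (W n) t\<bar>"
        using elim(2) by force
      moreover have "1 / A * \<bar>rv (W n) t\<bar> \<le> 1 / A * B" using A(1) B by (intro mult_left_mono) auto
      ultimately show False by simp
    qed
    then show ?case by (auto simp: bdd_above_def)
  qed
  obtain G where G: "\<And>N. g N \<le> G" "\<forall>\<^sup>*t. rv G t = (SUP N. rv (g N) t)"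
    by (rule L0_countable_sup[OF bdd]) blast
  have incv: "\<forall>\<^sup>*t. incseq (\<lambda>N. rv (g N) t)"
    using gv by eventually_elim (simp add: incseq_Suc_iff)
  have upG: "upper (abs_powr G p) (\<lambda>w. (p / (p - 1)) powr p * I (abs_powr x p) w)"
  proof (rule upper_monotone_limit[OF up])
    show "0 \<le> abs_powr (g N) p" for N using p by (intro abs_powr_nonneg) simp
    show "incseq (\<lambda>N. abs_powr (g N) p)"
    proof (rule incseq_SucI, rule abs_powr_mono)
      fix N show "\<bar>g N\<bar> \<le> \<bar>g (Suc N)\<bar>" using incseqD[OF inc, of N "Suc N"] gnn by simp
    qed (use p in simp)
    show "\<forall>\<^sup>*t. (\<lambda>N. rv (abs_powr (g N) p) t) \<longlonglongrightarrow> rv (abs_powr G p) t"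
      using G(2) incv bdd
    proof eventually_elim
      case (elim t)
      have "(\<lambda>N. rv (g N) t) \<longlonglongrightarrow> rv G t"
        unfolding elim(1) by (rule LIMSEQ_incseq_SUP[OF elim(3,2)])
      then have "(\<lambda>N. \<bar>rv (g N) t\<bar> powr p) \<longlonglongrightarrow> \<bar>rv G t\<bar> powr p"
        using p by (intro tendsto_powr' tendsto_rabs tendsto_const) auto
      then show ?case using p by simp
    qed
  qed
  show thesis
  proof (rule that)
    fix n :: nat assume "0 < n"
    then obtain N where n: "n = Suc N" by (cases n) auto
    have "(1 / A) *\<^sub>R \<bar>W n\<bar> \<le> G" using gS[of N] G(1)[of n] unfolding n by (metis order_trans sup_ge2)
    from scaleR_left_mono[OF this, of A] show "\<bar>weighted_avg \<alpha> T n x\<bar> \<le> A *\<^sub>R G"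
      using A(1) by (simp add: W_def)
  next
    have "abs_powr (A *\<^sub>R G) p = (A powr p) *\<^sub>R abs_powr G p"
      unfolding L0_eq_generic using A(1) p by (simp add: abs_mult powr_mult)
    moreover have "(A * (p / (p - 1))) powr p = A powr p * (p / (p - 1)) powr p"
      using A(1) p by (intro powr_mult)
    ultimately show "upper (abs_powr (A *\<^sub>R G) p)
        (\<lambda>w. (A * (p / (p - 1))) powr p * I (abs_powr x p) w)"
      using upper_scale[OF upG, of "A powr p"] A(1) by (simp add: mult.assoc)
  qed
qed

lemma weighted_avg_maximal_norm:
  assumes BB: "BB_sequence (\<lambda>k. complex_of_real (\<alpha> k))" and p: "1 < p" and x: "x \<in> Lp M m p"
  shows "\<exists>y\<in>Lp M m p. \<forall>n\<ge>1. \<bar>weighted_avg \<alpha> T n x\<bar> \<le> y"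
    and "AE w in M. Lp_norm M m p (SUP n\<in>{1..}. \<bar>weighted_avg \<alpha> T n x\<bar>) w
      \<le> (p / (p - 1)) * (SUP k. \<bar>\<alpha> k\<bar>) * Lp_norm M m p x w"
proof -
  let ?s = "SUP n\<in>{1..}. \<bar>weighted_avg \<alpha> T n x\<bar>" and ?A = "SUP k. \<bar>\<alpha> k\<bar>"
  have bdd: "bdd_above (range (\<lambda>k. \<bar>\<alpha> k\<bar>))" using BB unfolding BB_sequence_def by simp
  have A: "\<bar>\<alpha> k\<bar> \<le> ?A" for k using bdd by (intro cSUP_upper) auto
  have A0: "0 \<le> ?A" using A[of 0] by linarith
  have xp: "intg (abs_powr x p)" using x by (simp add: Lp_def)
  \<comment> \<open>The bound on the weights has to be positive to divide by it, and all weights may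
    be 0; so \<open>\<epsilon>\<close> is added and sent to 0 through
    \<open>1 / real (Suc j)\<close> at the end.\<close>
  have dom: "\<exists>y. (\<forall>n\<ge>1. \<bar>weighted_avg \<alpha> T n x\<bar> \<le> y) \<and>
      upper (abs_powr y p) (\<lambda>w. ((?A + \<epsilon>) * (p / (p - 1))) powr p * I (abs_powr x p) w)"
    if "0 < \<epsilon>" for \<epsilon>
  proof (rule dominated_weighted_avg[OF BB _ _ p x, where A = "?A + \<epsilon>"])
    show "0 < ?A + \<epsilon>" using A0 that by simp
    show "\<bar>\<alpha> k\<bar> \<le> ?A + \<epsilon>" for k using A[of k] that by linarith
  qed (auto simp: Suc_le_eq)
  have powr0: "0 \<le> abs_powr y p" for y :: "'b L0" using p by (intro abs_powr_nonneg) simp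
  show "\<exists>y\<in>Lp M m p. \<forall>n\<ge>1. \<bar>weighted_avg \<alpha> T n x\<bar> \<le> y"
    using dom[of 1] integrableI[OF powr0] unfolding Lp_def by auto
  have est: "intg (abs_powr ?s p) \<and>
      (AE w in M. I (abs_powr ?s p) w \<le> ((?A + \<epsilon>) * (p / (p - 1))) powr p * I (abs_powr x p) w)" if eps: "0 < \<epsilon>" for \<epsilon>
  proof -
    obtain y where y: "\<And>n. n \<ge> 1 \<Longrightarrow> \<bar>weighted_avg \<alpha> T n x\<bar> \<le> y" and
      up: "upper (abs_powr y p) (\<lambda>w. ((?A + \<epsilon>) * (p / (p - 1))) powr p * I (abs_powr x p) w)"
      using dom[OF eps] by blast
    have "bdd_above ((\<lambda>n. \<bar>weighted_avg \<alpha> T n x\<bar>) ` {1..})" using y by (auto simp: bdd_above_def)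
    then have "\<bar>weighted_avg \<alpha> T 1 x\<bar> \<le> ?s" by (intro cSUP_upper) auto
    then have s0: "0 \<le> ?s" by (meson abs_ge_zero order_trans)
    have sy: "?s \<le> y" using y by (intro cSUP_least) auto
    have "\<bar>?s\<bar> \<le> \<bar>y\<bar>"
      unfolding abs_of_nonneg[OF s0] by (rule order_trans[OF sy abs_ge_self])
    then have le: "abs_powr ?s p \<le> abs_powr y p" using p by (intro abs_powr_mono) simp
    have i: "intg (abs_powr ?s p)" using integrableI[OF powr0 upper_mono[OF up le]] .
    then show ?thesis using integral_least[OF i upper_mono[OF up le]] by blast
  qed
  have "AE w in M. \<forall>j. I (abs_powr ?s p) w \<le> ((?A + 1 / real (Suc j)) * (p / (p - 1))) powr p * I (abs_powr x p) w"
    unfolding AE_all_countable using est by simp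
  moreover have "AE w in M. 0 \<le> I (abs_powr ?s p) w" using est[of 1] integral_nonneg by simp
  ultimately show "AE w in M. Lp_norm M m p ?s w \<le> (p / (p - 1)) * ?A * Lp_norm M m p x w"
    using integral_nonneg[OF xp]
  proof eventually_elim
    case (elim w)
    let ?Y = "I (abs_powr x p) w"
    have pp: "(u powr p) powr (1 / p) = u" if "0 \<le> u" for u using p that by (simp add: powr_powr)
    have "(I (abs_powr ?s p) w) powr (1 / p) \<le> (p / (p - 1)) * (?A + 1 / real (Suc j)) * ?Y powr (1 / p)" for j
    proof -
      let ?c = "(?A + 1 / real (Suc j)) * (p / (p - 1))"
      have c: "0 \<le> ?c" using A0 p by simp
      have "(I (abs_powr ?s p) w) powr (1 / p) \<le> (?c powr p * ?Y) powr (1 / p)"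
        using elim(1,2) p by (intro powr_mono2) auto
      also have "\<dots> = (?c powr p) powr (1 / p) * ?Y powr (1 / p)"
        using elim(3) by (intro powr_mult) 
      also have "(?c powr p) powr (1 / p) = ?c" by (rule pp[OF c])
      finally show ?thesis by (simp only: mult.commute)
    qed
    moreover have "(\<lambda>j. (p / (p - 1)) * (?A + 1 / real (Suc j)) * ?Y powr (1 / p))
        \<longlonglongrightarrow> (p / (p - 1)) * (?A + 0) * ?Y powr (1 / p)"
      by (intro tendsto_mult tendsto_add tendsto_const LIMSEQ_Suc[OF lim_1_over_n])
    ultimately show ?case unfolding Lp_norm_def by (intro LIMSEQ_le_const) auto
  qed
qed

end

theorem theorem5p1:
  fixes M :: "'w measure"
    and m :: "'b::complete_ba \<Rightarrow> 'w \<Rightarrow> real"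
    and \<iota> :: "'w set \<Rightarrow> 'b"
    and T :: "'b L0 \<Rightarrow> 'b L0"
    and \<alpha> :: "int \<Rightarrow> real"
  assumes "direct_sum_property M"
    and "L0_measure M m"
    and "d_decomposable M m"
    and "regular_embedding M m \<iota>"
    and "AE w in M. m top w = 1"
    and "BB_sequence (\<lambda>k. complex_of_real (\<alpha> k))"
    and "T \<in> C1inf M m"
  shows "(\<forall>x\<in>Lp M m 1. \<exists>y. o_converges (\<lambda>n. weighted_avg \<alpha> T (Suc n) x) y) \<and>
    (\<forall>p x. 1 < p \<and> x \<in> Lp M m p \<longrightarrow>
      (\<exists>y\<in>Lp M m p. \<forall>n\<ge>1. \<bar>weighted_avg \<alpha> T n x\<bar> \<le> y) \<and>
      (AE w in M. Lp_norm M m p (SUP n\<in>{1..}. \<bar>weighted_avg \<alpha> T n x\<bar>) w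
         \<le> (p / (p - 1)) * (SUP k. \<bar>\<alpha> k\<bar>) * Lp_norm M m p x w))"
proof -
  interpret L0_contraction M m \<iota> T
    using assms by unfold_locales
  have "\<exists>y. o_converges (\<lambda>n. weighted_avg \<alpha> T (Suc n) x) y" if x: "x \<in> Lp M m 1" for x
  proof (rule o_converges_generic)
    show "\<forall>\<^sup>*t. convergent (\<lambda>n. rv (weighted_avg \<alpha> T (Suc n) x) t)"
      using weighted_avg_converges[OF assms(6) x] by eventually_elim (rule iffD2[OF convergent_Suc_iff])
  qed
  then show ?thesis using weighted_avg_maximal_norm[OF assms(6)] by blast
qed

end
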